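(* Let $n\ge 1$ and let $\mathfrak{h}\cong\mathbb{C}^n$ be the reflection representation of the Weyl group $S_{n+1}$ of type $A_n$. Then $$HP_0(\mathcal{O}_{(\mathfrak{h}\oplus\mathfrak{h}^* )/S_{n+1}})\ \cong\ \mathbb{C}\ \cong\ HH_0(\mathcal{D}(\mathfrak{h})^{S_{n+1}}).$$
   Context: For a Poisson algebra $A$, $HP_0(A):=A/\{A,A\}$; for an associative algebra $B$, $HH_0(B):=B/[B,B]$. $\mathfrak{h}\oplus\mathfrak{h}^*$ carries its canonical symplectic form, so $\mathcal{O}_{(\mathfrak{h}\oplus\mathfrak{h}^* )/S_{n+1}}=\mathcal{O}_{\mathfrak{h}\oplus\mathfrak{h}^*}^{S_{n+1}}$ is a Poisson algebra. $\mathcal{D}(\mathfrak{h})$ is the ring of polynomial differential operators on $\mathfrak{h}$. *)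

theory Defs
  imports
    "HOL-Analysis.Derivative"
    "HOL-Library.Function_Algebras"
    "HOL-Combinatorics.Permutations"
    "HOL-Algebra.Module"
begin

section \<open>Complex vector spaces\<close>

class scaleC =
  fixes scaleC :: "complex \<Rightarrow> 'a \<Rightarrow> 'a"  (infixr \<open>*\<^sub>C\<close> 75)

class complex_vector = scaleC + ab_group_add +
  assumes scaleC_add_right: "a *\<^sub>C (x + y) = a *\<^sub>C x + a *\<^sub>C y"
    and scaleC_add_left: "(a + b) *\<^sub>C x = a *\<^sub>C x + b *\<^sub>C x"
    and scaleC_scaleC: "a *\<^sub>C b *\<^sub>C x = (a * b) *\<^sub>C x"
    and scaleC_one: "1 *\<^sub>C x = x"

global_interpretation complex_vector:
  vector_space "scaleC :: complex \<Rightarrow> 'a \<Rightarrow> 'a::complex_vector"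
  by unfold_locales (simp_all add: scaleC_add_right scaleC_add_left scaleC_scaleC scaleC_one)

instantiation complex :: complex_vector
begin

definition scaleC_complex :: "complex \<Rightarrow> complex \<Rightarrow> complex"
  where "scaleC_complex a x = a * x"

instance
  by standard (simp_all add: scaleC_complex_def algebra_simps)

end

instantiation "fun" :: (type, complex_vector) complex_vector
begin

definition scaleC_fun :: "complex \<Rightarrow> ('a \<Rightarrow> 'b) \<Rightarrow> 'a \<Rightarrow> 'b"
  where "scaleC_fun a f = (\<lambda>x. a *\<^sub>C f x)"

instance
  by standard
    (simp_all add: scaleC_fun_def fun_eq_iff
      scaleC_add_right scaleC_add_left scaleC_scaleC scaleC_one)

end

instantiation prod :: (complex_vector, complex_vector) complex_vector
begin

definition scaleC_prod :: "complex \<Rightarrow> 'a \<times> 'b \<Rightarrow> 'a \<times> 'b"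
  where "scaleC_prod a p = (a *\<^sub>C fst p, a *\<^sub>C snd p)"

instance
  by standard
    (simp_all add: scaleC_prod_def prod_eq_iff
      scaleC_add_right scaleC_add_left scaleC_scaleC scaleC_one)

end

text \<open>
  The quotient as a set of cosets. The summand \<open>w\<close> in the scalar multiplication is needed only for
  \<open>c = 0\<close>. The multiplicative fields of the record play no role for vector spaces.
\<close>

definition quotient_space ::
    "'a::complex_vector set \<Rightarrow> 'a set \<Rightarrow> (complex, 'a set) module" where
  "quotient_space A W =
    \<lparr>carrier = {{a + w | w. w \<in> W} | a. a \<in> A},
     mult = undefined, one = undefined,
     zero = W,
     add = (\<lambda>X Y. {x + y | x y. x \<in> X \<and> y \<in> Y}),
     smult = (\<lambda>c X. {c *\<^sub>C x + w | x w. x \<in> X \<and> w \<in> W})\<rparr>"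

definition complex_line :: "(complex, complex) module" where
  "complex_line =
    \<lparr>carrier = UNIV, mult = (*), one = 1, zero = 0, add = (+), smult = (*)\<rparr>"

definition linear_isomorphic ::
    "(complex, 'a) module \<Rightarrow> (complex, 'b) module \<Rightarrow> bool"  (infix \<open>\<cong>\<^sub>C\<close> 50) where
  "M \<cong>\<^sub>C N \<longleftrightarrow>
    (\<exists>\<phi>. bij_betw \<phi> (carrier M) (carrier N) \<and>
      (\<forall>x\<in>carrier M. \<forall>y\<in>carrier M. \<phi> (x \<oplus>\<^bsub>M\<^esub> y) = \<phi> x \<oplus>\<^bsub>N\<^esub> \<phi> y) \<and>
      (\<forall>c. \<forall>x\<in>carrier M. \<phi> (c \<odot>\<^bsub>M\<^esub> x) = c \<odot>\<^bsub>N\<^esub> \<phi> x))"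


section \<open>Polynomial functions and differential operators on a subspace\<close>

text \<open>
  A vector space is given by its carrier \<open>S\<close>, a subspace of a type of class
  \<^class>\<open>complex_vector\<close>. Functions on \<open>S\<close> are represented by functions on the whole type that
  vanish outside \<open>S\<close>, so that equality of functions on \<open>S\<close> is equality in HOL. The same convention
  is used for operators on the algebra of polynomial functions.
\<close>

definition dual :: "'a::complex_vector set \<Rightarrow> ('a \<Rightarrow> complex) set" where
  "dual S = {l. (\<forall>x\<in>S. \<forall>y\<in>S. l (x + y) = l x + l y) \<and>
                (\<forall>c. \<forall>x\<in>S. l (c *\<^sub>C x) = c * l x) \<and>
                (\<forall>x. x \<notin> S \<longrightarrow> l x = 0)}"

inductive_set poly_fun :: "'a::complex_vector set \<Rightarrow> ('a \<Rightarrow> complex) set"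
  for S :: "'a set" where
  const: "(\<lambda>x. if x \<in> S then c else 0) \<in> poly_fun S"
| linear: "l \<in> dual S \<Longrightarrow> l \<in> poly_fun S"
| add: "f \<in> poly_fun S \<Longrightarrow> g \<in> poly_fun S \<Longrightarrow> f + g \<in> poly_fun S"
| mult: "f \<in> poly_fun S \<Longrightarrow> g \<in> poly_fun S \<Longrightarrow> f * g \<in> poly_fun S"

definition dir_deriv ::
    "'a::complex_vector set \<Rightarrow> 'a \<Rightarrow> ('a \<Rightarrow> complex) \<Rightarrow> 'a \<Rightarrow> complex" where
  "dir_deriv S v f = (\<lambda>p. if p \<in> S then deriv (\<lambda>t. f (p + t *\<^sub>C v)) 0 else 0)"

text \<open>
  The algebra of polynomial differential operators is the subalgebra of the endomorphisms of
  \<^term>\<open>poly_fun S\<close> generated by multiplications by polynomial functions and by derivatives along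
  constant vector fields; its product is composition. Scalar multiples are covered because the
  constant functions are polynomial.
\<close>

inductive_set diff_op ::
    "'a::complex_vector set \<Rightarrow> (('a \<Rightarrow> complex) \<Rightarrow> ('a \<Rightarrow> complex)) set"
  for S :: "'a set" where
  mult: "f \<in> poly_fun S \<Longrightarrow> (\<lambda>g. if g \<in> poly_fun S then f * g else 0) \<in> diff_op S"
| deriv: "v \<in> S \<Longrightarrow> (\<lambda>g. if g \<in> poly_fun S then dir_deriv S v g else 0) \<in> diff_op S"
| add: "D \<in> diff_op S \<Longrightarrow> E \<in> diff_op S \<Longrightarrow> D + E \<in> diff_op S"
| comp: "D \<in> diff_op S \<Longrightarrow> E \<in> diff_op S \<Longrightarrow> D \<circ> E \<in> diff_op S"


section \<open>The canonical symplectic form and its Poisson bracket\<close>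

definition symp_form ::
    "'a \<times> ('a \<Rightarrow> complex) \<Rightarrow> 'a \<times> ('a \<Rightarrow> complex) \<Rightarrow> complex" where
  "symp_form u v = snd v (fst u) - snd u (fst v)"

text \<open>
  The Hamiltonian vector field of \<open>f\<close> at \<open>p\<close> is determined by \<open>\<omega>(X, w) = df\<^sub>p(w)\<close> for all
  \<open>w \<in> S \<oplus> S\<^sup>*\<close>. The bracket is \<open>{f, g} = \<omega>(X\<^sub>f, X\<^sub>g)\<close>; thus \<open>{x, \<xi>} = 1\<close> for dual coordinates
  \<open>x\<close> on \<open>S\<close> and \<open>\<xi>\<close> on \<open>S\<^sup>*\<close>.
\<close>

definition ham_vec ::
    "'a::complex_vector set \<Rightarrow> ('a \<times> ('a \<Rightarrow> complex) \<Rightarrow> complex) \<Rightarrow>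
      'a \<times> ('a \<Rightarrow> complex) \<Rightarrow> 'a \<times> ('a \<Rightarrow> complex)" where
  "ham_vec S f p =
    (THE X. X \<in> S \<times> dual S \<and>
      (\<forall>w\<in>S \<times> dual S. symp_form X w = dir_deriv (S \<times> dual S) w f p))"

definition poisson ::
    "'a::complex_vector set \<Rightarrow> ('a \<times> ('a \<Rightarrow> complex) \<Rightarrow> complex) \<Rightarrow>
      ('a \<times> ('a \<Rightarrow> complex) \<Rightarrow> complex) \<Rightarrow> 'a \<times> ('a \<Rightarrow> complex) \<Rightarrow> complex" where
  "poisson S f g =
    (\<lambda>p. if p \<in> S \<times> dual S then symp_form (ham_vec S f p) (ham_vec S g p) else 0)"


section \<open>Zeroth Poisson and Hochschild homology\<close>

definition HP0 ::
    "'a::complex_vector set \<Rightarrow> ('a \<Rightarrow> 'a \<Rightarrow> 'a) \<Rightarrow> (complex, 'a set) module" where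
  "HP0 A bracket =
    quotient_space A (complex_vector.span {bracket f g | f g. f \<in> A \<and> g \<in> A})"

definition HH0 ::
    "'a::complex_vector set \<Rightarrow> ('a \<Rightarrow> 'a \<Rightarrow> 'a) \<Rightarrow> (complex, 'a set) module" where
  "HH0 B mul =
    quotient_space B (complex_vector.span {mul a b - mul b a | a b. a \<in> B \<and> b \<in> B})"


section \<open>The reflection representation of the symmetric group\<close>

definition refl_rep :: "nat \<Rightarrow> (nat \<Rightarrow> complex) set" where
  "refl_rep n = {x. (\<forall>i>n. x i = 0) \<and> (\<Sum>i\<le>n. x i) = 0}"

definition weyl_group :: "nat \<Rightarrow> (nat \<Rightarrow> nat) set" where
  "weyl_group n = {\<sigma>. \<sigma> permutes {..n}}"

definition act_vec :: "(nat \<Rightarrow> nat) \<Rightarrow> (nat \<Rightarrow> complex) \<Rightarrow> nat \<Rightarrow> complex" where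
  "act_vec \<sigma> x = x \<circ> inv_into UNIV \<sigma>"

text \<open>The action on functions induced by an action \<open>\<rho>\<close> on points; on linear functionals this is
  the contragredient action.\<close>

definition act_fun ::
    "((nat \<Rightarrow> nat) \<Rightarrow> 'a \<Rightarrow> 'a) \<Rightarrow> (nat \<Rightarrow> nat) \<Rightarrow> ('a \<Rightarrow> complex) \<Rightarrow> 'a \<Rightarrow> complex" where
  "act_fun \<rho> \<sigma> f = f \<circ> \<rho> (inv_into UNIV \<sigma>)"

definition act_cotangent ::
    "(nat \<Rightarrow> nat) \<Rightarrow> (nat \<Rightarrow> complex) \<times> ((nat \<Rightarrow> complex) \<Rightarrow> complex) \<Rightarrow>
      (nat \<Rightarrow> complex) \<times> ((nat \<Rightarrow> complex) \<Rightarrow> complex)" where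
  "act_cotangent \<sigma> = map_prod (act_vec \<sigma>) (act_fun act_vec \<sigma>)"

definition act_op ::
    "(nat \<Rightarrow> nat) \<Rightarrow>
      (((nat \<Rightarrow> complex) \<Rightarrow> complex) \<Rightarrow> ((nat \<Rightarrow> complex) \<Rightarrow> complex)) \<Rightarrow>
      ((nat \<Rightarrow> complex) \<Rightarrow> complex) \<Rightarrow> ((nat \<Rightarrow> complex) \<Rightarrow> complex)" where
  "act_op \<sigma> D = act_fun act_vec \<sigma> \<circ> D \<circ> act_fun act_vec (inv_into UNIV \<sigma>)"

definition inv_poly_fun ::
    "nat \<Rightarrow> ((nat \<Rightarrow> complex) \<times> ((nat \<Rightarrow> complex) \<Rightarrow> complex) \<Rightarrow> complex) set" where
  "inv_poly_fun n =
    {f \<in> poly_fun (refl_rep n \<times> dual (refl_rep n)).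
      \<forall>\<sigma>\<in>weyl_group n. act_fun act_cotangent \<sigma> f = f}"

definition inv_diff_op ::
    "nat \<Rightarrow> (((nat \<Rightarrow> complex) \<Rightarrow> complex) \<Rightarrow> ((nat \<Rightarrow> complex) \<Rightarrow> complex)) set" where
  "inv_diff_op n =
    {D \<in> diff_op (refl_rep n). \<forall>\<sigma>\<in>weyl_group n. act_op \<sigma> D = D}"

end

theory Submission
  imports Defs
begin

text \<open>
  Write $N = n + 1$. Both algebras are generated by elements $X_i, Y_i$ ($0 \le i \le n$) with
  $\sum_i X_i = \sum_i Y_i = 0$ whose brackets $\{Y_i, X_j\}$ are multiples of
  $\delta_{ij} - 1/N$, and the symmetric group permutes the indices; the bracket is the Poisson
  bracket in one case and the commutator in the other, where products commute up to shorter words.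

  \<^emph>\<open>Invariants are spanned by 1 and brackets.\<close> Modulo the elements whose symmetrization is of this form,
  one may apply permutations and drop brackets with
  $T = \sum_i X_i^a Y_i^{b+1}$. For a word $q X_n^{m+1}$ the bracket with $T$ is, up to a factor
  and up to shorter words and words with more factors $X_n$, equal to
  $(X_n^a Y_n^b - \frac1N \sum_i X_i^a Y_i^b)\, q X_n^m$. The case $a + b = 1$ kills all words with a
  letter of index $n$ in front of $X_n^m$, so the other cases give
  $\sum_{i<n} X_i^a Y_i^b\, q X_n^m \equiv 0$, and Weyl's polarization argument (induction on the
  number of distinct indices) kills the remaining words.

  \<^emph>\<open>1 is not a combination of brackets.\<close> For functions, evaluate at the origin: the differential of an invariant
  there is an invariant covector, hence zero. For operators, there is a trace on
  $\mathcal D(\mathfrak h)$ twisted by the $N$-cycle $c$, which has no fixed vectors in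
  $\mathfrak h \oplus \mathfrak h^*$: it sends $D$ with normally ordered symbol $p$ to
  $(e^Q p)(0)$ for a suitable second order operator $Q$ with constant coefficients. On
  $c$-invariant operators it is a genuine trace, and its value at 1 is 1.
\<close>

section \<open>Algebras generated by two permuted families of letters\<close>

text \<open>The letters stay redundant on purpose. A basis of h would break the symmetry, whereas
  with N letters per family the group only renames indices, and the relations saying that each
  family sums to zero cancel the averages produced by the term -1/N. The operator Q arises as
  follows. On symbols, left multiplication by X_k is multiplication by a linear function, and right
  multiplication adds a derivative in a momentum direction; for Y_k it is the left side that gains a
  derivative, in a position direction. Conjugation by e^Q turns multiplication by a linear function
  l into l + [Q, l], and l vanishes at the origin. The twisted trace property on letters thus
  becomes a linear equation that prescribes the difference of [Q, X_k] and [Q, X_{c(k)}], and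
  likewise for Y. It is solvable because 1 - c is invertible on h. The N-cycles are the only
  permutations without nonzero fixed vectors in h, whence the choice of c.\<close>

abbreviation cspan :: "'a::complex_vector set \<Rightarrow> 'a set" where
  "cspan \<equiv> complex_vector.span"

abbreviation csubspace :: "'a::complex_vector set \<Rightarrow> bool" where
  "csubspace \<equiv> complex_vector.subspace"

lemmas csubspace_simps =
  complex_vector.subspace_0 complex_vector.subspace_add complex_vector.subspace_diff
  complex_vector.subspace_scale complex_vector.subspace_sum

text \<open>The algebra laws below hold only on a carrier, so the induction over a span has to carry
  membership in \<open>A\<close> through sums and scalar multiples.\<close>

lemma span_induct_on:
  assumes "z \<in> cspan W" and "csubspace A" and "W \<subseteq> A"
    and zero: "P 0"
    and add: "\<And>x y. x \<in> A \<Longrightarrow> y \<in> A \<Longrightarrow> P x \<Longrightarrow> P y \<Longrightarrow> P (x + y)"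
    and scale: "\<And>c x. x \<in> A \<Longrightarrow> P x \<Longrightarrow> P (c *\<^sub>C x)"
    and base: "\<And>x. x \<in> W \<Longrightarrow> P x"
  shows "P z"
proof -
  have "csubspace {x \<in> A. P x}"
    using assms(2) zero add scale by (auto simp: complex_vector.subspace_def)
  moreover have "W \<subseteq> {x \<in> A. P x}" using assms(3) base by auto
  ultimately have "cspan W \<subseteq> {x \<in> A. P x}" by (rule complex_vector.span_minimal[rotated])
  then show ?thesis using assms(1) by auto
qed

text \<open>The letter \<open>(True, i)\<close> stands for $X_i$ and \<open>(False, i)\<close> for $Y_i$.\<close>

locale algebra_with_letters =
  fixes A :: "'a::complex_vector set"
    and mul :: "'a \<Rightarrow> 'a \<Rightarrow> 'a"  (infixl \<open>\<star>\<close> 70)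
    and e :: 'a
    and gen :: "bool \<times> nat \<Rightarrow> 'a"
  assumes sub: "csubspace A"
    and e_in [simp]: "e \<in> A"
    and mul_in [simp]: "a \<in> A \<Longrightarrow> b \<in> A \<Longrightarrow> a \<star> b \<in> A"
    and mul_assoc: "a \<in> A \<Longrightarrow> b \<in> A \<Longrightarrow> c \<in> A \<Longrightarrow> a \<star> b \<star> c = a \<star> (b \<star> c)"
    and e_mul [simp]: "a \<in> A \<Longrightarrow> e \<star> a = a"
    and mul_e [simp]: "a \<in> A \<Longrightarrow> a \<star> e = a"
    and add_mul: "a \<in> A \<Longrightarrow> b \<in> A \<Longrightarrow> c \<in> A \<Longrightarrow> (a + b) \<star> c = a \<star> c + b \<star> c"
    and mul_add: "a \<in> A \<Longrightarrow> b \<in> A \<Longrightarrow> c \<in> A \<Longrightarrow> a \<star> (b + c) = a \<star> b + a \<star> c"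
    and scale_mul: "a \<in> A \<Longrightarrow> b \<in> A \<Longrightarrow> (k *\<^sub>C a) \<star> b = k *\<^sub>C (a \<star> b)"
    and mul_scale: "a \<in> A \<Longrightarrow> b \<in> A \<Longrightarrow> a \<star> (k *\<^sub>C b) = k *\<^sub>C (a \<star> b)"
    and gen_in [simp]: "gen s \<in> A"
begin

definition ev :: "(bool \<times> nat) list \<Rightarrow> 'a" where
  "ev w = foldr (\<lambda>s. mul (gen s)) w e"

lemma ev_Nil [simp]: "ev [] = e" and ev_Cons: "ev (s # w) = gen s \<star> ev w"
  by (simp_all add: ev_def)

lemma zero_in [simp]: "0 \<in> A"
  and add_in [simp]: "a \<in> A \<Longrightarrow> b \<in> A \<Longrightarrow> a + b \<in> A"
  and diff_in [simp]: "a \<in> A \<Longrightarrow> b \<in> A \<Longrightarrow> a - b \<in> A"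
  and scale_in [simp]: "a \<in> A \<Longrightarrow> k *\<^sub>C a \<in> A"
  and sum_in: "(\<And>i. i \<in> I \<Longrightarrow> f i \<in> A) \<Longrightarrow> sum f I \<in> A"
  using sub by (auto intro: csubspace_simps)

lemma ev_in [simp]: "ev w \<in> A"
  by (induction w) (simp_all add: ev_Cons)

lemma ev_append: "ev (u @ v) = ev u \<star> ev v"
  by (induction u) (simp_all add: ev_Cons mul_assoc)

lemma zero_mul [simp]: "a \<in> A \<Longrightarrow> 0 \<star> a = 0"
  and mul_zero [simp]: "a \<in> A \<Longrightarrow> a \<star> 0 = 0"
  using add_mul[of 0 0 a] mul_add[of a 0 0] by auto

lemma mul_diff: "a \<in> A \<Longrightarrow> b \<in> A \<Longrightarrow> c \<in> A \<Longrightarrow> a \<star> (b - c) = a \<star> b - a \<star> c"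
  using mul_add[of a "b - c" c] by (simp add: algebra_simps)

lemma diff_mul: "a \<in> A \<Longrightarrow> b \<in> A \<Longrightarrow> c \<in> A \<Longrightarrow> (b - c) \<star> a = b \<star> a - c \<star> a"
  using add_mul[of "b - c" c a] by (simp add: algebra_simps)

lemma sum_mul:
  "finite I \<Longrightarrow> (\<And>i. i \<in> I \<Longrightarrow> f i \<in> A) \<Longrightarrow> a \<in> A \<Longrightarrow> sum f I \<star> a = (\<Sum>i\<in>I. f i \<star> a)"
  by (induction I rule: finite_induct) (simp_all add: add_mul sum_in)

lemma span_ev_sub: "cspan (ev ` W) \<subseteq> A"
  using sub by (intro complex_vector.span_minimal) auto

lemma span_ev_mul_left:
  assumes "z \<in> cspan (ev ` W)" "(\<lambda>w. u @ w) ` W \<subseteq> W'"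
  shows "ev u \<star> z \<in> cspan (ev ` W')"
proof (rule span_induct_on[OF assms(1) sub])
  show "ev u \<star> x \<in> cspan (ev ` W')" if "x \<in> ev ` W" for x
    using that assms(2) by (force simp: ev_append[symmetric] intro: complex_vector.span_base)
qed (auto simp: mul_add mul_scale complex_vector.span_zero intro: complex_vector.span_add
    complex_vector.span_scale)

lemma span_ev_mul_right:
  assumes "z \<in> cspan (ev ` W)" "(\<lambda>w. w @ u) ` W \<subseteq> W'"
  shows "z \<star> ev u \<in> cspan (ev ` W')"
proof (rule span_induct_on[OF assms(1) sub])
  show "x \<star> ev u \<in> cspan (ev ` W')" if "x \<in> ev ` W" for x
    using that assms(2) by (force simp: ev_append[symmetric] intro: complex_vector.span_base)
qed (auto simp: add_mul scale_mul complex_vector.span_zero intro: complex_vector.span_add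
    complex_vector.span_scale)

lemma span_ev_mono: "z \<in> cspan (ev ` W) \<Longrightarrow> W \<subseteq> W' \<Longrightarrow> z \<in> cspan (ev ` W')"
  by (meson complex_vector.span_mono image_mono in_mono)

lemma words_mul_closed:
  assumes "a \<in> cspan (range ev)" "b \<in> cspan (range ev)"
  shows "a \<star> b \<in> cspan (range ev)"
proof (rule span_induct_on[OF assms(1) sub])
  have "b \<in> A" using assms(2) span_ev_sub[of UNIV] by auto
  then show "0 \<star> b \<in> cspan (range ev)" by (simp add: complex_vector.span_zero)
  show "(x + y) \<star> b \<in> cspan (range ev)"
    if "x \<in> A" "y \<in> A" "x \<star> b \<in> cspan (range ev)" "y \<star> b \<in> cspan (range ev)" for x y
    using that \<open>b \<in> A\<close> by (simp add: add_mul complex_vector.span_add)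
  show "(c *\<^sub>C x) \<star> b \<in> cspan (range ev)" if "x \<in> A" "x \<star> b \<in> cspan (range ev)" for c x
    using that \<open>b \<in> A\<close> by (simp add: scale_mul complex_vector.span_scale)
  show "x \<star> b \<in> cspan (range ev)" if "x \<in> range ev" for x
    using that span_ev_mul_left[of b UNIV _ UNIV] assms(2) by auto
qed auto

lemma gen_in_words: "gen s \<in> cspan (range ev)"
proof -
  have "gen s = ev [s]" by (simp add: ev_Cons)
  then show ?thesis by (simp add: complex_vector.span_base)
qed

lemma e_in_words: "e \<in> cspan (range ev)"
  using ev_Nil by (metis complex_vector.span_base rangeI)

section \<open>Iterated commutators with a fixed element\<close>

definition ad :: "'a \<Rightarrow> 'a \<Rightarrow> 'a" where
  "ad m a = a \<star> m - m \<star> a"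

context
  fixes m assumes m [simp]: "m \<in> A"
begin

lemma ad_in [simp]: "a \<in> A \<Longrightarrow> ad m a \<in> A"
  by (simp add: ad_def)

lemma ad_add: "a \<in> A \<Longrightarrow> b \<in> A \<Longrightarrow> ad m (a + b) = ad m a + ad m b"
  by (simp add: ad_def add_mul mul_add)

lemma ad_scale: "a \<in> A \<Longrightarrow> ad m (k *\<^sub>C a) = k *\<^sub>C ad m a"
  by (simp add: ad_def scale_mul mul_scale complex_vector.scale_right_diff_distrib)

lemma ad_zero [simp]: "ad m 0 = 0"
  by (simp add: ad_def)

lemma ad_e [simp]: "ad m e = 0"
  by (simp add: ad_def)

lemma ad_power_in [simp]: "a \<in> A \<Longrightarrow> (ad m ^^ k) a \<in> A"
  by (induction k) simp_all

lemma ad_power_add: "a \<in> A \<Longrightarrow> b \<in> A \<Longrightarrow> (ad m ^^ k) (a + b) = (ad m ^^ k) a + (ad m ^^ k) b"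
  by (induction k) (simp_all add: ad_add)

lemma ad_power_scale: "a \<in> A \<Longrightarrow> (ad m ^^ k) (c *\<^sub>C a) = c *\<^sub>C (ad m ^^ k) a"
  by (induction k) (simp_all add: ad_scale)

lemma ad_power_zero: "(ad m ^^ k) 0 = 0"
  by (induction k) simp_all

lemma ad_power_zero_mono: "(ad m ^^ k) a = 0 \<Longrightarrow> k \<le> j \<Longrightarrow> (ad m ^^ j) a = 0"
  by (rotate_tac, induction j rule: dec_induct) simp_all

lemma ad_mul:
  assumes "a \<in> A" "b \<in> A" and a: "ad m a = c *\<^sub>C e"
  shows "ad m (a \<star> b) = a \<star> ad m b + c *\<^sub>C b"
proof -
  have "ad m (a \<star> b) = a \<star> ad m b + ad m a \<star> b"
    using assms(1,2) by (simp add: ad_def mul_diff diff_mul mul_assoc)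
  then show ?thesis using assms by (simp add: scale_mul)
qed

text \<open>In the binomial Leibniz formula only the terms with at most one \<open>ad m\<close> on
  \<open>a\<close> survive, because \<open>ad m a\<close> is a scalar and \<open>ad m\<close> kills
  scalars.\<close>

lemma ad_power_mul:
  assumes "a \<in> A" "b \<in> A" "ad m a = c *\<^sub>C e"
  shows "(ad m ^^ Suc k) (a \<star> b) = a \<star> (ad m ^^ Suc k) b + (of_nat (Suc k) * c) *\<^sub>C (ad m ^^ k) b"
proof (induction k)
  case 0
  show ?case using ad_mul[OF assms] by simp
next
  case (Suc k)
  have "(ad m ^^ Suc (Suc k)) (a \<star> b) = ad m ((ad m ^^ Suc k) (a \<star> b))" by simp
  also have "\<dots> = ad m (a \<star> (ad m ^^ Suc k) b) + (of_nat (Suc k) * c) *\<^sub>C (ad m ^^ Suc k) b"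
    unfolding Suc.IH using assms(1,2) by (subst ad_add) (simp_all add: ad_scale)
  also have "ad m (a \<star> (ad m ^^ Suc k) b) = a \<star> (ad m ^^ Suc (Suc k)) b + c *\<^sub>C (ad m ^^ Suc k) b"
    using ad_mul[OF assms(1) ad_power_in[OF assms(2), of "Suc k"] assms(3)] by simp
  finally show ?case
    by (simp only: of_nat_Suc[of "Suc k"] distrib_right mult_1 scaleC_add_left add.assoc)
qed

text \<open>Each letter raises the order of nilpotency of a word by at most one. This makes the
  series for the conjugation of \<open>a\<close> by the exponential of \<open>m\<close>
  finite.\<close>

lemma ad_nilpotent:
  assumes gen: "\<And>s. \<exists>c. ad m (gen s) = c *\<^sub>C e" and a: "a \<in> cspan (range ev)"
  shows "\<exists>K. \<forall>k\<ge>K. (ad m ^^ k) a = 0"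
proof (rule span_induct_on[OF a sub])
  show "\<exists>K. \<forall>k\<ge>K. (ad m ^^ k) (x + y) = 0"
    if "x \<in> A" "y \<in> A" "\<exists>K. \<forall>k\<ge>K. (ad m ^^ k) x = 0" "\<exists>K. \<forall>k\<ge>K. (ad m ^^ k) y = 0" for x y
  proof -
    from that obtain K L where "\<forall>k\<ge>K. (ad m ^^ k) x = 0" "\<forall>k\<ge>L. (ad m ^^ k) y = 0" by blast
    then show ?thesis using that(1,2) by (intro exI[of _ "max K L"]) (simp add: ad_power_add)
  qed
  have "\<exists>K. (ad m ^^ K) (ev w) = 0" for w
  proof (induction w)
    case Nil
    show ?case by (intro exI[of _ 1]) simp
  next
    case (Cons s w)
    then obtain K where K: "(ad m ^^ K) (ev w) = 0" by blast
    obtain c where "ad m (gen s) = c *\<^sub>C e" using gen by blast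
    from ad_power_mul[OF gen_in ev_in this, of K w] K
    have "(ad m ^^ Suc K) (ev (s # w)) = 0"
      unfolding ev_Cons by simp
    then show ?case by blast
  qed
  then show "\<exists>K. \<forall>k\<ge>K. (ad m ^^ k) x = 0" if "x \<in> range ev" for x
    using that ad_power_zero_mono by blast
qed (auto simp: ad_power_scale ad_power_zero)

end

end

text \<open>One spanning argument serves both halves of the theorem. \<open>\<theta>\<close>
  measures how far letters are from commuting and \<open>\<omega>\<close> is the bracket of letters.
  For functions \<open>\<theta>\<close> is 0 and \<open>\<kappa>\<close> is -1; for operators both
  forms are the commutator and \<open>\<kappa>\<close> is 1.\<close>

locale symmetric_weyl_algebra = algebra_with_letters A mul e gen
  for A :: "'a::complex_vector set"
    and mul :: "'a \<Rightarrow> 'a \<Rightarrow> 'a"  (infixl \<open>\<star>\<close> 70)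
    and e gen +
  fixes n :: nat
    and br :: "'a \<Rightarrow> 'a \<Rightarrow> 'a"
    and act :: "(nat \<Rightarrow> nat) \<Rightarrow> 'a \<Rightarrow> 'a"
    and \<theta> :: "bool \<times> nat \<Rightarrow> bool \<times> nat \<Rightarrow> complex"
    and \<omega> :: "bool \<times> nat \<Rightarrow> bool \<times> nat \<Rightarrow> complex"
    and \<kappa> :: complex
  assumes br_in [simp]: "a \<in> A \<Longrightarrow> b \<in> A \<Longrightarrow> br a b \<in> A"
    and br_add_left: "a \<in> A \<Longrightarrow> b \<in> A \<Longrightarrow> c \<in> A \<Longrightarrow> br (a + b) c = br a c + br b c"
    and br_add_right: "a \<in> A \<Longrightarrow> b \<in> A \<Longrightarrow> c \<in> A \<Longrightarrow> br a (b + c) = br a b + br a c"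
    and leibniz_left: "a \<in> A \<Longrightarrow> b \<in> A \<Longrightarrow> c \<in> A \<Longrightarrow> br (a \<star> b) c = a \<star> br b c + br a c \<star> b"
    and leibniz_right: "a \<in> A \<Longrightarrow> b \<in> A \<Longrightarrow> c \<in> A \<Longrightarrow> br a (b \<star> c) = br a b \<star> c + b \<star> br a c"
    and gen_zero: "i > n \<Longrightarrow> gen (x, i) = 0"
    and gen_sum: "(\<Sum>i\<le>n. gen (x, i)) = 0"
    and gen_comm: "gen s \<star> gen t - gen t \<star> gen s = \<theta> s t *\<^sub>C e"
    and br_gen: "br (gen s) (gen t) = \<omega> s t *\<^sub>C e"
    and \<omega>_TT: "\<omega> (True, i) (True, j) = 0"
    and \<omega>_FT: "i \<le> n \<Longrightarrow> j \<le> n \<Longrightarrow>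
      \<omega> (False, i) (True, j) = \<kappa> * (of_bool (i = j) - 1 / of_nat (Suc n))"
    and \<kappa>_nonzero: "\<kappa> \<noteq> 0"
    and generated: "A \<subseteq> cspan (range ev)"
    and act_in [simp]: "\<sigma> permutes {..n} \<Longrightarrow> a \<in> A \<Longrightarrow> act \<sigma> a \<in> A"
    and act_add: "\<sigma> permutes {..n} \<Longrightarrow> a \<in> A \<Longrightarrow> b \<in> A \<Longrightarrow> act \<sigma> (a + b) = act \<sigma> a + act \<sigma> b"
    and act_scale: "\<sigma> permutes {..n} \<Longrightarrow> a \<in> A \<Longrightarrow> act \<sigma> (k *\<^sub>C a) = k *\<^sub>C act \<sigma> a"
    and act_mul: "\<sigma> permutes {..n} \<Longrightarrow> a \<in> A \<Longrightarrow> b \<in> A \<Longrightarrow> act \<sigma> (a \<star> b) = act \<sigma> a \<star> act \<sigma> b"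
    and act_br: "\<sigma> permutes {..n} \<Longrightarrow> a \<in> A \<Longrightarrow> b \<in> A \<Longrightarrow> act \<sigma> (br a b) = br (act \<sigma> a) (act \<sigma> b)"
    and act_e: "\<sigma> permutes {..n} \<Longrightarrow> act \<sigma> e = e"
    and act_gen: "\<sigma> permutes {..n} \<Longrightarrow> act \<sigma> (gen s) = gen (apsnd \<sigma> s)"
begin

section \<open>Bracket and action on words, up to shorter words\<close>

lemma A_eq: "A = cspan (range ev)"
proof
  show "A \<subseteq> cspan (range ev)" by (rule generated)
  show "cspan (range ev) \<subseteq> A" using sub by (intro complex_vector.span_minimal) auto
qed

lemma A_induct [consumes 1, case_names zero add scale ev]:
  assumes "z \<in> A" "P 0"
    "\<And>x y. x \<in> A \<Longrightarrow> y \<in> A \<Longrightarrow> P x \<Longrightarrow> P y \<Longrightarrow> P (x + y)"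
    "\<And>c x. x \<in> A \<Longrightarrow> P x \<Longrightarrow> P (c *\<^sub>C x)"
    "\<And>w. P (ev w)"
  shows "P z"
  using assms sub by (intro span_induct_on[of z "range ev" A P]) (auto simp: A_eq[symmetric])

lemma br_zero [simp]: "a \<in> A \<Longrightarrow> br 0 a = 0" "a \<in> A \<Longrightarrow> br a 0 = 0"
  using br_add_left[of 0 0 a] br_add_right[of a 0 0] by auto

lemma act_zero [simp]: "\<sigma> permutes {..n} \<Longrightarrow> act \<sigma> 0 = 0"
  using act_add[of \<sigma> 0 0] by auto

lemma br_sum_left:
  "finite I \<Longrightarrow> (\<And>i. i \<in> I \<Longrightarrow> f i \<in> A) \<Longrightarrow> a \<in> A \<Longrightarrow> br (sum f I) a = (\<Sum>i\<in>I. br (f i) a)"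
  by (induction I rule: finite_induct) (simp_all add: br_add_left sum_in)

lemma br_sum_right:
  "finite I \<Longrightarrow> (\<And>i. i \<in> I \<Longrightarrow> f i \<in> A) \<Longrightarrow> a \<in> A \<Longrightarrow> br a (sum f I) = (\<Sum>i\<in>I. br a (f i))"
  by (induction I rule: finite_induct) (simp_all add: br_add_right sum_in)

lemma act_sum:
  "finite I \<Longrightarrow> \<sigma> permutes {..n} \<Longrightarrow> (\<And>i. i \<in> I \<Longrightarrow> f i \<in> A) \<Longrightarrow>
    act \<sigma> (sum f I) = (\<Sum>i\<in>I. act \<sigma> (f i))"
  by (induction I rule: finite_induct) (simp_all add: act_add sum_in)

lemma br_e_left [simp]: "a \<in> A \<Longrightarrow> br e a = 0"
  using leibniz_left[of e e a] by simp

lemma br_e_right [simp]: "a \<in> A \<Longrightarrow> br a e = 0"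
  using leibniz_right[of a e e] by simp

lemma act_ev: "\<sigma> permutes {..n} \<Longrightarrow> act \<sigma> (ev w) = ev (map (apsnd \<sigma>) w)"
  by (induction w) (simp_all add: ev_Cons act_mul act_gen act_e)

text \<open>By \<open>gen_comm\<close> every swap of neighbours costs a multiple of the word without
  the two letters, so the error is two letters shorter, not just one.\<close>

lemma ev_move_front:
  "ev (u @ s # v) - ev (s # u @ v) \<in> cspan (ev ` {w. length w < length u + length v})"
proof (induction u)
  case (Cons t u)
  let ?L = "\<lambda>k. cspan (ev ` {w. length w < k})"
  have "ev [t] \<star> (ev (u @ s # v) - ev (s # u @ v)) \<in> ?L (Suc (length u + length v))"
    by (rule span_ev_mul_left[OF Cons.IH]) auto
  moreover have "ev [t] \<star> (ev (u @ s # v) - ev (s # u @ v)) = ev (t # u @ s # v) - ev (t # s # u @ v)"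
    by (simp add: ev_Cons mul_diff)
  moreover have "ev (t # s # u @ v) - ev (s # t # u @ v) = \<theta> t s *\<^sub>C ev (u @ v)"
  proof -
    have "ev (t # s # u @ v) - ev (s # t # u @ v)
        = (gen t \<star> gen s - gen s \<star> gen t) \<star> ev (u @ v)"
      by (simp add: ev_Cons mul_assoc diff_mul)
    then show ?thesis by (simp add: gen_comm scale_mul)
  qed
  moreover have "\<theta> t s *\<^sub>C ev (u @ v) \<in> ?L (Suc (length u + length v))"
    by (intro complex_vector.span_scale complex_vector.span_base) auto
  ultimately have "(ev (t # u @ s # v) - ev (t # s # u @ v)) + (ev (t # s # u @ v) - ev (s # t # u @ v))
      \<in> ?L (Suc (length u + length v))"
    by (metis complex_vector.span_add)
  then show ?case by simp
qed (simp add: complex_vector.span_zero)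

lemma ev_perm:
  "mset u = mset w \<Longrightarrow> ev u - ev w \<in> cspan (ev ` {v. length v < length w})"
proof (induction u arbitrary: w)
  case (Cons s u)
  then have "s \<in> set w" by (metis list.set_intros(1) mset_eq_setD)
  then obtain w1 w2 where w: "w = w1 @ s # w2" by (meson split_list)
  with Cons.prems have "mset u = mset (w1 @ w2)" by simp
  from Cons.IH[OF this] have "ev u - ev (w1 @ w2) \<in> cspan (ev ` {v. length v < length (w1 @ w2)})" .
  then have "ev [s] \<star> (ev u - ev (w1 @ w2)) \<in> cspan (ev ` {v. length v < length w})"
    by (rule span_ev_mul_left) (auto simp: w)
  moreover have "ev w - ev (s # w1 @ w2) \<in> cspan (ev ` {v. length v < length w})"
    unfolding w by (rule span_ev_mono[OF ev_move_front]) auto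
  ultimately have "ev [s] \<star> (ev u - ev (w1 @ w2)) - (ev w - ev (s # w1 @ w2))
    \<in> cspan (ev ` {v. length v < length w})"
    by (rule complex_vector.span_diff)
  then show ?case by (simp add: ev_Cons mul_diff)
qed (simp add: complex_vector.span_zero)

lemma br_gen_ev: "br (gen s) (ev v) \<in> cspan (ev ` {w. length w + 1 \<le> length v})"
proof (induction v)
  case (Cons t v)
  have "br (gen s) (ev (t # v)) = \<omega> s t *\<^sub>C ev v + ev [t] \<star> br (gen s) (ev v)"
    by (simp add: ev_Cons leibniz_right br_gen scale_mul)
  moreover have "ev [t] \<star> br (gen s) (ev v) \<in> cspan (ev ` {w. length w + 1 \<le> length (t # v)})"
    by (rule span_ev_mul_left[OF Cons.IH]) auto
  moreover have "\<omega> s t *\<^sub>C ev v \<in> cspan (ev ` {w. length w + 1 \<le> length (t # v)})"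
    by (intro complex_vector.span_scale complex_vector.span_base) auto
  ultimately show ?case by (simp add: complex_vector.span_add)
qed (simp add: complex_vector.span_zero)

text \<open>Each Leibniz term pairs a letter of \<open>u\<close> with a letter of \<open>v\<close>
  and replaces the pair by a scalar, so two letters are lost.\<close>

lemma br_ev_ev: "br (ev u) (ev v) \<in> cspan (ev ` {w. length w + 2 \<le> length u + length v})"
proof (induction u)
  case (Cons s u)
  have "br (ev (s # u)) (ev v) = ev [s] \<star> br (ev u) (ev v) + br (gen s) (ev v) \<star> ev u"
    by (simp add: ev_Cons leibniz_left)
  moreover have "ev [s] \<star> br (ev u) (ev v) \<in> cspan (ev ` {w. length w + 2 \<le> length (s # u) + length v})"
    by (rule span_ev_mul_left[OF Cons.IH]) auto
  moreover have "br (gen s) (ev v) \<star> ev u \<in> cspan (ev ` {w. length w + 2 \<le> length (s # u) + length v})"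
    by (rule span_ev_mul_right[OF br_gen_ev]) auto
  ultimately show ?case by (simp add: complex_vector.span_add)
qed (simp add: complex_vector.span_zero)

lemma br_ev_True: "br (ev (replicate a (True, i))) (gen (True, j)) = 0"
  by (induction a) (simp_all add: ev_Cons leibniz_left br_gen \<omega>_TT complex_vector.scale_zero_left)

lemma br_ev_False:
  "br (ev (replicate (Suc b) (False, i))) (gen (True, j)) =
    (of_nat (Suc b) * \<omega> (False, i) (True, j)) *\<^sub>C ev (replicate b (False, i))"
proof (induction b)
  case (Suc b)
  have "br (ev (replicate (Suc (Suc b)) (False, i))) (gen (True, j)) =
    gen (False, i) \<star> br (ev (replicate (Suc b) (False, i))) (gen (True, j)) +
    br (gen (False, i)) (gen (True, j)) \<star> ev (replicate (Suc b) (False, i))"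
    by (simp add: ev_Cons leibniz_left)
  also have "\<dots> = (of_nat (Suc b) * \<omega> (False, i) (True, j)) *\<^sub>C ev (replicate (Suc b) (False, i))
     + \<omega> (False, i) (True, j) *\<^sub>C ev (replicate (Suc b) (False, i))"
    unfolding Suc.IH by (simp add: br_gen scale_mul mul_scale ev_Cons)
  also have "\<dots> = (of_nat (Suc (Suc b)) * \<omega> (False, i) (True, j)) *\<^sub>C ev (replicate (Suc b) (False, i))"
    by (simp only: scaleC_add_left[symmetric] of_nat_Suc[of "Suc b"] distrib_right mult_1 add.commute)
  finally show ?case .
qed (simp add: ev_Cons br_gen)

section \<open>Brackets with the blocks X_i^a Y_i^b\<close>

abbreviation XY :: "nat \<Rightarrow> nat \<Rightarrow> nat \<Rightarrow> (bool \<times> nat) list" where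
  "XY a b i \<equiv> replicate a (True, i) @ replicate b (False, i)"

abbreviation Xn :: "bool \<times> nat" where
  "Xn \<equiv> (True, n)"

lemma br_XY_gen:
  "br (ev (XY a (Suc b) i)) (gen (True, j)) =
    (of_nat (Suc b) * \<omega> (False, i) (True, j)) *\<^sub>C ev (XY a b i)"
proof -
  have "br (ev (XY a (Suc b) i)) (gen (True, j)) =
      ev (replicate a (True, i)) \<star> br (ev (replicate (Suc b) (False, i))) (gen (True, j)) +
      br (ev (replicate a (True, i))) (gen (True, j)) \<star> ev (replicate (Suc b) (False, i))"
    by (simp only: ev_append leibniz_left ev_in gen_in)
  then show ?thesis
    by (simp only: br_ev_True br_ev_False mul_scale zero_mul ev_append ev_in add_0_right)
qed

text \<open>The Leibniz rule yields \<open>Suc m\<close> terms that differ only in the place where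
  the bracket was inserted; by \<open>ev_perm\<close> they agree up to shorter words.\<close>

lemma br_power:
  assumes "z \<in> A" "br z (gen s) = c *\<^sub>C ev u"
  shows "br z (ev (replicate (Suc m) s)) - (of_nat (Suc m) * c) *\<^sub>C ev (u @ replicate m s)
    \<in> cspan (ev ` {v. length v < length u + m})"
proof (induction m)
  case 0
  show ?case using assms by (simp add: ev_Cons complex_vector.span_zero)
next
  case (Suc m)
  let ?L = "cspan (ev ` {v. length v < length u + Suc m})"
  let ?k = "of_nat (Suc m) * c" and ?R = "ev (replicate (Suc m) s)" and ?v = "u @ replicate m s"
  have "ev [s] \<star> (br z ?R - ?k *\<^sub>C ev ?v) \<in> ?L"
    by (rule span_ev_mul_left[OF Suc.IH]) auto
  moreover have "ev [s] \<star> (br z ?R - ?k *\<^sub>C ev ?v) = gen s \<star> br z ?R - ?k *\<^sub>C ev (s # ?v)"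
    using assms(1) by (simp add: ev_Cons mul_diff mul_scale)
  ultimately have 1: "gen s \<star> br z ?R - ?k *\<^sub>C ev (s # ?v) \<in> ?L" by simp
  have "ev (s # ?v) - ev (u @ replicate (Suc m) s) \<in> ?L"
    using ev_perm[of "s # ?v" "u @ replicate (Suc m) s"] by simp
  from complex_vector.span_add[OF 1 complex_vector.span_scale[OF this, of ?k]]
  have 2: "gen s \<star> br z ?R - ?k *\<^sub>C ev (u @ replicate (Suc m) s) \<in> ?L"
    by (simp only: complex_vector.scale_right_diff_distrib diff_add_cancel add_diff_eq)
  have "br z (ev (replicate (Suc (Suc m)) s)) = br z (gen s) \<star> ?R + gen s \<star> br z ?R"
    using assms(1) leibniz_right[of z "gen s" ?R] by (simp only: replicate_Suc[of "Suc m"] ev_Cons[of s "replicate (Suc m) s"]) simp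
  also have "br z (gen s) \<star> ?R = c *\<^sub>C ev (u @ replicate (Suc m) s)"
    unfolding assms(2) ev_append by (simp add: scale_mul)
  finally have "br z (ev (replicate (Suc (Suc m)) s)) -
      (of_nat (Suc (Suc m)) * c) *\<^sub>C ev (u @ replicate (Suc m) s)
    = gen s \<star> br z ?R - ?k *\<^sub>C ev (u @ replicate (Suc m) s)"
    by (simp only: scaleC_add_left of_nat_Suc[of "Suc m"] distrib_right mult_1) simp
  with 2 show ?case by simp
qed

text \<open>The leading term comes from the bracket hitting the power of X_n. The shape of
  \<open>W\<close> matches the induction in which this is used: shorter words and words of equal
  length with more factors X_n are already settled there.\<close>

lemma br_XY_word:
  fixes q :: "(bool \<times> nat) list" and a b m :: nat
  defines "d \<equiv> length q + a + b + m"
  defines "W \<equiv> {w. length w < d \<or> length w = d \<and> count_list w Xn > m}"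
  shows "br (ev (XY a (Suc b) i)) (ev (q @ replicate (Suc m) Xn)) -
    (of_nat (Suc m) * (of_nat (Suc b) * \<omega> (False, i) Xn)) *\<^sub>C ev (XY a b i @ q @ replicate m Xn)
    \<in> cspan (ev ` W)"
proof -
  let ?z = "ev (XY a (Suc b) i)" and ?R = "ev (replicate (Suc m) Xn)"
  let ?c = "of_nat (Suc m) * (of_nat (Suc b) * \<omega> (False, i) Xn)"
  \<comment> \<open>Two letters are lost in the bracket of the block with \<open>q\<close>, so at
    most \<open>d\<close> remain, and all \<open>m + 1\<close> trailing copies of X_n
    survive.\<close>
  have A: "br ?z (ev q) \<star> ?R \<in> cspan (ev ` W)"
  proof (cases q)
    case (Cons x q')
    have "count_list (replicate k Xn) Xn = k" for k by (induction k) auto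
    then show ?thesis
      by (intro span_ev_mul_right[OF br_ev_ev]) (auto simp: W_def d_def Cons simp del: replicate_Suc)
  qed (simp add: complex_vector.span_zero del: replicate_Suc)
  have "ev q \<star> (br ?z ?R - ?c *\<^sub>C ev (XY a b i @ replicate m Xn)) \<in> cspan (ev ` W)"
    by (rule span_ev_mul_left, rule br_power[OF ev_in br_XY_gen])
       (auto simp: W_def d_def simp del: replicate_Suc)
  moreover have "ev q \<star> (br ?z ?R - ?c *\<^sub>C ev (XY a b i @ replicate m Xn)) =
    ev q \<star> br ?z ?R - ?c *\<^sub>C ev (q @ XY a b i @ replicate m Xn)"
    by (simp only: mul_diff mul_scale br_in ev_in scale_in ev_append mul_in)
  ultimately have B: "ev q \<star> br ?z ?R - ?c *\<^sub>C ev (q @ XY a b i @ replicate m Xn) \<in> cspan (ev ` W)"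
    by simp
  have "ev (q @ XY a b i @ replicate m Xn) - ev (XY a b i @ q @ replicate m Xn) \<in> cspan (ev ` W)"
    by (rule span_ev_mono[OF ev_perm]) (auto simp: W_def d_def)
  note C = complex_vector.span_scale[OF this, of ?c]
  have "br ?z (ev (q @ replicate (Suc m) Xn)) = br ?z (ev q) \<star> ?R + ev q \<star> br ?z ?R"
    by (simp only: ev_append[of q] leibniz_right ev_in)
  with complex_vector.span_add[OF complex_vector.span_add[OF A B] C] show ?thesis
    by (simp only: complex_vector.scale_right_diff_distrib) (simp del: replicate_Suc)
qed

section \<open>The spanning argument for words\<close>

definition T :: "nat \<Rightarrow> nat \<Rightarrow> 'a" where
  "T a b = (\<Sum>i\<le>n. ev (XY a b i))"

lemma T_in [simp]: "T a b \<in> A"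
  by (auto simp: T_def intro: sum_in)

lemma permutes_transpose: "i \<le> n \<Longrightarrow> j \<le> n \<Longrightarrow> Transposition.transpose i j permutes {..n}"
  by (intro permutes_swap_id) auto

text \<open>\<open>M\<close> stands for the elements whose symmetrization is spanned by 1 and
  brackets of invariants. The inductions are nested: upwards on the length of the word, for fixed
  length downwards on the number of factors X_n, and inside that on the number of distinct indices
  in the rest of the word.\<close>

lemma module_contains_words:
  assumes M: "csubspace M" and eM: "e \<in> M"
    and brM: "\<And>a b z. z \<in> A \<Longrightarrow> br (T a b) z \<in> M"
    and conjM: "\<And>\<sigma> w. \<sigma> permutes {..n} \<Longrightarrow> ev w - ev (map (apsnd \<sigma>) w) \<in> M"
  shows "ev w \<in> M"
proof (induction "length w" arbitrary: w rule: less_induct)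
  case less
  define d where "d = length w"
  have short: "ev v \<in> M" if "length v < d" for v using less that by (simp add: d_def)
  have perm: "ev u \<in> M \<longleftrightarrow> ev v \<in> M" if "mset u = mset v" "length v = d" for u v
  proof -
    have "cspan (ev ` {w. length w < length v}) \<subseteq> M"
      using short that(2) by (intro complex_vector.span_minimal M) auto
    with ev_perm[OF that(1)] have "ev u - ev v \<in> M" by auto
    with M show ?thesis
      by (metis complex_vector.subspace_diff complex_vector.subspace_add add_diff_cancel_left'
          diff_add_cancel diff_diff_eq2)
  qed
  \<comment> \<open>The downward induction on \<open>m\<close> starts at \<open>Suc d\<close>, where
    no word of length \<open>d\<close> qualifies.\<close>
  have "length v = d \<Longrightarrow> count_list v Xn \<ge> m \<Longrightarrow> ev v \<in> M" if "m \<le> Suc d" for m v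
    using that
  proof (induction m arbitrary: v rule: inc_induct)
    case base
    then show ?case using count_le_length[of v Xn] by simp
  next
    case (step m)
    \<comment> \<open>Sum \<open>br_XY_word\<close> over \<open>i\<close>. With second index
      \<open>n\<close>, \<open>\<omega>_FT\<close> supplies the coefficient that is 1 at
      \<open>i = n\<close>, diminished by 1/N throughout, so one word minus an average
      remains.\<close>
    have key: "(\<kappa> * of_nat (Suc m * Suc b)) *\<^sub>C (ev (XY a b n @ q @ replicate m Xn)
        - (1 / of_nat (Suc n)) *\<^sub>C (\<Sum>i\<le>n. ev (XY a b i @ q @ replicate m Xn))) \<in> M"
      if d: "length q + a + b + m = d" for q a b
    proof -
      let ?W = "{w. length w < d \<or> length w = d \<and> count_list w Xn > m}"
      let ?R = "ev (q @ replicate (Suc m) Xn)"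
      let ?c = "\<kappa> * of_nat (Suc m * Suc b)" and ?N = "1 / of_nat (Suc n)"
      let ?w = "\<lambda>i. XY a b i @ q @ replicate m Xn"
      have W: "cspan (ev ` ?W) \<subseteq> M"
        using short step.IH by (intro complex_vector.span_minimal M) auto
      let ?c' = "\<lambda>i. of_nat (Suc m) * (of_nat (Suc b) * \<omega> (False, i) Xn)"
      have "br (ev (XY a (Suc b) i)) ?R - ?c' i *\<^sub>C ev (?w i) \<in> M" for i
        using subsetD[OF W, OF br_XY_word[where q=q and a=a and b=b and m=m, unfolded d], of i]
        by (simp only: append_assoc)
      then have "(\<Sum>i\<le>n. br (ev (XY a (Suc b) i)) ?R - ?c' i *\<^sub>C ev (?w i)) \<in> M"
        by (intro complex_vector.subspace_sum M)
      moreover have "(\<Sum>i\<le>n. br (ev (XY a (Suc b) i)) ?R) = br (T a (Suc b)) ?R"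
        unfolding T_def by (rule br_sum_left[symmetric]) auto
      ultimately have "br (T a (Suc b)) ?R - (\<Sum>i\<le>n. ?c' i *\<^sub>C ev (?w i)) \<in> M"
        by (simp add: sum_subtractf)
      from complex_vector.subspace_diff[OF M brM[OF ev_in, of a "Suc b" "q @ replicate (Suc m) Xn"] this]
      have "(\<Sum>i\<le>n. ?c' i *\<^sub>C ev (?w i)) \<in> M" by simp
      also have "(\<Sum>i\<le>n. ?c' i *\<^sub>C ev (?w i)) = (\<Sum>i\<le>n. (?c * of_bool (i = n)) *\<^sub>C ev (?w i)
          - (?c * ?N) *\<^sub>C ev (?w i))"
      proof (intro sum.cong refl)
        fix i assume "i \<in> {..n}"
        then have "?c' i = ?c * of_bool (i = n) - ?c * ?N" by (simp add: \<omega>_FT algebra_simps add_divide_distrib)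
        then show "?c' i *\<^sub>C ev (?w i) = (?c * of_bool (i = n)) *\<^sub>C ev (?w i) - (?c * ?N) *\<^sub>C ev (?w i)"
          by (simp only: complex_vector.scale_left_diff_distrib)
      qed
      also have "\<dots> = (\<Sum>i\<le>n. if i = n then ?c *\<^sub>C ev (?w i) else 0) - (\<Sum>i\<le>n. (?c * ?N) *\<^sub>C ev (?w i))"
        unfolding sum_subtractf by (intro arg_cong2[of _ _ _ _ minus] sum.cong) auto
      also have "\<dots> = ?c *\<^sub>C (ev (?w n) - ?N *\<^sub>C (\<Sum>i\<le>n. ev (?w i)))"
        by (simp add: complex_vector.scale_right_diff_distrib complex_vector.scale_sum_right)
      finally show ?thesis .
    qed
    have R: "ev (XY a b n @ q @ replicate m Xn)
        - (1 / of_nat (Suc n)) *\<^sub>C (\<Sum>i\<le>n. ev (XY a b i @ q @ replicate m Xn)) \<in> M"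
      if "length q + a + b + m = d" for q a b
    proof -
      have "\<kappa> * of_nat (Suc m * Suc b) \<noteq> 0" using \<kappa>_nonzero by (simp del: mult_Suc_right mult_Suc of_nat_Suc of_nat_mult)
      from complex_vector.subspace_scale[OF M key[OF that], of "1 / (\<kappa> * of_nat (Suc m * Suc b))"] this
      show ?thesis by (simp add: scaleC_scaleC scaleC_one del: mult_Suc_right mult_Suc of_nat_Suc of_nat_mult)
    qed
    \<comment> \<open>If \<open>a + b = 1\<close>, the average runs over a complete family of
      letters and vanishes by \<open>gen_sum\<close>, leaving a single word.\<close>
    have letter_n: "ev ((x, n) # q @ replicate m Xn) \<in> M" if "Suc (length q) + m = d" for x q
    proof -
      define a b :: nat where "a = of_bool x" and "b = of_bool (\<not> x)"
      have XY: "XY a b i = [(x, i)]" for i by (cases x) (simp_all add: a_def b_def)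
      have "(\<Sum>i\<le>n. ev (XY a b i @ q @ replicate m Xn)) = (\<Sum>i\<le>n. gen (x, i)) \<star> ev (q @ replicate m Xn)"
        by (simp add: XY ev_Cons sum_mul)
      also have "\<dots> = 0" by (simp add: gen_sum)
      finally show ?thesis
        using R[of q a b] that by (simp add: XY) (simp add: a_def b_def)
    qed
    have power_sum: "(\<Sum>i<n. ev (XY a b i @ q @ replicate m Xn)) \<in> M"
      if d: "length q + a + b + m = d" "a + b > 0" for q a b
    proof -
      let ?w = "\<lambda>i. XY a b i @ q @ replicate m Xn" and ?N = "of_nat (Suc n) :: complex"
      \<comment> \<open>The summand with \<open>i = n\<close> begins with a letter of index
        \<open>n\<close>. Splitting that letter off makes \<open>letter_n\<close> applicable, so the
        summand can be removed from the average.\<close>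
      have n: "ev (?w n) \<in> M"
      proof (cases a)
        case 0
        then obtain b' where "b = Suc b'" using d(2) by (cases b) auto
        with 0 d(1) letter_n[of "replicate b' (False, n) @ q" False] show ?thesis by simp
      next
        case (Suc a')
        with d(1) letter_n[of "XY a' b n @ q" True] show ?thesis by simp
      qed
      from complex_vector.subspace_diff[OF M this R[OF d(1)]]
      have "(1 / ?N) *\<^sub>C (\<Sum>i\<le>n. ev (?w i)) \<in> M" by simp
      from complex_vector.subspace_scale[OF M this, of ?N]
      have "(\<Sum>i\<le>n. ev (?w i)) \<in> M" by (simp add: scaleC_scaleC scaleC_one del: of_nat_Suc)
      from complex_vector.subspace_diff[OF M this n] show ?thesis
        by (simp add: lessThan_Suc_atMost[symmetric])
    qed
    \<comment> \<open>Polarization: collect the letters of one index \<open>i0\<close> of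
      \<open>q\<close> into a block and let the index \<open>i\<close> of that block run below
      \<open>n\<close>. If \<open>i\<close> occurs in the remaining letters, the word has fewer
      distinct indices. If it does not, the word is conjugate to the one with \<open>i0\<close>. So
      \<open>power_sum\<close> leaves a positive multiple of the original word, up to order.\<close>
    have distinct_indices: "ev (q @ replicate m Xn) \<in> M"
      if "length q + m = d" "q \<noteq> []" "\<forall>x. (x, n) \<notin> set q" "snd ` set q \<subseteq> {..n}" for q
      using that
    proof (induction "card (snd ` set q)" arbitrary: q rule: less_induct)
      case (less q)
      obtain x0 i0 where i0: "(x0, i0) \<in> set q" using less.prems(2) by (cases q) auto
      define q' where "q' = filter (\<lambda>s. snd s \<noteq> i0) q"
      define a b where "a = count_list q (True, i0)" and "b = count_list q (False, i0)"
      have mset_q: "mset q = mset (XY a b i0 @ q')"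
      proof (rule multiset_eqI)
        fix s :: "bool \<times> nat"
        obtain x i where s: "s = (x, i)" by (cases s)
        have "count (mset (filter P q)) s = (if P s then count_list q s else 0)" for P
          by (simp add: count_mset)
        then show "count (mset q) s = count (mset (XY a b i0 @ q')) s"
          unfolding q'_def by (cases x) (auto simp: s a_def b_def count_mset)
      qed
      from arg_cong[OF this, of size] have len: "length q' + a + b = length q" by simp
      have "count_list q (x0, i0) \<noteq> 0" using i0 by (simp add: count_list_0_iff)
      then have ab: "a + b > 0" by (cases x0) (simp_all add: a_def b_def)
      have i0n: "i0 < n" using i0 less.prems(3,4) by (force simp: order.strict_iff_order)
      let ?I = "snd ` set q'" and ?w = "\<lambda>i. XY a b i @ q' @ replicate m Xn"
      have fin: "?I \<subseteq> {..<n}"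
        using less.prems(3,4) by (force simp: q'_def order.strict_iff_order)
      have I: "snd ` set q = insert i0 ?I" "i0 \<notin> ?I" using i0 by (force simp: q'_def)+
      have in_I: "ev (?w i) \<in> M" if "i \<in> ?I" for i
      proof -
        have sub: "set (XY a b i @ q') \<subseteq> {(True, i), (False, i)} \<union> set q'" by auto
        have "snd ` set (XY a b i @ q') \<subseteq> insert i ?I" by auto
        also have "\<dots> = ?I" using that by (rule insert_absorb)
        finally have "card (snd ` set (XY a b i @ q')) < card (snd ` set q)"
          using I by (simp add: card_insert_if) (metis List.finite_set card_mono finite_imageI le_imp_less_Suc)
        then have "ev ((XY a b i @ q') @ replicate m Xn) \<in> M"
        proof (rule less.hyps)
          show "length (XY a b i @ q') + m = d" using len less.prems(1) by simp
          show "XY a b i @ q' \<noteq> []" using ab by auto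
          show "\<forall>x. (x, n) \<notin> set (XY a b i @ q')" using that fin by force
          show "snd ` set (XY a b i @ q') \<subseteq> {..n}" using that fin by force
        qed
        then show ?thesis by simp
      qed
      have not_in_I: "ev (?w i0) - ev (?w i) \<in> M" if "i < n" "i \<notin> ?I" for i
      proof -
        let ?\<sigma> = "Transposition.transpose i0 i"
        \<comment> \<open>Both \<open>i0\<close> and \<open>i\<close> are below \<open>n\<close> and
          absent from \<open>q'\<close>, so the transposition moves only the leading block and
          leaves the factors X_n alone.\<close>
        have "apsnd ?\<sigma> s = s" if "s \<in> set (q' @ replicate m Xn)" for s
        proof -
          have "snd s \<noteq> i0" "snd s \<noteq> i"
            using that i0n \<open>i < n\<close> \<open>i \<notin> ?I\<close> I(2) by (force split: if_splits)+
          then show ?thesis by (cases s) simp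
        qed
        then have "map (apsnd ?\<sigma>) (q' @ replicate m Xn) = q' @ replicate m Xn"
          by (intro map_idI)
        moreover have "map (apsnd ?\<sigma>) (XY a b i0) = XY a b i" by simp
        ultimately have "map (apsnd ?\<sigma>) (?w i0) = ?w i" by (simp only: map_append)
        then show ?thesis using conjM[OF permutes_transpose[of i0 i], of "?w i0"] i0n that(1) by simp
      qed
      have "(\<Sum>i<n. ev (?w i)) \<in> M" using power_sum[of q' a b] len ab less.prems(1) by simp
      moreover have "(\<Sum>i<n. ev (?w i)) = (\<Sum>i\<in>{..<n} - ?I. ev (?w i)) + (\<Sum>i\<in>?I. ev (?w i))"
        by (rule sum.subset_diff[OF fin]) simp
      moreover have "(\<Sum>i\<in>?I. ev (?w i)) \<in> M" using in_I by (intro complex_vector.subspace_sum M)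
      ultimately have "(\<Sum>i\<in>{..<n} - ?I. ev (?w i)) \<in> M"
        using complex_vector.subspace_diff[OF M] by fastforce
      moreover have "(\<Sum>i\<in>{..<n} - ?I. ev (?w i0) - ev (?w i)) \<in> M"
        using not_in_I by (intro complex_vector.subspace_sum M) auto
      ultimately have "(\<Sum>i\<in>{..<n} - ?I. ev (?w i0)) \<in> M"
        using complex_vector.subspace_add[OF M] by (fastforce simp: sum_subtractf)
      then have "of_nat (card ({..<n} - ?I)) *\<^sub>C ev (?w i0) \<in> M"
        by (simp add: complex_vector.sum_constant_scale)
      \<comment> \<open>\<open>i0\<close> itself is among the counted indices, so the multiplicity
        can be divided out.\<close>
      moreover have "card ({..<n} - ?I) \<noteq> 0" using i0n I(2) by auto
      ultimately have "ev (?w i0) \<in> M"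
        using complex_vector.subspace_scale[OF M, of "of_nat (card ({..<n} - ?I)) *\<^sub>C ev (?w i0)"
            "1 / of_nat (card ({..<n} - ?I))"]
        by (simp add: scaleC_scaleC scaleC_one del: card_0_eq)
      then show ?case
        using perm[of "?w i0" "q @ replicate m Xn"] mset_q less.prems(1) by simp
    qed
    show ?case
    proof (cases "snd ` set v \<subseteq> {..n}")
      case False
      then obtain x i v1 v2 where "v = v1 @ (x, i) # v2" "i > n"
        by (force dest: split_list simp: not_le)
      then have "ev v = 0" by (simp add: ev_append ev_Cons gen_zero)
      then show ?thesis using M by (simp add: complex_vector.subspace_0)
    next
      case True
      show ?thesis
      proof (cases "count_list v Xn = m")
        case False
        then show ?thesis using step.IH[of v] step.prems by simp
      next
        case count: True
        define q where "q = filter (\<lambda>s. s \<noteq> Xn) v"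
        have mset_v: "mset v = mset (q @ replicate m Xn)"
        proof (rule multiset_eqI)
          fix s show "count (mset v) s = count (mset (q @ replicate m Xn)) s"
            using count by (auto simp: q_def count_mset)
        qed
        from arg_cong[OF this, of size] have len: "length q + m = d" using step.prems by simp
        have "ev (q @ replicate m Xn) \<in> M"
        proof (cases "q = []")
          case q: True
          show ?thesis
          proof (cases m)
            case 0
            then show ?thesis using eM q by simp
          next
            case (Suc m')
            \<comment> \<open>For a pure power of X_n the relation \<open>R\<close> with
              \<open>a = b = 0\<close> is vacuous. The sum of the X_i Y_i replaces it: its bracket
              acts as an Euler field and reproduces the power with factor
              \<open>of_nat (Suc m') * \<kappa>\<close>, because the averaged term vanishes by
              \<open>gen_sum\<close>.\<close>
            let ?R = "replicate (Suc m') Xn"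
            have "br (ev (XY 1 1 i)) (ev ?R) - (of_nat (Suc m') * \<omega> (False, i) Xn) *\<^sub>C ev ([(True, i)] @ replicate m' Xn) \<in> M" for i
            proof -
              have "cspan (ev ` {v. length v < length [(True, i)] + m'}) \<subseteq> M"
                using short len q Suc by (intro complex_vector.span_minimal M) auto
              moreover have "br (ev (XY 1 1 i)) (gen Xn) = \<omega> (False, i) Xn *\<^sub>C ev [(True, i)]"
                using br_XY_gen[of 1 i 0 n] by simp
              ultimately show ?thesis using br_power[OF ev_in, of "XY 1 1 i" Xn _ "[(True, i)]" m'] by blast
            qed
            then have "(\<Sum>i\<le>n. br (ev (XY 1 1 i)) (ev ?R) - (of_nat (Suc m') * \<omega> (False, i) Xn) *\<^sub>C ev ([(True, i)] @ replicate m' Xn)) \<in> M"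
              by (intro complex_vector.subspace_sum M) auto
            moreover have "(\<Sum>i\<le>n. br (ev (XY 1 1 i)) (ev ?R)) = br (T 1 1) (ev ?R)"
              unfolding T_def by (rule br_sum_left[symmetric]) auto
            ultimately have "br (T 1 1) (ev ?R) - (\<Sum>i\<le>n. (of_nat (Suc m') * \<omega> (False, i) Xn) *\<^sub>C ev ([(True, i)] @ replicate m' Xn)) \<in> M"
              by (simp only: sum_subtractf)
            from complex_vector.subspace_diff[OF M brM[OF ev_in, of 1 1 ?R] this]
            have "(\<Sum>i\<le>n. (of_nat (Suc m') * \<omega> (False, i) Xn) *\<^sub>C ev ([(True, i)] @ replicate m' Xn)) \<in> M" by simp
            also have "(\<Sum>i\<le>n. (of_nat (Suc m') * \<omega> (False, i) Xn) *\<^sub>C ev ([(True, i)] @ replicate m' Xn))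
              = (of_nat (Suc m') * \<kappa>) *\<^sub>C ((\<Sum>i\<le>n. if i = n then gen Xn \<star> ev (replicate m' Xn) else 0) - (1 / of_nat (Suc n)) *\<^sub>C (\<Sum>i\<le>n. gen (True, i) \<star> ev (replicate m' Xn)))"
              unfolding complex_vector.scale_sum_right sum_subtractf[symmetric]
              by (intro sum.cong)
                (auto simp: \<omega>_FT ev_Cons scaleC_scaleC algebra_simps complex_vector.scale_left_diff_distrib
                  complex_vector.scale_right_diff_distrib)
            also have "(\<Sum>i\<le>n. gen (True, i) \<star> ev (replicate m' Xn)) = 0"
              using sum_mul[of "{..n}" "\<lambda>i. gen (True, i)" "ev (replicate m' Xn)"] by (simp add: gen_sum)
            finally have "(of_nat (Suc m') * \<kappa>) *\<^sub>C ev ?R \<in> M"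
              by (simp add: ev_Cons)
            from complex_vector.subspace_scale[OF M this, of "1 / (of_nat (Suc m') * \<kappa>)"]
            show ?thesis using \<kappa>_nonzero q Suc
              by (simp add: scaleC_scaleC scaleC_one del: of_nat_Suc)
          qed
        next
          case q: False
          show ?thesis
          proof (cases "\<exists>x. (x, n) \<in> set q")
            case True
            then obtain x q1 q2 where q12: "q = q1 @ (x, n) # q2" by (meson split_list)
            then have "ev ((x, n) # (q1 @ q2) @ replicate m Xn) \<in> M"
              using letter_n[of "q1 @ q2" x] len by simp
            then show ?thesis
              using perm[of "(x, n) # (q1 @ q2) @ replicate m Xn" "q @ replicate m Xn"] q12 len by simp
          next
            case False
            moreover have "snd ` set q \<subseteq> {..n}" using \<open>snd ` set v \<subseteq> {..n}\<close> by (auto simp: q_def)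
            ultimately show ?thesis using distinct_indices[OF len q] by blast
          qed
        qed
        then show ?thesis using perm[OF mset_v] len by simp
      qed
    qed
  qed
  from this[OF le0 d_def[symmetric] le0] show ?case .
qed

section \<open>Invariants and symmetrization\<close>

definition B :: "'a set" where
  "B = {a \<in> A. \<forall>\<sigma>. \<sigma> permutes {..n} \<longrightarrow> act \<sigma> a = a}"

lemma B_in: "a \<in> B \<Longrightarrow> a \<in> A"
  by (simp add: B_def)

lemma B_subspace: "csubspace B"
  by (auto simp: B_def complex_vector.subspace_def act_add act_scale)

lemma e_B: "e \<in> B"
  by (simp add: B_def act_e)

lemma br_B: "a \<in> B \<Longrightarrow> b \<in> B \<Longrightarrow> br a b \<in> B"
  by (simp add: B_def act_br)

lemma T_B: "T a b \<in> B"
proof -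
  have "act \<sigma> (T a b) = T a b" if \<sigma>: "\<sigma> permutes {..n}" for \<sigma>
  proof -
    have "act \<sigma> (T a b) = (\<Sum>i\<le>n. ev (XY a b (\<sigma> i)))"
      unfolding T_def using \<sigma> by (simp add: act_sum act_ev)
    also have "\<dots> = T a b"
      unfolding T_def using sum.permute[OF \<sigma>, of "\<lambda>i. ev (XY a b i)"] by (simp add: o_def)
    finally show ?thesis .
  qed
  then show ?thesis by (simp add: B_def)
qed

definition symmetrize :: "'a \<Rightarrow> 'a" where
  "symmetrize z = (\<Sum>\<sigma> | \<sigma> permutes {..n}. act \<sigma> z)"

lemma finite_perms: "finite {\<sigma>. \<sigma> permutes {..n::nat}}"
  by (simp add: finite_permutations)

lemma symmetrize_add: "a \<in> A \<Longrightarrow> b \<in> A \<Longrightarrow> symmetrize (a + b) = symmetrize a + symmetrize b"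
  by (simp add: symmetrize_def act_add sum.distrib)

lemma symmetrize_scale: "a \<in> A \<Longrightarrow> symmetrize (k *\<^sub>C a) = k *\<^sub>C symmetrize a"
  by (simp add: symmetrize_def act_scale complex_vector.scale_sum_right)

lemma symmetrize_zero: "symmetrize 0 = 0"
  by (simp add: symmetrize_def)

text \<open>That \<open>act\<close> is a group action is derived from its effect on letters rather
  than assumed: on words it composes the maps of indices.\<close>

lemma act_comp:
  assumes "\<sigma> permutes {..n}" "\<tau> permutes {..n}" "a \<in> A"
  shows "act \<sigma> (act \<tau> a) = act (\<sigma> \<circ> \<tau>) a"
  using assms(3)
proof (induction rule: A_induct)
  case (ev w)
  have "apsnd \<sigma> \<circ> apsnd \<tau> = (apsnd (\<sigma> \<circ> \<tau>) :: bool \<times> nat \<Rightarrow> _)" by auto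
  with assms(1,2) permutes_compose[OF assms(2,1)] show ?case by (simp only: act_ev map_map)
qed (use assms(1,2) permutes_compose[OF assms(2,1)] in
    \<open>simp_all only: act_add act_scale act_zero act_in\<close>)

lemma symmetrize_B: "a \<in> A \<Longrightarrow> symmetrize a \<in> B"
proof -
  assume a: "a \<in> A"
  have "act \<tau> (symmetrize a) = symmetrize a" if \<tau>: "\<tau> permutes {..n}" for \<tau>
  proof -
    have "act \<tau> (symmetrize a) = (\<Sum>\<sigma> | \<sigma> permutes {..n}. act (\<tau> \<circ> \<sigma>) a)"
      unfolding symmetrize_def using \<tau> a
      by (subst act_sum) (auto simp: finite_perms act_comp intro!: sum.cong)
    also have "\<dots> = symmetrize a"
      unfolding symmetrize_def using \<tau>
      by (intro sum.reindex_bij_witness[of _ "\<lambda>p. inv_into UNIV \<tau> \<circ> p" "\<lambda>p. \<tau> \<circ> p"])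
        (auto simp: permutes_compose permutes_inv o_assoc permutes_inv_o)
    finally show ?thesis .
  qed
  then show ?thesis using a by (auto simp: B_def symmetrize_def intro: sum_in)
qed

lemma symmetrize_act:
  assumes \<tau>: "\<tau> permutes {..n}" and a: "a \<in> A"
  shows "symmetrize (act \<tau> a) = symmetrize a"
proof -
  have "symmetrize (act \<tau> a) = (\<Sum>\<sigma> | \<sigma> permutes {..n}. act (\<sigma> \<circ> \<tau>) a)"
    unfolding symmetrize_def using \<tau> a by (simp add: act_comp)
  also have "\<dots> = symmetrize a"
    unfolding symmetrize_def by (rule sum_permutations_compose_right[symmetric]) (rule \<tau>)
  finally show ?thesis .
qed

lemma symmetrize_br:
  assumes "b \<in> B" "a \<in> A"
  shows "symmetrize (br b a) = br b (symmetrize a)"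
proof -
  have "act \<sigma> (br b a) = br b (act \<sigma> a)" if "\<sigma> permutes {..n}" for \<sigma>
    using that assms by (simp add: B_def act_br)
  then show ?thesis
    unfolding symmetrize_def using assms
    by (subst br_sum_right) (auto simp: finite_perms B_in intro!: sum.cong)
qed

lemma symmetrize_fixed: "b \<in> B \<Longrightarrow> symmetrize b = of_nat (fact (Suc n)) *\<^sub>C b"
  using card_permutations[of "{..n}" "Suc n"]
  by (simp add: symmetrize_def B_def complex_vector.sum_constant_scale)

text \<open>\<open>?M\<close> is the preimage of the target under symmetrization. It contains the
  brackets with \<open>T a b\<close> because \<open>symmetrize_br\<close> moves the symmetrization
  past an invariant factor. On \<open>B\<close> symmetrization is multiplication by (n+1)!, which
  brings the result back to \<open>B\<close>.\<close>

theorem invariants_spanned: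
  "B \<subseteq> cspan (insert e {br f g | f g. f \<in> B \<and> g \<in> B})"
proof
  let ?J = "cspan (insert e {br f g | f g. f \<in> B \<and> g \<in> B})"
  let ?M = "{z \<in> A. symmetrize z \<in> ?J}"
  have M: "csubspace ?M"
    by (auto simp: complex_vector.subspace_def symmetrize_add symmetrize_scale symmetrize_zero
        complex_vector.span_zero complex_vector.span_add complex_vector.span_scale)
  have "ev w \<in> ?M" for w
  proof (rule module_contains_words[OF M])
    show "e \<in> ?M"
      by (simp add: symmetrize_fixed e_B) (intro complex_vector.span_scale complex_vector.span_base insertI1)
    show "br (T a b) z \<in> ?M" if "z \<in> A" for a b z
      using that T_B[of a b] symmetrize_B[OF that]
      by (auto simp: symmetrize_br intro!: complex_vector.span_base)
    show "ev w - ev (map (apsnd \<sigma>) w) \<in> ?M" if "\<sigma> permutes {..n}" for \<sigma> w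
    proof -
      have "symmetrize (ev w - ev (map (apsnd \<sigma>) w)) + symmetrize (ev (map (apsnd \<sigma>) w)) = symmetrize (ev w)"
        by (simp add: symmetrize_add[symmetric])
      then show ?thesis
        using symmetrize_act[OF that ev_in, of w] that by (simp add: act_ev complex_vector.span_zero)
    qed
  qed
  then have "A \<subseteq> ?M"
    unfolding A_eq by (intro complex_vector.span_minimal M[unfolded A_eq]) auto
  fix b assume b: "b \<in> B"
  with \<open>A \<subseteq> ?M\<close> B_in have "symmetrize b \<in> ?J" by auto
  from complex_vector.span_scale[OF this[unfolded symmetrize_fixed[OF b]], of "1 / of_nat (fact (Suc n))"]
  show "b \<in> ?J" by (simp add: scaleC_scaleC scaleC_one del: fact_Suc)
qed

text \<open>A word is taken apart from the left: each letter is carried around to the far right and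
  picks up \<open>\<sigma>\<close> on the way. Hence the property has to be checked only for
  letters.\<close>

lemma twisted_trace:
  fixes \<tau> :: "'a \<Rightarrow> complex"
  assumes \<sigma>: "\<sigma> permutes {..n}"
    and add: "\<And>a b. a \<in> A \<Longrightarrow> b \<in> A \<Longrightarrow> \<tau> (a + b) = \<tau> a + \<tau> b"
    and scale: "\<And>c a. a \<in> A \<Longrightarrow> \<tau> (c *\<^sub>C a) = c * \<tau> a"
    and gen: "\<And>s a. a \<in> A \<Longrightarrow> \<tau> (gen s \<star> a) = \<tau> (a \<star> gen (apsnd \<sigma> s))"
    and a: "a \<in> A" and b: "b \<in> A"
  shows "\<tau> (a \<star> b) = \<tau> (b \<star> act \<sigma> a)"
  using a
proof (induction a rule: A_induct)
  case zero
  show ?case using b \<sigma> by simp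
next
  case (add x y)
  then show ?case using b \<sigma> assms(2) by (simp add: add_mul mul_add act_add)
next
  case (scale c x)
  then show ?case using b \<sigma> assms(3) by (simp add: scale_mul mul_scale act_scale)
next
  case (ev w)
  have "\<tau> (ev w \<star> b) = \<tau> (b \<star> ev (map (apsnd \<sigma>) w))"
    using b
  proof (induction w arbitrary: b)
    case (Cons s w)
    have "\<tau> (ev (s # w) \<star> b) = \<tau> (gen s \<star> (ev w \<star> b))"
      using Cons.prems by (simp add: ev_Cons mul_assoc)
    also have "\<dots> = \<tau> (ev w \<star> (b \<star> gen (apsnd \<sigma> s)))"
      using Cons.prems by (simp add: gen mul_assoc)
    also have "\<dots> = \<tau> (b \<star> gen (apsnd \<sigma> s) \<star> ev (map (apsnd \<sigma>) w))"
      by (rule Cons.IH) (simp add: Cons.prems)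
    finally show ?case using Cons.prems by (simp add: ev_Cons mul_assoc)
  qed simp
  then show ?case by (simp add: act_ev \<sigma>)
qed

end

section \<open>Polynomial functions on a subspace\<close>

lemma scaleC_complex [simp]: "a *\<^sub>C (x::complex) = a * x"
  by (simp add: scaleC_complex_def)

lemma scaleC_fun_apply: "(a *\<^sub>C f) x = a *\<^sub>C f x"
  by (simp add: scaleC_fun_def)

lemma minus_fun_apply: "(f - g) x = f x - g x"
  by (simp add: fun_diff_def)

text \<open>
  Induction over functions leaves goals in \<open>\<eta>\<close>-long form, where these rules would unfold the pointwise
  operations everywhere; so they are not simplification rules.
\<close>

lemmas fun_apply = plus_fun_apply times_fun_apply zero_fun_apply minus_fun_apply scaleC_fun_apply

declare plus_fun_apply [simp del] times_fun_apply [simp del] zero_fun_apply [simp del]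

lemma sum_fun_apply: "sum f I x = (\<Sum>i\<in>I. f i x)"
  by (induction I rule: infinite_finite_induct) (simp_all add: fun_apply)

lemma scaleC_mult_fun:
  fixes f g :: "'a \<Rightarrow> complex"
  shows "(c *\<^sub>C f) * g = c *\<^sub>C (f * g)" "f * (c *\<^sub>C g) = c *\<^sub>C (f * g)"
  by (simp_all add: fun_eq_iff fun_apply)

lemma scaleC_Pair [simp]: "c *\<^sub>C (x, y) = (c *\<^sub>C x, c *\<^sub>C y)"
  by (simp add: scaleC_prod_def)

lemma fst_scaleC [simp]: "fst (a *\<^sub>C p) = a *\<^sub>C fst p"
  and snd_scaleC [simp]: "snd (a *\<^sub>C p) = a *\<^sub>C snd p"
  by (simp_all add: scaleC_prod_def)

definition ind :: "'a set \<Rightarrow> 'a \<Rightarrow> complex" where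
  "ind S = (\<lambda>x. if x \<in> S then 1 else 0)"

lemma poly_fun_outside: "f \<in> poly_fun S \<Longrightarrow> x \<notin> S \<Longrightarrow> f x = 0"
  by (induction rule: poly_fun.induct) (auto simp: dual_def fun_apply)

lemma poly_fun_ind [simp]: "ind S \<in> poly_fun S"
  unfolding ind_def by (rule poly_fun.const)

lemma poly_fun_ind_mult [simp]: "f \<in> poly_fun S \<Longrightarrow> ind S * f = f" "f \<in> poly_fun S \<Longrightarrow> f * ind S = f"
  by (auto simp: ind_def fun_eq_iff poly_fun_outside fun_apply)

lemma const_eq_scaleC_ind: "(\<lambda>x. if x \<in> S then c else 0) = c *\<^sub>C ind S"
  by (auto simp: ind_def fun_apply)

lemma poly_fun_scale [simp]: "f \<in> poly_fun S \<Longrightarrow> c *\<^sub>C f \<in> poly_fun S"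
proof -
  assume f: "f \<in> poly_fun S"
  have "c *\<^sub>C f = (\<lambda>x. if x \<in> S then c else 0) * f"
    using f by (auto simp: fun_eq_iff poly_fun_outside fun_apply)
  then show ?thesis using f by (simp add: poly_fun.const poly_fun.mult)
qed

lemma poly_fun_zero [simp]: "0 \<in> poly_fun S"
  using poly_fun_scale[OF poly_fun_ind, of 0] by simp

lemmas poly_fun_add [simp] = poly_fun.add
lemmas poly_fun_mult [simp] = poly_fun.mult

text \<open>The generated rule shows sums and products as abstractions. Folded back, and with
  constants written as multiples of the unit, its cases match the rules for
  \<open>dir_deriv\<close>.\<close>

lemma poly_fun_induct [consumes 1, case_names const linear add mult]:
  assumes "f \<in> poly_fun S"
    and "\<And>c. P (c *\<^sub>C ind S)"
    and "\<And>l. l \<in> dual S \<Longrightarrow> P l"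
    and "\<And>f g. f \<in> poly_fun S \<Longrightarrow> g \<in> poly_fun S \<Longrightarrow> P f \<Longrightarrow> P g \<Longrightarrow> P (f + g)"
    and "\<And>f g. f \<in> poly_fun S \<Longrightarrow> g \<in> poly_fun S \<Longrightarrow> P f \<Longrightarrow> P g \<Longrightarrow> P (f * g)"
  shows "P f"
  using assms(1)
proof (induction f rule: poly_fun.induct)
  case (const c)
  show ?case unfolding const_eq_scaleC_ind by (rule assms(2))
next
  case (linear l)
  then show ?case by (rule assms(3))
next
  case (add f g)
  then show ?case using assms(4)[of f g] by (simp only: plus_fun_def)
next
  case (mult f g)
  then show ?case using assms(5)[of f g] by (simp only: times_fun_def)
qed

lemma poly_fun_subspace: "csubspace (poly_fun S)"
  by (simp add: complex_vector.subspace_def)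

lemma poly_fun_sum: "(\<And>i. i \<in> I \<Longrightarrow> f i \<in> poly_fun S) \<Longrightarrow> sum f I \<in> poly_fun S"
  by (rule complex_vector.subspace_sum[OF poly_fun_subspace])

lemma dual_subspace: "csubspace S \<Longrightarrow> csubspace (dual S)"
  by (auto simp: complex_vector.subspace_def dual_def fun_apply algebra_simps)

lemma subspace_Times: "csubspace S \<Longrightarrow> csubspace T \<Longrightarrow> csubspace (S \<times> T)"
  by (auto simp: complex_vector.subspace_def zero_prod_def scaleC_prod_def)

lemma line_in_subspace:
  "csubspace S \<Longrightarrow> p \<in> S \<Longrightarrow> v \<in> S \<Longrightarrow> p + t *\<^sub>C v \<in> S"
  by (simp add: complex_vector.subspace_def)

lemma dual_add: "l \<in> dual S \<Longrightarrow> x \<in> S \<Longrightarrow> y \<in> S \<Longrightarrow> l (x + y) = l x + l y"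
  and dual_scale: "l \<in> dual S \<Longrightarrow> x \<in> S \<Longrightarrow> l (c *\<^sub>C x) = c * l x"
  by (simp_all add: dual_def)

lemma dual_zero: "csubspace S \<Longrightarrow> l \<in> dual S \<Longrightarrow> l 0 = 0"
  using complex_vector.subspace_0[of S] by (force simp: dual_def)

lemma dual_sum:
  assumes "csubspace S" "l \<in> dual S" "\<And>i. i \<in> I \<Longrightarrow> f i \<in> S"
  shows "l (\<Sum>i\<in>I. f i) = (\<Sum>i\<in>I. l (f i))"
  using assms(3)
proof (induction I rule: infinite_finite_induct)
  case (insert x F)
  then have "sum f F \<in> S" by (intro complex_vector.subspace_sum assms(1)) auto
  with insert assms(2) show ?case by (simp add: dual_def)
qed (simp_all add: dual_zero[OF assms(1,2)])

text \<open>\<open>deriv\<close> obeys the sum and product rules only where the functions are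
  differentiable, so differentiability along lines comes before all rules for
  \<open>dir_deriv\<close>.\<close>

lemma poly_fun_line_differentiable:
  assumes "csubspace S" "f \<in> poly_fun S" "p \<in> S" "v \<in> S"
  shows "(\<lambda>t. f (p + t *\<^sub>C v)) field_differentiable at z"
  using assms(2)
proof (induction f rule: poly_fun_induct)
  case (const c)
  have "(\<lambda>t. (c *\<^sub>C ind S) (p + t *\<^sub>C v)) = (\<lambda>t. c)"
    using line_in_subspace[OF assms(1,3,4)] by (simp add: ind_def fun_apply)
  then show ?case by simp
next
  case (linear l)
  then have "(\<lambda>t. l (p + t *\<^sub>C v)) = (\<lambda>t. l p + t * l v)"
    using assms by (auto simp: dual_def complex_vector.subspace_scale)
  then show ?case by (auto intro!: derivative_intros)
qed (auto simp: fun_apply intro!: derivative_intros)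

section \<open>Directional derivatives as commuting derivations\<close>

lemma has_deriv_line:
  assumes "csubspace S" "f \<in> poly_fun S" "p \<in> S" "v \<in> S"
  shows "((\<lambda>t. f (p + t *\<^sub>C v)) has_field_derivative dir_deriv S v f p) (at 0)"
  using poly_fun_line_differentiable[OF assms] assms(3)
  by (simp add: dir_deriv_def DERIV_deriv_iff_field_differentiable)

lemma dir_derivI:
  assumes "p \<in> S" "((\<lambda>t. f (p + t *\<^sub>C v)) has_field_derivative D) (at 0)"
  shows "dir_deriv S v f p = D"
  using assms by (simp add: dir_deriv_def DERIV_imp_deriv)

lemma dir_deriv_outside: "p \<notin> S \<Longrightarrow> dir_deriv S v f p = 0"
  by (simp add: dir_deriv_def)

context
  fixes S :: "'a::complex_vector set"
  assumes S: "csubspace S"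
begin

lemma dir_deriv_ind: "v \<in> S \<Longrightarrow> dir_deriv S v (ind S) = 0"
proof
  fix p assume v: "v \<in> S"
  show "dir_deriv S v (ind S) p = 0 p"
  proof (cases "p \<in> S")
    case True
    then have "(\<lambda>t. ind S (p + t *\<^sub>C v)) = (\<lambda>t. 1)"
      using line_in_subspace[OF S True v] by (simp add: ind_def)
    then show ?thesis using True by (simp add: dir_deriv_def fun_apply)
  qed (simp add: dir_deriv_outside fun_apply)
qed

lemma dir_deriv_linear: "v \<in> S \<Longrightarrow> l \<in> dual S \<Longrightarrow> dir_deriv S v l = l v *\<^sub>C ind S"
proof
  fix p assume v: "v \<in> S" "l \<in> dual S"
  show "dir_deriv S v l p = (l v *\<^sub>C ind S) p"
  proof (cases "p \<in> S")
    case True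
    then have *: "(\<lambda>t. l (p + t *\<^sub>C v)) = (\<lambda>t. l p + t * l v)"
      using v S by (auto simp: dual_def complex_vector.subspace_scale)
    have "((\<lambda>t. l p + t * l v) has_field_derivative l v) (at 0)"
      by (auto intro!: derivative_eq_intros)
    then show ?thesis using True by (simp add: dir_derivI * ind_def fun_apply)
  qed (simp add: dir_deriv_outside ind_def fun_apply)
qed

lemma dir_deriv_add:
  assumes "v \<in> S" "f \<in> poly_fun S" "g \<in> poly_fun S"
  shows "dir_deriv S v (f + g) = dir_deriv S v f + dir_deriv S v g"
proof
  fix p show "dir_deriv S v (f + g) p = (dir_deriv S v f + dir_deriv S v g) p"
  proof (cases "p \<in> S")
    case True
    show ?thesis
      using DERIV_add[OF has_deriv_line[OF S assms(2) True assms(1)] has_deriv_line[OF S assms(3) True assms(1)]]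
      by (intro dir_derivI) (auto simp: True fun_apply)
  qed (simp add: dir_deriv_outside fun_apply)
qed

lemma dir_deriv_mult:
  assumes "v \<in> S" "f \<in> poly_fun S" "g \<in> poly_fun S"
  shows "dir_deriv S v (f * g) = f * dir_deriv S v g + dir_deriv S v f * g"
proof
  fix p show "dir_deriv S v (f * g) p = (f * dir_deriv S v g + dir_deriv S v f * g) p"
  proof (cases "p \<in> S")
    case True
    show ?thesis
      using DERIV_mult[OF has_deriv_line[OF S assms(2) True assms(1)] has_deriv_line[OF S assms(3) True assms(1)]]
      by (intro dir_derivI) (auto simp: True fun_apply algebra_simps)
  qed (simp add: dir_deriv_outside fun_apply)
qed

lemma dir_deriv_scale:
  assumes "v \<in> S" "f \<in> poly_fun S"
  shows "dir_deriv S v (c *\<^sub>C f) = c *\<^sub>C dir_deriv S v f"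
proof
  fix p show "dir_deriv S v (c *\<^sub>C f) p = (c *\<^sub>C dir_deriv S v f) p"
  proof (cases "p \<in> S")
    case True
    show ?thesis
      using DERIV_cmult[OF has_deriv_line[OF S assms(2) True assms(1)], of c]
      by (intro dir_derivI) (auto simp: True fun_apply)
  qed (simp add: dir_deriv_outside fun_apply)
qed

lemma dir_deriv_zero: "v \<in> S \<Longrightarrow> dir_deriv S v 0 = 0"
  using dir_deriv_scale[of v 0 0] by simp

lemma dir_deriv_sum:
  assumes "v \<in> S" "\<And>i. i \<in> I \<Longrightarrow> f i \<in> poly_fun S"
  shows "dir_deriv S v (\<Sum>i\<in>I. f i) = (\<Sum>i\<in>I. dir_deriv S v (f i))"
  using assms(2)
  by (induction I rule: infinite_finite_induct)
    (simp_all add: dir_deriv_zero assms(1) dir_deriv_add poly_fun_sum)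

lemma dir_deriv_poly_fun:
  assumes "v \<in> S" "f \<in> poly_fun S"
  shows "dir_deriv S v f \<in> poly_fun S"
  using assms(2)
proof (induction f rule: poly_fun_induct)
  case (const c)
  show "dir_deriv S v (c *\<^sub>C ind S) \<in> poly_fun S" using assms by (simp add: dir_deriv_scale dir_deriv_ind)
qed (simp_all add: dir_deriv_linear dir_deriv_add dir_deriv_mult assms(1))

text \<open>No chain rule in several variables is invoked: both sides are derivations in
  \<open>f\<close>, so it suffices to compare them on constants and linear functions.\<close>

lemma dir_deriv_add_direction:
  assumes "v \<in> S" "w \<in> S" "f \<in> poly_fun S"
  shows "dir_deriv S (v + w) f = dir_deriv S v f + dir_deriv S w f"
proof -
  have vw: "v + w \<in> S" using assms S by (simp add: complex_vector.subspace_add)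
  show ?thesis using assms(3)
  proof (induction f rule: poly_fun_induct)
    case (const c)
    show "dir_deriv S (v + w) (c *\<^sub>C ind S) = dir_deriv S v (c *\<^sub>C ind S) + dir_deriv S w (c *\<^sub>C ind S)" using assms vw by (simp add: dir_deriv_scale dir_deriv_ind)
  next
    case (linear l)
    then show ?case using assms vw
      by (simp add: dir_deriv_linear dual_def scaleC_add_left)
  qed (simp_all add: dir_deriv_add dir_deriv_mult assms vw algebra_simps)
qed

lemma dir_deriv_scale_direction:
  assumes "v \<in> S" "f \<in> poly_fun S"
  shows "dir_deriv S (c *\<^sub>C v) f = c *\<^sub>C dir_deriv S v f"
proof -
  have cv: "c *\<^sub>C v \<in> S" using assms S by (simp add: complex_vector.subspace_scale)
  show ?thesis using assms(2)
  proof (induction f rule: poly_fun_induct)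
    case (const k)
    show "dir_deriv S (c *\<^sub>C v) (k *\<^sub>C ind S) = c *\<^sub>C dir_deriv S v (k *\<^sub>C ind S)" using assms cv by (simp add: dir_deriv_scale dir_deriv_ind)
  next
    case (linear l)
    then show ?case using assms cv
      by (simp add: dir_deriv_linear dual_def scaleC_scaleC)
  qed (simp_all add: dir_deriv_add dir_deriv_mult assms cv scaleC_add_right scaleC_mult_fun algebra_simps)
qed

lemma dir_deriv_sum_direction:
  assumes "\<And>i. i \<in> I \<Longrightarrow> v i \<in> S" "f \<in> poly_fun S"
  shows "dir_deriv S (\<Sum>i\<in>I. v i) f = (\<Sum>i\<in>I. dir_deriv S (v i) f)"
proof -
  have "0 \<in> S" using S by (rule complex_vector.subspace_0)
  from dir_deriv_scale_direction[OF this assms(2), of 0]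
  have "dir_deriv S 0 f = 0" by simp
  with assms(1) show ?thesis
  proof (induction I rule: infinite_finite_induct)
    case (insert x F)
    then have "sum v F \<in> S" by (intro complex_vector.subspace_sum S) auto
    with insert assms(2) show ?case by (simp add: dir_deriv_add_direction)
  qed simp_all
qed

text \<open>Both orders satisfy the same second order Leibniz rule and vanish on constants and
  linear functions.\<close>

lemma dir_deriv_commute:
  assumes "v \<in> S" "w \<in> S" "f \<in> poly_fun S"
  shows "dir_deriv S v (dir_deriv S w f) = dir_deriv S w (dir_deriv S v f)"
  using assms(3)
proof (induction f rule: poly_fun_induct)
  case (const c)
  show "dir_deriv S v (dir_deriv S w (c *\<^sub>C ind S)) = dir_deriv S w (dir_deriv S v (c *\<^sub>C ind S))" using assms by (simp add: dir_deriv_scale dir_deriv_ind dir_deriv_zero)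
next
  case (linear l)
  then show ?case using assms by (simp add: dir_deriv_linear dir_deriv_scale dir_deriv_ind)
qed (simp_all add: dir_deriv_add dir_deriv_mult assms(1,2) dir_deriv_poly_fun algebra_simps)

end

text \<open>\<open>lin_iff\<close> makes \<open>S\<close> the full preimage of \<open>T\<close>, so
  that functions vanishing outside \<open>T\<close> pull back to functions vanishing outside
  \<open>S\<close>.\<close>

locale linear_on =
  fixes \<phi> :: "'a::complex_vector \<Rightarrow> 'b::complex_vector" and S T
  assumes subS: "csubspace S" and subT: "csubspace T"
    and lin_add: "\<phi> (x + y) = \<phi> x + \<phi> y"
    and lin_scale: "\<phi> (c *\<^sub>C x) = c *\<^sub>C \<phi> x"
    and lin_iff: "\<phi> x \<in> T \<longleftrightarrow> x \<in> S"
begin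

lemma ind_comp: "ind T \<circ> \<phi> = ind S"
  by (simp add: fun_eq_iff ind_def lin_iff)

lemma dual_comp: "l \<in> dual T \<Longrightarrow> l \<circ> \<phi> \<in> dual S"
  by (simp add: dual_def lin_add lin_scale lin_iff)

lemma poly_fun_comp: "f \<in> poly_fun T \<Longrightarrow> f \<circ> \<phi> \<in> poly_fun S"
proof (induction f rule: poly_fun_induct)
  case (const c)
  have "(c *\<^sub>C ind T) \<circ> \<phi> = c *\<^sub>C ind S"
    by (simp add: fun_eq_iff ind_def lin_iff fun_apply)
  then show ?case by simp
next
  case (linear l)
  then show ?case by (intro poly_fun.linear dual_comp)
next
  case (add f g)
  have "(f + g) \<circ> \<phi> = (f \<circ> \<phi>) + (g \<circ> \<phi>)" by (simp add: fun_eq_iff fun_apply)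
  with add show ?case by (simp only: poly_fun_add)
next
  case (mult f g)
  have "(f * g) \<circ> \<phi> = (f \<circ> \<phi>) * (g \<circ> \<phi>)" by (simp add: fun_eq_iff fun_apply)
  with mult show ?case by (simp only: poly_fun_mult)
qed

lemma dir_deriv_comp: "dir_deriv S v (f \<circ> \<phi>) = dir_deriv T (\<phi> v) f \<circ> \<phi>"
  by (simp add: dir_deriv_def fun_eq_iff lin_add lin_scale lin_iff)

end

section \<open>The reflection representation and its Poisson bracket\<close>

text \<open>
  The orthogonal projections of the unit vectors of $\mathbb C^{n+1}$. Together with the coordinate
  functions below they form a symmetric system of dual frames, not of bases: both sum to zero.
\<close>

definition proj_unit :: "nat \<Rightarrow> nat \<Rightarrow> nat \<Rightarrow> complex" where
  "proj_unit n i k = (if i \<le> n \<and> k \<le> n then of_bool (k = i) - 1 / of_nat (Suc n) else 0)"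

definition coord :: "nat \<Rightarrow> nat \<Rightarrow> (nat \<Rightarrow> complex) \<Rightarrow> complex" where
  "coord n i x = (if x \<in> refl_rep n then x i else 0)"

abbreviation phase_space :: "nat \<Rightarrow> ((nat \<Rightarrow> complex) \<times> ((nat \<Rightarrow> complex) \<Rightarrow> complex)) set" where
  "phase_space n \<equiv> refl_rep n \<times> dual (refl_rep n)"

lemma refl_subspace: "csubspace (refl_rep n)"
  by (auto simp: complex_vector.subspace_def refl_rep_def fun_apply sum.distrib sum_distrib_left[symmetric])

lemma phase_space_subspace: "csubspace (phase_space n)"
  by (intro subspace_Times refl_subspace dual_subspace)

lemma refl_zero [simp]: "0 \<in> refl_rep n"
  and dual_refl_zero [simp]: "0 \<in> dual (refl_rep n)"
  using refl_subspace dual_subspace[OF refl_subspace] by (auto intro: complex_vector.subspace_0)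

lemma proj_unit_sym: "proj_unit n i k = proj_unit n k i"
  by (auto simp: proj_unit_def)

lemma proj_unit_outside: "i > n \<Longrightarrow> proj_unit n i = 0"
  by (simp add: proj_unit_def fun_eq_iff fun_apply)

lemma of_bool_mult_sum:
  fixes k n :: nat
  shows
  "(\<Sum>i\<le>n. of_bool (k = i) * f i) = (if k \<le> n then f k else (0::complex))"
  "(\<Sum>i\<le>n. f i * of_bool (k = i)) = (if k \<le> n then f k else (0::complex))"
proof -
  have "(\<Sum>i\<le>n. of_bool (k = i) * f i) = (\<Sum>i\<le>n. if k = i then f i else 0)"
    by (intro sum.cong) auto
  then show "(\<Sum>i\<le>n. of_bool (k = i) * f i) = (if k \<le> n then f k else 0)"
    by (simp only: sum.delta' finite_atMost atMost_iff)
  then show "(\<Sum>i\<le>n. f i * of_bool (k = i)) = (if k \<le> n then f k else 0)"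
    by (simp only: mult.commute)
qed

lemma sum_proj_unit_right: "(\<Sum>k\<le>n. proj_unit n i k) = 0"
proof (cases "i \<le> n")
  case True
  then have "(\<Sum>k\<le>n. proj_unit n i k) = (\<Sum>k\<le>n. of_bool (i = k) * 1 - 1 / of_nat (Suc n))"
    by (intro sum.cong) (auto simp: proj_unit_def)
  also have "\<dots> = 0" unfolding sum_subtractf of_bool_mult_sum using True by (simp del: of_nat_Suc)
  finally show ?thesis .
qed (simp add: proj_unit_def)

lemma proj_unit_in [simp]: "proj_unit n i \<in> refl_rep n"
  using sum_proj_unit_right[of n i] by (simp add: refl_rep_def proj_unit_def)

lemma sum_proj_unit: "(\<Sum>i\<le>n. proj_unit n i) = 0"
proof
  fix k show "(\<Sum>i\<le>n. proj_unit n i) k = 0 k"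
    using sum_proj_unit_right[of n k] by (simp add: sum_fun_apply fun_apply proj_unit_sym[of n _ k])
qed

text \<open>The entries -1/N contribute a multiple of the coordinate sum, which is zero on
  \<open>refl_rep n\<close>. So the redundant frame reproduces a vector from its own coordinates,
  exactly as a basis would.\<close>

lemma refl_expand_apply:
  assumes "x \<in> refl_rep n"
  shows "x k = (\<Sum>i\<le>n. x i * proj_unit n i k)"
proof (cases "k \<le> n")
  case True
  have "(\<Sum>i\<le>n. x i * proj_unit n i k) = (\<Sum>i\<le>n. x i * of_bool (k = i) - x i * (1 / of_nat (Suc n)))"
    using True by (intro sum.cong) (auto simp: proj_unit_def algebra_simps)
  also have "\<dots> = x k - (\<Sum>i\<le>n. x i) * (1 / of_nat (Suc n))"
    unfolding sum_subtractf of_bool_mult_sum sum_distrib_right using True by simp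
  finally show ?thesis using assms by (simp add: refl_rep_def)
next
  case False
  then show ?thesis using assms by (simp add: proj_unit_def refl_rep_def)
qed

lemma refl_expand: "x \<in> refl_rep n \<Longrightarrow> x = (\<Sum>i\<le>n. x i *\<^sub>C proj_unit n i)"
  by (rule ext) (simp add: sum_fun_apply fun_apply refl_expand_apply[symmetric])

lemma coord_in [simp]: "coord n i \<in> dual (refl_rep n)"
  using refl_subspace[of n] by (auto simp: dual_def coord_def fun_apply complex_vector.subspace_def)

lemma coord_outside: "i > n \<Longrightarrow> coord n i = 0"
  by (auto simp: coord_def refl_rep_def fun_eq_iff fun_apply)

lemma coord_proj_unit: "coord n j (proj_unit n i) = proj_unit n i j"
  by (simp add: coord_def)

lemma sum_coord: "(\<Sum>i\<le>n. coord n i) = 0"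
proof
  fix x show "(\<Sum>i\<le>n. coord n i) x = 0 x"
    by (cases "x \<in> refl_rep n") (simp_all add: sum_fun_apply coord_def fun_apply, simp add: refl_rep_def)
qed

lemma scale_proj_unit_in [simp]: "c *\<^sub>C proj_unit n i \<in> refl_rep n"
  by (simp add: complex_vector.subspace_scale refl_subspace)

lemma dual_refl_expand_apply:
  assumes "\<eta> \<in> dual (refl_rep n)" "x \<in> refl_rep n"
  shows "\<eta> x = (\<Sum>i\<le>n. x i * \<eta> (proj_unit n i))"
proof -
  have "\<eta> x = \<eta> (\<Sum>i\<le>n. x i *\<^sub>C proj_unit n i)" using refl_expand[OF assms(2)] by simp
  also have "\<dots> = (\<Sum>i\<le>n. \<eta> (x i *\<^sub>C proj_unit n i))"
    by (intro dual_sum[OF refl_subspace assms(1)]) simp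
  also have "\<dots> = (\<Sum>i\<le>n. x i * \<eta> (proj_unit n i))" using assms(1) by (simp add: dual_def)
  finally show ?thesis .
qed

lemma dual_refl_expand:
  assumes "\<eta> \<in> dual (refl_rep n)"
  shows "\<eta> = (\<Sum>i\<le>n. \<eta> (proj_unit n i) *\<^sub>C coord n i)"
proof
  fix x show "\<eta> x = (\<Sum>i\<le>n. \<eta> (proj_unit n i) *\<^sub>C coord n i) x"
  proof (cases "x \<in> refl_rep n")
    case True
    then show ?thesis
      using dual_refl_expand_apply[OF assms True] by (simp add: sum_fun_apply fun_apply coord_def mult.commute)
  qed (use assms in \<open>simp add: dual_def sum_fun_apply fun_apply coord_def\<close>)
qed

section \<open>Frames and linear coordinates on the phase space\<close>

definition pos_dir :: "nat \<Rightarrow> nat \<Rightarrow> (nat \<Rightarrow> complex) \<times> ((nat \<Rightarrow> complex) \<Rightarrow> complex)" where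
  "pos_dir n i = (proj_unit n i, 0)"

definition mom_dir :: "nat \<Rightarrow> nat \<Rightarrow> (nat \<Rightarrow> complex) \<times> ((nat \<Rightarrow> complex) \<Rightarrow> complex)" where
  "mom_dir n i = (0, coord n i)"

lemma pos_dir_in [simp]: "pos_dir n i \<in> phase_space n" and mom_dir_in [simp]: "mom_dir n i \<in> phase_space n"
  by (simp_all add: pos_dir_def mom_dir_def)

lemma fst_sum: "fst (sum f I) = (\<Sum>i\<in>I. fst (f i))" and snd_sum: "snd (sum f I) = (\<Sum>i\<in>I. snd (f i))"
  by (induction I rule: infinite_finite_induct) simp_all

lemma phase_space_expand:
  assumes "p \<in> phase_space n"
  shows "p = (\<Sum>i\<le>n. fst p i *\<^sub>C pos_dir n i) + (\<Sum>i\<le>n. snd p (proj_unit n i) *\<^sub>C mom_dir n i)"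
proof (rule prod_eqI)
  from assms have "fst p \<in> refl_rep n" "snd p \<in> dual (refl_rep n)" by (auto simp: mem_Times_iff)
  then show "fst p = fst ((\<Sum>i\<le>n. fst p i *\<^sub>C pos_dir n i) + (\<Sum>i\<le>n. snd p (proj_unit n i) *\<^sub>C mom_dir n i))"
    "snd p = snd ((\<Sum>i\<le>n. fst p i *\<^sub>C pos_dir n i) + (\<Sum>i\<le>n. snd p (proj_unit n i) *\<^sub>C mom_dir n i))"
    using refl_expand dual_refl_expand by (simp_all add: fst_sum snd_sum pos_dir_def mom_dir_def)
qed

definition pos_fun :: "nat \<Rightarrow> nat \<Rightarrow> (nat \<Rightarrow> complex) \<times> ((nat \<Rightarrow> complex) \<Rightarrow> complex) \<Rightarrow> complex" where
  "pos_fun n i p = (if p \<in> phase_space n then fst p i else 0)"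

definition mom_fun :: "nat \<Rightarrow> nat \<Rightarrow> (nat \<Rightarrow> complex) \<times> ((nat \<Rightarrow> complex) \<Rightarrow> complex) \<Rightarrow> complex" where
  "mom_fun n i p = (if p \<in> phase_space n then snd p (proj_unit n i) else 0)"

lemma pos_fun_dual [simp]: "pos_fun n i \<in> dual (phase_space n)" and mom_fun_dual [simp]: "mom_fun n i \<in> dual (phase_space n)"
  using phase_space_subspace[of n]
  by (auto simp: dual_def[of "phase_space n"] pos_fun_def mom_fun_def fun_apply
      complex_vector.subspace_add[OF refl_subspace] complex_vector.subspace_scale[OF refl_subspace]
      complex_vector.subspace_add[OF dual_subspace[OF refl_subspace]]
      complex_vector.subspace_scale[OF dual_subspace[OF refl_subspace]])

lemma pos_fun_pos_dir: "pos_fun n i (pos_dir n k) = proj_unit n k i" and pos_fun_mom_dir: "pos_fun n i (mom_dir n k) = 0"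
  and mom_fun_pos_dir: "mom_fun n i (pos_dir n k) = 0" and mom_fun_mom_dir: "mom_fun n i (mom_dir n k) = proj_unit n k i"
  by (simp_all add: pos_fun_def mom_fun_def pos_dir_def mom_dir_def fun_apply coord_proj_unit proj_unit_sym)

lemma pos_fun_outside: "i > n \<Longrightarrow> pos_fun n i = 0" and mom_fun_outside: "i > n \<Longrightarrow> mom_fun n i = 0"
  by (auto simp: fun_eq_iff pos_fun_def mom_fun_def fun_apply refl_rep_def proj_unit_outside dual_zero[OF refl_subspace])

lemma sum_pos_fun: "(\<Sum>i\<le>n. pos_fun n i) = 0"
proof
  fix p show "(\<Sum>i\<le>n. pos_fun n i) p = 0 p"
    by (cases "p \<in> phase_space n") (simp_all add: sum_fun_apply pos_fun_def fun_apply, auto simp: refl_rep_def)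
qed

lemma sum_mom_fun: "(\<Sum>i\<le>n. mom_fun n i) = 0"
proof
  fix p :: "(nat \<Rightarrow> complex) \<times> ((nat \<Rightarrow> complex) \<Rightarrow> complex)"
  have "(\<Sum>i\<le>n. snd p (proj_unit n i)) = 0" if "snd p \<in> dual (refl_rep n)"
    using dual_sum[OF refl_subspace that, of "{..n}" "proj_unit n"] dual_zero[OF refl_subspace that]
    by (simp add: sum_proj_unit)
  then show "(\<Sum>i\<le>n. mom_fun n i) p = 0 p" by (cases "p \<in> phase_space n") (auto simp: sum_fun_apply mom_fun_def fun_apply)
qed

lemma dual_phase_space_expand:
  assumes "l \<in> dual (phase_space n)"
  shows "l = (\<Sum>i\<le>n. l (pos_dir n i) *\<^sub>C pos_fun n i) + (\<Sum>i\<le>n. l (mom_dir n i) *\<^sub>C mom_fun n i)"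
proof
  fix p show "l p = ((\<Sum>i\<le>n. l (pos_dir n i) *\<^sub>C pos_fun n i) + (\<Sum>i\<le>n. l (mom_dir n i) *\<^sub>C mom_fun n i)) p"
  proof (cases "p \<in> phase_space n")
    case True
    note scale_in = complex_vector.subspace_scale[OF phase_space_subspace]
    have "l p = l ((\<Sum>i\<le>n. fst p i *\<^sub>C pos_dir n i) + (\<Sum>i\<le>n. snd p (proj_unit n i) *\<^sub>C mom_dir n i))"
      using phase_space_expand[OF True] by simp
    also have "\<dots> = l (\<Sum>i\<le>n. fst p i *\<^sub>C pos_dir n i) + l (\<Sum>i\<le>n. snd p (proj_unit n i) *\<^sub>C mom_dir n i)"
      by (intro dual_add[OF assms] complex_vector.subspace_sum[OF phase_space_subspace] scale_in) simp_all
    also have "\<dots> = (\<Sum>i\<le>n. l (fst p i *\<^sub>C pos_dir n i)) + (\<Sum>i\<le>n. l (snd p (proj_unit n i) *\<^sub>C mom_dir n i))"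
      by (intro arg_cong2[of _ _ _ _ plus] dual_sum[OF phase_space_subspace assms] scale_in) simp_all
    also have "\<dots> = (\<Sum>i\<le>n. fst p i * l (pos_dir n i)) + (\<Sum>i\<le>n. snd p (proj_unit n i) * l (mom_dir n i))"
      by (simp only: dual_scale[OF assms pos_dir_in] dual_scale[OF assms mom_dir_in])
    finally show ?thesis
      using True by (simp add: sum_fun_apply fun_apply pos_fun_def mom_fun_def mult.commute)
  next
    case False
    have "l p = 0" using assms False unfolding dual_def by blast
    then show ?thesis using False by (simp add: sum_fun_apply fun_apply pos_fun_def mom_fun_def)
  qed
qed

section \<open>Derivatives along the frames and Hamiltonian vector fields\<close>

abbreviation dpos :: "nat \<Rightarrow> nat \<Rightarrow> ((nat \<Rightarrow> complex) \<times> ((nat \<Rightarrow> complex) \<Rightarrow> complex) \<Rightarrow> complex) \<Rightarrow>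
    (nat \<Rightarrow> complex) \<times> ((nat \<Rightarrow> complex) \<Rightarrow> complex) \<Rightarrow> complex" where
  "dpos n i \<equiv> dir_deriv (phase_space n) (pos_dir n i)"

abbreviation dmom :: "nat \<Rightarrow> nat \<Rightarrow> ((nat \<Rightarrow> complex) \<times> ((nat \<Rightarrow> complex) \<Rightarrow> complex) \<Rightarrow> complex) \<Rightarrow>
    (nat \<Rightarrow> complex) \<times> ((nat \<Rightarrow> complex) \<Rightarrow> complex) \<Rightarrow> complex" where
  "dmom n i \<equiv> dir_deriv (phase_space n) (mom_dir n i)"

lemma dir_deriv_phase_space_expand:
  assumes "w \<in> phase_space n" "f \<in> poly_fun (phase_space n)"
  shows "dir_deriv (phase_space n) w f p =
    (\<Sum>i\<le>n. fst w i * dpos n i f p) + (\<Sum>i\<le>n. snd w (proj_unit n i) * dmom n i f p)"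
proof -
  note scale_in = complex_vector.subspace_scale[OF phase_space_subspace]
  note sum_in = complex_vector.subspace_sum[OF phase_space_subspace]
  have "dir_deriv (phase_space n) w f =
    dir_deriv (phase_space n) ((\<Sum>i\<le>n. fst w i *\<^sub>C pos_dir n i) + (\<Sum>i\<le>n. snd w (proj_unit n i) *\<^sub>C mom_dir n i)) f"
    using phase_space_expand[OF assms(1)] by simp
  also have "\<dots> = dir_deriv (phase_space n) (\<Sum>i\<le>n. fst w i *\<^sub>C pos_dir n i) f
      + dir_deriv (phase_space n) (\<Sum>i\<le>n. snd w (proj_unit n i) *\<^sub>C mom_dir n i) f"
    by (intro dir_deriv_add_direction[OF phase_space_subspace] sum_in scale_in assms(2)) simp_all
  also have "\<dots> = (\<Sum>i\<le>n. fst w i *\<^sub>C dpos n i f) + (\<Sum>i\<le>n. snd w (proj_unit n i) *\<^sub>C dmom n i f)"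
    using assms(2)
    by (simp add: dir_deriv_sum_direction[OF phase_space_subspace] dir_deriv_scale_direction[OF phase_space_subspace]
        scale_in del: mem_Times_iff)
  finally show ?thesis by (simp add: sum_fun_apply fun_apply)
qed

text \<open>\<open>ham_vec\<close> is a definite description, so both existence and uniqueness are
  needed. Uniqueness is nondegeneracy tested on the frames: pairing with \<open>mom_dir\<close>
  reads off the position component, pairing with \<open>pos_dir\<close> the momentum
  component.\<close>

lemma
  assumes f: "f \<in> poly_fun (phase_space n)"
  defines "X p \<equiv> (\<Sum>i\<le>n. dmom n i f p *\<^sub>C proj_unit n i, - (\<Sum>i\<le>n. dpos n i f p *\<^sub>C coord n i))"
  shows ham_vec_eq: "ham_vec (refl_rep n) f p = X p"
    and ham_vec_in: "X p \<in> phase_space n"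
    and ham_vec_symp: "w \<in> phase_space n \<Longrightarrow> symp_form (X p) w = dir_deriv (phase_space n) w f p"
proof -
  have X: "fst (X p) \<in> refl_rep n" "snd (X p) \<in> dual (refl_rep n)"
    using dual_subspace[OF refl_subspace, of n]
    by (auto simp: X_def intro!: complex_vector.subspace_sum[OF refl_subspace]
        complex_vector.subspace_sum[OF dual_subspace[OF refl_subspace]]
        complex_vector.subspace_neg complex_vector.subspace_scale[OF dual_subspace[OF refl_subspace]])
  then show X_in: "X p \<in> phase_space n" by (simp add: mem_Times_iff)
  have symp: "symp_form (X p) w = dir_deriv (phase_space n) w f p" if w: "w \<in> phase_space n" for w
  proof -
    have "snd w (\<Sum>i\<le>n. dmom n i f p *\<^sub>C proj_unit n i) = (\<Sum>i\<le>n. snd w (dmom n i f p *\<^sub>C proj_unit n i))"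
      using w by (intro dual_sum[OF refl_subspace]) auto
    also have "\<dots> = (\<Sum>i\<le>n. snd w (proj_unit n i) * dmom n i f p)"
      using w by (intro sum.cong) (auto simp: dual_def)
    finally show ?thesis
      using w by (simp add: X_def symp_form_def dir_deriv_phase_space_expand f sum_fun_apply fun_apply coord_def
          fun_Compl_def mem_Times_iff mult.commute)
  qed
  then show "w \<in> phase_space n \<Longrightarrow> symp_form (X p) w = dir_deriv (phase_space n) w f p" .
  show "ham_vec (refl_rep n) f p = X p"
    unfolding ham_vec_def
  proof (rule the_equality)
    show "X p \<in> phase_space n \<and> (\<forall>w\<in>phase_space n. symp_form (X p) w = dir_deriv (phase_space n) w f p)"
      using X_in symp by simp
    fix Y assume Y: "Y \<in> phase_space n \<and> (\<forall>w\<in>phase_space n. symp_form Y w = dir_deriv (phase_space n) w f p)"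
    have eq: "symp_form Y w = symp_form (X p) w" if "w \<in> phase_space n" for w using Y symp that by auto
    have Y': "fst Y \<in> refl_rep n" "snd Y \<in> dual (refl_rep n)" using Y by (auto simp: mem_Times_iff)
    show "Y = X p"
    proof (rule prod_eqI)
      show "fst Y = fst (X p)"
      proof
        fix k show "fst Y k = fst (X p) k"
          using eq[OF mom_dir_in, of k] X(1) Y'(1) dual_zero[OF refl_subspace X(2)]
            dual_zero[OF refl_subspace Y'(2)] by (simp add: symp_form_def mom_dir_def coord_def)
      qed
      have "snd Y (proj_unit n i) = snd (X p) (proj_unit n i)" for i
        using eq[OF pos_dir_in, of i] by (simp add: symp_form_def pos_dir_def fun_apply)
      then show "snd Y = snd (X p)"
        using dual_refl_expand[OF X(2)] dual_refl_expand[OF Y'(2)] by simp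
    qed
  qed
qed

text \<open>Obtained by expanding a frame vector in the frame itself: the projection matrix
  \<open>proj_unit\<close> fixes the family of derivatives.\<close>

lemma dpos_expand: "f \<in> poly_fun (phase_space n) \<Longrightarrow> (\<Sum>j\<le>n. dpos n j f p * proj_unit n j i) = dpos n i f p"
  and dmom_expand: "f \<in> poly_fun (phase_space n) \<Longrightarrow> (\<Sum>j\<le>n. dmom n j f p * proj_unit n j i) = dmom n i f p"
  using dir_deriv_phase_space_expand[OF pos_dir_in, of f n i p] dir_deriv_phase_space_expand[OF mom_dir_in, of f n i p]
  by (simp_all add: pos_dir_def[of n i] mom_dir_def[of n i] fun_apply coord_proj_unit proj_unit_sym[of n i] mult.commute)

lemma dpos_expand': "f \<in> poly_fun (phase_space n) \<Longrightarrow> (\<Sum>j\<le>n. dpos n j f p * proj_unit n i j) = dpos n i f p"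
  by (simp add: proj_unit_sym[of n i] dpos_expand)

text \<open>The bracket is the derivative of \<open>f\<close> along the Hamiltonian vector field of
  \<open>g\<close>. The Gram matrix of the redundant frame enters when that field is expanded and is
  absorbed by \<open>dpos_expand'\<close> and \<open>dmom_expand\<close>, so the formula looks as it
  would in a basis.\<close>

lemma poisson_eq:
  assumes f: "f \<in> poly_fun (phase_space n)" and g: "g \<in> poly_fun (phase_space n)"
  shows "poisson (refl_rep n) f g = (\<Sum>i\<le>n. dpos n i f * dmom n i g - dmom n i f * dpos n i g)"
proof
  fix p
  show "poisson (refl_rep n) f g p = (\<Sum>i\<le>n. dpos n i f * dmom n i g - dmom n i f * dpos n i g) p"
  proof (cases "p \<in> phase_space n")
    case True
    have "poisson (refl_rep n) f g p = dir_deriv (phase_space n) (ham_vec (refl_rep n) g p) f p"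
      using True ham_vec_symp[OF f ham_vec_in[OF g]] by (simp add: poisson_def ham_vec_eq f g)
    also have "\<dots> = (\<Sum>i\<le>n. dmom n i g p * dpos n i f p) + (\<Sum>i\<le>n. - dpos n i g p * dmom n i f p)"
      unfolding ham_vec_eq[OF g] dir_deriv_phase_space_expand[OF ham_vec_in[OF g] f]
      by (simp add: sum_fun_apply fun_apply coord_proj_unit fun_Compl_def dpos_expand' dmom_expand g)
    finally show ?thesis
      using True by (simp add: sum_fun_apply fun_apply sum_subtractf sum_negf mult.commute)
  qed (simp add: poisson_def sum_fun_apply fun_apply dir_deriv_outside)
qed

section \<open>The zeroth Poisson homology\<close>

text \<open>The isomorphism \<open>\<psi>\<close> sends a scalar to the coset of that multiple of
  \<open>e\<close>; it is onto since \<open>e\<close> and \<open>W\<close> span, and injective since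
  \<open>e\<close> is not in \<open>W\<close>. Both directions are recorded because the goal has the
  line on the right in one half and on the left in the other.\<close>

lemma one_dimensional_quotient:
  assumes A: "csubspace A" and W: "csubspace W" and WA: "W \<subseteq> A"
    and e: "e \<in> A" "e \<notin> W" and A_span: "A \<subseteq> cspan (insert e W)"
  shows "quotient_space A W \<cong>\<^sub>C complex_line" "complex_line \<cong>\<^sub>C quotient_space A W"
proof -
  define \<psi> where "\<psi> c = {c *\<^sub>C e + w | w. w \<in> W}" for c
  note W' = complex_vector.subspace_add[OF W] complex_vector.subspace_diff[OF W]
    complex_vector.subspace_scale[OF W] complex_vector.subspace_0[OF W]
  have coset: "{a + w | w. w \<in> W} = \<psi> c" if "a - c *\<^sub>C e \<in> W" for a c
  proof (rule Set.set_eqI, rule iffI)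
    fix x assume "x \<in> {a + w | w. w \<in> W}"
    then obtain w where "w \<in> W" "x = a + w" by auto
    with that show "x \<in> \<psi> c"
      unfolding \<psi>_def by (intro CollectI exI[of _ "(a - c *\<^sub>C e) + w"]) (simp add: W')
  next
    fix x assume "x \<in> \<psi> c"
    then obtain w where "w \<in> W" "x = c *\<^sub>C e + w" by (auto simp: \<psi>_def)
    with that show "x \<in> {a + w | w. w \<in> W}"
      by (intro CollectI exI[of _ "w - (a - c *\<^sub>C e)"]) (simp add: W')
  qed
  have carrier: "carrier (quotient_space A W) = range \<psi>"
  proof -
    have ex: "\<exists>c. a - c *\<^sub>C e \<in> W" if "a \<in> A" for a
    proof -
      have "cspan W = W" using W by (simp add: complex_vector.span_eq_iff)
      moreover have "a \<in> cspan (insert e W)" using that A_span by blast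
      ultimately show ?thesis by (metis complex_vector.span_breakdown_eq)
    qed
    have "{{a + w | w. w \<in> W} | a. a \<in> A} = range \<psi>"
    proof (intro equalityI subsetI)
      fix X assume "X \<in> {{a + w | w. w \<in> W} | a. a \<in> A}"
      then obtain a where "a \<in> A" and X: "X = {a + w | w. w \<in> W}" by blast
      with ex obtain c where "a - c *\<^sub>C e \<in> W" by blast
      with X show "X \<in> range \<psi>" by (simp only: coset rangeI)
    next
      fix X assume "X \<in> range \<psi>"
      then obtain c where "X = {c *\<^sub>C e + w | w. w \<in> W}" by (auto simp only: \<psi>_def)
      moreover have "c *\<^sub>C e \<in> A" using A e(1) by (rule complex_vector.subspace_scale)
      ultimately show "X \<in> {{a + w | w. w \<in> W} | a. a \<in> A}" by blast
    qed
    then show ?thesis by (simp add: quotient_space_def)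
  qed
  have inj: "inj \<psi>"
  proof (rule injI)
    fix c d assume "\<psi> c = \<psi> d"
    moreover have "c *\<^sub>C e \<in> \<psi> c" unfolding \<psi>_def using W' by force
    ultimately obtain w where "w \<in> W" "c *\<^sub>C e = d *\<^sub>C e + w" by (auto simp: \<psi>_def)
    then have "(c - d) *\<^sub>C e \<in> W" by (simp add: complex_vector.scale_left_diff_distrib)
    then have "(1 / (c - d)) *\<^sub>C (c - d) *\<^sub>C e \<in> W" by (rule W'(3))
    then show "c = d" using e(2) by (cases "c = d") (auto simp: scaleC_scaleC scaleC_one)
  qed
  have add: "\<psi> c \<oplus>\<^bsub>quotient_space A W\<^esub> \<psi> d = \<psi> (c + d)" for c d
  proof -
    have "{x + y | x y. x \<in> \<psi> c \<and> y \<in> \<psi> d} = \<psi> (c + d)"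
    proof (rule Set.set_eqI, rule iffI)
      fix z assume "z \<in> {x + y | x y. x \<in> \<psi> c \<and> y \<in> \<psi> d}"
      then obtain v w where "v \<in> W" "w \<in> W" "z = (c *\<^sub>C e + v) + (d *\<^sub>C e + w)"
        by (auto simp: \<psi>_def)
      then show "z \<in> \<psi> (c + d)"
        unfolding \<psi>_def by (intro CollectI exI[of _ "v + w"]) (simp add: W' scaleC_add_left)
    next
      fix z assume "z \<in> \<psi> (c + d)"
      then obtain w where w: "w \<in> W" "z = (c *\<^sub>C e + w) + (d *\<^sub>C e + 0)"
        by (auto simp: \<psi>_def scaleC_add_left)
      then show "z \<in> {x + y | x y. x \<in> \<psi> c \<and> y \<in> \<psi> d}"
        unfolding \<psi>_def using W'(4) by blast
    qed
    then show ?thesis by (simp add: quotient_space_def)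
  qed
  have smult: "c \<odot>\<^bsub>quotient_space A W\<^esub> \<psi> d = \<psi> (c * d)" for c d
  proof -
    have "{c *\<^sub>C x + w | x w. x \<in> \<psi> d \<and> w \<in> W} = \<psi> (c * d)"
    proof (rule Set.set_eqI, rule iffI)
      fix z assume "z \<in> {c *\<^sub>C x + w | x w. x \<in> \<psi> d \<and> w \<in> W}"
      then obtain v w where "v \<in> W" "w \<in> W" "z = c *\<^sub>C (d *\<^sub>C e + v) + w" by (auto simp: \<psi>_def)
      then show "z \<in> \<psi> (c * d)"
        unfolding \<psi>_def by (intro CollectI exI[of _ "c *\<^sub>C v + w"]) (simp add: W' scaleC_add_right scaleC_scaleC)
    next
      fix z assume "z \<in> \<psi> (c * d)"
      then obtain w where w: "w \<in> W" "z = c *\<^sub>C (d *\<^sub>C e + 0) + w"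
        by (auto simp: \<psi>_def scaleC_scaleC)
      then show "z \<in> {c *\<^sub>C x + w | x w. x \<in> \<psi> d \<and> w \<in> W}"
        unfolding \<psi>_def using W'(4) by blast
    qed
    then show ?thesis by (simp add: quotient_space_def)
  qed
  have bij: "bij_betw \<psi> (carrier complex_line) (carrier (quotient_space A W))"
    using inj by (simp add: bij_betw_def carrier complex_line_def)
  show "complex_line \<cong>\<^sub>C quotient_space A W"
    unfolding linear_isomorphic_def using bij
    by (intro exI[of _ \<psi>]) (simp add: add smult, simp add: complex_line_def)
  show "quotient_space A W \<cong>\<^sub>C complex_line"
    unfolding linear_isomorphic_def using bij_betw_inv_into[OF bij] inj
    by (intro exI[of _ "inv_into UNIV \<psi>"])
      (auto simp: carrier add smult complex_line_def)
qed

section \<open>The symmetric group acting on vectors, covectors and functions\<close>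

lemma perm_inv [simp]: "\<sigma> permutes S \<Longrightarrow> inv_into UNIV \<sigma> permutes S"
  and perm_inv_inv [simp]: "\<sigma> permutes S \<Longrightarrow> inv_into UNIV (inv_into UNIV \<sigma>) = \<sigma>"
  and perm_inv_apply [simp]: "\<sigma> permutes S \<Longrightarrow> inv_into UNIV \<sigma> (\<sigma> x) = x"
    "\<sigma> permutes S \<Longrightarrow> \<sigma> (inv_into UNIV \<sigma> x) = x"
  by (simp_all add: permutes_inv permutes_inv_inv permutes_inverses)

lemma act_vec_refl: "\<tau> permutes {..n} \<Longrightarrow> act_vec \<tau> x \<in> refl_rep n \<longleftrightarrow> x \<in> refl_rep n"
proof -
  assume \<tau>: "\<tau> permutes {..n}"
  then have p: "inv_into UNIV \<tau> permutes {..n}" by simp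
  have "(\<Sum>i\<le>n. x (inv_into UNIV \<tau> i)) = (\<Sum>i\<le>n. x i)"
    using sum.permute[OF p, of x] by (simp add: o_def)
  moreover have "inv_into UNIV \<tau> i = i" if "i > n" for i
    using that by (intro permutes_not_in[OF p]) simp
  ultimately show ?thesis by (simp add: act_vec_def refl_rep_def)
qed

lemma act_vec_linear: "act_vec \<tau> (x + y) = act_vec \<tau> x + act_vec \<tau> y"
  "act_vec \<tau> (c *\<^sub>C x) = c *\<^sub>C act_vec \<tau> x"
  by (simp_all add: act_vec_def fun_eq_iff fun_apply)

lemma linear_on_act_vec: "\<tau> permutes {..n} \<Longrightarrow> linear_on (act_vec \<tau>) (refl_rep n) (refl_rep n)"
  by unfold_locales (simp_all add: refl_subspace act_vec_linear act_vec_refl)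

lemma act_vec_inverse:
  "\<tau> permutes {..n} \<Longrightarrow> act_vec (inv_into UNIV \<tau>) (act_vec \<tau> x) = x"
  "\<tau> permutes {..n} \<Longrightarrow> act_vec \<tau> (act_vec (inv_into UNIV \<tau>) x) = x"
  by (auto simp: act_vec_def fun_eq_iff)

lemma permutes_le_iff: "\<tau> permutes {..n::nat} \<Longrightarrow> \<tau> i \<le> n \<longleftrightarrow> i \<le> n"
  using permutes_in_image[of \<tau> "{..n}" i] by simp

lemma act_vec_proj_unit: "\<tau> permutes {..n} \<Longrightarrow> act_vec \<tau> (proj_unit n i) = proj_unit n (\<tau> i)"
proof
  fix k assume \<tau>: "\<tau> permutes {..n}"
  then have "inv_into UNIV \<tau> k \<le> n \<longleftrightarrow> k \<le> n" by (intro permutes_le_iff) simp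
  moreover have "inv_into UNIV \<tau> k = i \<longleftrightarrow> k = \<tau> i" using \<tau> by auto
  ultimately show "act_vec \<tau> (proj_unit n i) k = proj_unit n (\<tau> i) k"
    using \<tau> by (simp add: act_vec_def proj_unit_def permutes_le_iff)
qed

lemma act_fun_act_vec_coord: "\<tau> permutes {..n} \<Longrightarrow> act_fun act_vec \<tau> (coord n i) = coord n (\<tau> i)"
  by (auto simp: act_fun_def fun_eq_iff coord_def act_vec_refl) (simp add: act_vec_def)

lemma act_fun_dual:
  assumes \<tau>: "\<tau> permutes {..n}"
  shows "act_fun act_vec \<tau> \<eta> \<in> dual (refl_rep n) \<longleftrightarrow> \<eta> \<in> dual (refl_rep n)"
proof
  interpret l: linear_on "act_vec \<tau>" "refl_rep n" "refl_rep n" by (rule linear_on_act_vec[OF \<tau>])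
  interpret l': linear_on "act_vec (inv_into UNIV \<tau>)" "refl_rep n" "refl_rep n"
    by (rule linear_on_act_vec) (simp add: \<tau>)
  show "act_fun act_vec \<tau> \<eta> \<in> dual (refl_rep n)" if "\<eta> \<in> dual (refl_rep n)"
    unfolding act_fun_def using that by (rule l'.dual_comp)
  show "\<eta> \<in> dual (refl_rep n)" if "act_fun act_vec \<tau> \<eta> \<in> dual (refl_rep n)"
    using l.dual_comp[OF that] \<tau> by (simp add: act_fun_def o_def act_vec_inverse)
qed

lemma linear_on_act_cotangent:
  assumes \<tau>: "\<tau> permutes {..n}"
  shows "linear_on (act_cotangent \<tau>) (phase_space n) (phase_space n)"
proof unfold_locales
  show "csubspace (phase_space n)" by (rule phase_space_subspace)
  show "act_cotangent \<tau> (x + y) = act_cotangent \<tau> x + act_cotangent \<tau> y" for x y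
    by (cases x; cases y) (simp add: act_cotangent_def act_vec_linear act_fun_def fun_eq_iff fun_apply)
  show "act_cotangent \<tau> (c *\<^sub>C x) = c *\<^sub>C act_cotangent \<tau> x" for c x
    by (cases x) (simp add: act_cotangent_def act_vec_linear act_fun_def fun_eq_iff fun_apply)
  show "act_cotangent \<tau> x \<in> phase_space n \<longleftrightarrow> x \<in> phase_space n" for x
    by (cases x) (simp add: act_cotangent_def act_vec_refl act_fun_dual \<tau>)
qed

lemma act_cotangent_pos_dir: "\<tau> permutes {..n} \<Longrightarrow> act_cotangent \<tau> (pos_dir n i) = pos_dir n (\<tau> i)"
  by (simp add: act_cotangent_def pos_dir_def act_vec_proj_unit) (simp add: act_fun_def fun_eq_iff fun_apply)

lemma act_cotangent_mom_dir: "\<tau> permutes {..n} \<Longrightarrow> act_cotangent \<tau> (mom_dir n i) = mom_dir n (\<tau> i)"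
  by (simp add: act_cotangent_def mom_dir_def act_fun_act_vec_coord) (simp add: act_vec_def fun_eq_iff fun_apply)

lemma act_pos_fun: "\<sigma> permutes {..n} \<Longrightarrow> act_fun act_cotangent \<sigma> (pos_fun n i) = pos_fun n (\<sigma> i)"
  and act_mom_fun: "\<sigma> permutes {..n} \<Longrightarrow> act_fun act_cotangent \<sigma> (mom_fun n i) = mom_fun n (\<sigma> i)"
  unfolding fun_eq_iff
  by (simp_all add: act_fun_def[of act_cotangent] pos_fun_def mom_fun_def linear_on.lin_iff[OF linear_on_act_cotangent]
      del: mem_Times_iff)
    (simp_all add: act_cotangent_def act_fun_def act_vec_proj_unit, simp add: act_vec_def)

section \<open>Polynomial functions as an algebra with letters\<close>

definition gen_fun :: "nat \<Rightarrow> bool \<times> nat \<Rightarrow> (nat \<Rightarrow> complex) \<times> ((nat \<Rightarrow> complex) \<Rightarrow> complex) \<Rightarrow> complex" where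
  "gen_fun n s = (if fst s then pos_fun n (snd s) else mom_fun n (snd s))"

lemma gen_fun_dual [simp]: "gen_fun n s \<in> dual (phase_space n)"
  by (simp add: gen_fun_def)

lemma gen_fun_in [simp]: "gen_fun n s \<in> poly_fun (phase_space n)"
  by (intro poly_fun.linear) simp

definition poisson_form :: "nat \<Rightarrow> bool \<times> nat \<Rightarrow> bool \<times> nat \<Rightarrow> complex" where
  "poisson_form n s t = (\<Sum>k\<le>n. gen_fun n s (pos_dir n k) * gen_fun n t (mom_dir n k)
     - gen_fun n s (mom_dir n k) * gen_fun n t (pos_dir n k))"

text \<open>This smaller interpretation comes first because \<open>fun_alg.ev\<close> is needed to
  state \<open>poly_fun_words\<close>, which the full one requires.\<close>

global_interpretation fun_alg: algebra_with_letters "poly_fun (phase_space n)" "(*)" "ind (phase_space n)" "gen_fun n" for n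
  by unfold_locales
    (simp_all add: poly_fun_subspace scaleC_mult_fun algebra_simps)

lemma poly_fun_words: "poly_fun (phase_space n) \<subseteq> cspan (range (fun_alg.ev n))"
proof
  fix f assume "f \<in> poly_fun (phase_space n)"
  then show "f \<in> cspan (range (fun_alg.ev n))"
  proof (induction f rule: poly_fun_induct)
    case (const c)
    show ?case by (intro complex_vector.span_scale fun_alg.e_in_words)
  next
    case (linear l)
    have "pos_fun n i \<in> cspan (range (fun_alg.ev n))" "mom_fun n i \<in> cspan (range (fun_alg.ev n))" for i
      using fun_alg.gen_in_words[of n "(True, i)"] fun_alg.gen_in_words[of n "(False, i)"]
      by (simp_all add: gen_fun_def)
    then have "(\<Sum>i\<le>n. l (pos_dir n i) *\<^sub>C pos_fun n i) + (\<Sum>i\<le>n. l (mom_dir n i) *\<^sub>C mom_fun n i) \<in> cspan (range (fun_alg.ev n))"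
      by (intro complex_vector.span_add complex_vector.span_sum complex_vector.span_scale)
    then show ?case by (simp only: dual_phase_space_expand[OF linear, symmetric])
  next
    case (add f g)
    then show ?case by (intro complex_vector.span_add)
  next
    case (mult f g)
    then show ?case by (intro fun_alg.words_mul_closed)
  qed
qed

lemma dir_deriv_phase_space_in [simp]:
  "f \<in> poly_fun (phase_space n) \<Longrightarrow> dpos n i f \<in> poly_fun (phase_space n)" "f \<in> poly_fun (phase_space n) \<Longrightarrow> dmom n i f \<in> poly_fun (phase_space n)"
  by (simp_all add: dir_deriv_poly_fun[OF phase_space_subspace] del: mem_Times_iff)

lemmas phase_space_deriv_simps =
  dir_deriv_add[OF phase_space_subspace pos_dir_in] dir_deriv_mult[OF phase_space_subspace pos_dir_in]
  dir_deriv_scale[OF phase_space_subspace pos_dir_in] dir_deriv_linear[OF phase_space_subspace pos_dir_in]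
  dir_deriv_add[OF phase_space_subspace mom_dir_in] dir_deriv_mult[OF phase_space_subspace mom_dir_in]
  dir_deriv_scale[OF phase_space_subspace mom_dir_in] dir_deriv_linear[OF phase_space_subspace mom_dir_in]
  dir_deriv_ind[OF phase_space_subspace pos_dir_in] dir_deriv_ind[OF phase_space_subspace mom_dir_in]

text \<open>The group permutes both frames by the same index map, so it merely reorders the sum in
  \<open>poisson_eq\<close>.\<close>

lemma act_poisson:
  assumes \<sigma>: "\<sigma> permutes {..n}" and f: "f \<in> poly_fun (phase_space n)" and g: "g \<in> poly_fun (phase_space n)"
  shows "act_fun act_cotangent \<sigma> (poisson (refl_rep n) f g) =
    poisson (refl_rep n) (act_fun act_cotangent \<sigma> f) (act_fun act_cotangent \<sigma> g)"
proof -
  let ?\<tau> = "inv_into UNIV \<sigma>"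
  let ?\<phi> = "act_cotangent ?\<tau>"
  have \<tau>: "?\<tau> permutes {..n}" using \<sigma> by simp
  interpret linear_on ?\<phi> "phase_space n" "phase_space n" by (rule linear_on_act_cotangent[OF \<tau>])
  let ?b = "\<lambda>i. dpos n i f * dmom n i g - dmom n i f * dpos n i g"
  have "poisson (refl_rep n) (f \<circ> ?\<phi>) (g \<circ> ?\<phi>) = (\<Sum>i\<le>n. ?b (?\<tau> i) \<circ> ?\<phi>)"
    unfolding poisson_eq[OF poly_fun_comp[OF f] poly_fun_comp[OF g]] dir_deriv_comp
      act_cotangent_pos_dir[OF \<tau>] act_cotangent_mom_dir[OF \<tau>]
    by (intro sum.cong) (simp_all add: fun_eq_iff fun_apply)
  also have "\<dots> = (\<Sum>i\<le>n. ?b i \<circ> ?\<phi>)"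
    using sum.permute[OF \<tau>, of "\<lambda>i. ?b i \<circ> ?\<phi>"] by (simp add: o_def)
  also have "\<dots> = (\<Sum>i\<le>n. ?b i) \<circ> ?\<phi>"
    by (simp add: fun_eq_iff sum_fun_apply)
  finally show ?thesis by (simp add: act_fun_def poisson_eq f g)
qed

global_interpretation fun_alg: symmetric_weyl_algebra "poly_fun (phase_space n)" "(*)" "ind (phase_space n)" "gen_fun n"
  n "poisson (refl_rep n)" "act_fun act_cotangent" "\<lambda>_ _. 0" "poisson_form n" "-1" for n
proof unfold_locales
  fix f g h :: "(nat \<Rightarrow> complex) \<times> ((nat \<Rightarrow> complex) \<Rightarrow> complex) \<Rightarrow> complex"
  assume f: "f \<in> poly_fun (phase_space n)" and g: "g \<in> poly_fun (phase_space n)"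
  show "poisson (refl_rep n) f g \<in> poly_fun (phase_space n)"
    using f g by (auto simp: poisson_eq intro!: poly_fun_sum)
  assume h: "h \<in> poly_fun (phase_space n)"
  show "poisson (refl_rep n) (f + g) h = poisson (refl_rep n) f h + poisson (refl_rep n) g h"
    "poisson (refl_rep n) f (g + h) = poisson (refl_rep n) f g + poisson (refl_rep n) f h"
    using f g h by (simp_all add: poisson_eq phase_space_deriv_simps sum.distrib[symmetric] algebra_simps)
  show "poisson (refl_rep n) (f * g) h = f * poisson (refl_rep n) g h + poisson (refl_rep n) f h * g"
    "poisson (refl_rep n) f (g * h) = poisson (refl_rep n) f g * h + g * poisson (refl_rep n) f h"
    using f g h by (simp_all add: poisson_eq phase_space_deriv_simps sum_distrib_left sum_distrib_right
        sum.distrib[symmetric] algebra_simps)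
next
  show "gen_fun n (x, i) = 0" if "n < i" for i x
    using that by (simp add: gen_fun_def pos_fun_outside mom_fun_outside)
  show "(\<Sum>i\<le>n. gen_fun n (x, i)) = 0" for x
    by (cases x) (simp_all add: gen_fun_def sum_pos_fun sum_mom_fun)
  show "gen_fun n s * gen_fun n t - gen_fun n t * gen_fun n s = 0 *\<^sub>C ind (phase_space n)" for s t
    by (simp add: mult.commute)
  show "poisson (refl_rep n) (gen_fun n s) (gen_fun n t) = poisson_form n s t *\<^sub>C ind (phase_space n)" for s t
    by (simp add: poisson_eq poisson_form_def phase_space_deriv_simps scaleC_mult_fun complex_vector.scale_sum_left
        complex_vector.scale_left_diff_distrib scaleC_scaleC mult.commute)
  show "poisson_form n (True, i) (True, j) = 0" for i j
    by (simp add: poisson_form_def gen_fun_def pos_fun_mom_dir)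
  show "poisson_form n (False, i) (True, j) = - 1 * (of_bool (i = j) - 1 / of_nat (Suc n))"
    if "i \<le> n" "j \<le> n" for i j
  proof -
    \<comment> \<open>The sum is the square of the projection matrix, which is idempotent: its rows
      lie in \<open>refl_rep n\<close> and are reproduced by
      \<open>refl_expand_apply\<close>.\<close>
    have "poisson_form n (False, i) (True, j) = - (\<Sum>k\<le>n. proj_unit n i k * proj_unit n k j)"
      by (simp add: poisson_form_def gen_fun_def mom_fun_pos_dir mom_fun_mom_dir pos_fun_pos_dir sum_negf proj_unit_sym[of n i])
    also have "\<dots> = - proj_unit n i j" by (simp add: refl_expand_apply[symmetric])
    finally show ?thesis using that by (auto simp: proj_unit_def)
  qed
  show "(- 1 :: complex) \<noteq> 0" by simp
  show "poly_fun (phase_space n) \<subseteq> cspan (range (fun_alg.ev n))" by (rule poly_fun_words)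
  fix \<sigma> :: "nat \<Rightarrow> nat" assume \<sigma>: "\<sigma> permutes {..n}"
  interpret linear_on "act_cotangent (inv_into UNIV \<sigma>)" "phase_space n" "phase_space n"
    by (rule linear_on_act_cotangent) (simp add: \<sigma>)
  show "act_fun act_cotangent \<sigma> (ind (phase_space n)) = ind (phase_space n)" by (simp add: act_fun_def ind_comp)
  show "act_fun act_cotangent \<sigma> (gen_fun n s) = gen_fun n (apsnd \<sigma> s)" for s
    by (simp add: gen_fun_def act_pos_fun act_mom_fun \<sigma>)
  fix f g :: "(nat \<Rightarrow> complex) \<times> ((nat \<Rightarrow> complex) \<Rightarrow> complex) \<Rightarrow> complex" and k :: complex
  assume f: "f \<in> poly_fun (phase_space n)"
  show "act_fun act_cotangent \<sigma> f \<in> poly_fun (phase_space n)" using f by (simp add: act_fun_def poly_fun_comp)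
  show "act_fun act_cotangent \<sigma> (k *\<^sub>C f) = k *\<^sub>C act_fun act_cotangent \<sigma> f"
    by (simp add: act_fun_def fun_eq_iff fun_apply)
  assume g: "g \<in> poly_fun (phase_space n)"
  show "act_fun act_cotangent \<sigma> (f + g) = act_fun act_cotangent \<sigma> f + act_fun act_cotangent \<sigma> g"
    "act_fun act_cotangent \<sigma> (f * g) = act_fun act_cotangent \<sigma> f * act_fun act_cotangent \<sigma> g"
    by (simp_all add: act_fun_def fun_eq_iff fun_apply)
  show "act_fun act_cotangent \<sigma> (poisson (refl_rep n) f g) =
    poisson (refl_rep n) (act_fun act_cotangent \<sigma> f) (act_fun act_cotangent \<sigma> g)"
    by (rule act_poisson[OF \<sigma> f g])
qed

lemma inv_poly_fun_eq: "inv_poly_fun n = fun_alg.B n"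
  by (auto simp: inv_poly_fun_def fun_alg.B_def weyl_group_def)

text \<open>Transpositions fix the origin and permute the frame, so all these derivatives agree;
  since the frame sums to zero, so do they. Position directions are enough because every term of
  \<open>poisson_eq\<close> contains one.\<close>

lemma invariant_deriv_zero:
  assumes "f \<in> inv_poly_fun n" "i \<le> n"
  shows "dpos n i f 0 = 0"
proof -
  have f: "f \<in> poly_fun (phase_space n)" using assms(1) by (simp add: inv_poly_fun_def)
  have eq: "dpos n j f 0 = dpos n i f 0" if "j \<le> n" for j
  proof -
    let ?\<sigma> = "Transposition.transpose i j"
    have \<sigma>: "?\<sigma> permutes {..n}" using assms(2) that by (intro permutes_swap_id) auto
    then have \<tau>: "inv_into UNIV ?\<sigma> permutes {..n}" by simp
    interpret linear_on "act_cotangent (inv_into UNIV ?\<sigma>)" "phase_space n" "phase_space n"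
      by (rule linear_on_act_cotangent[OF \<tau>])
    have "dpos n j f = dpos n j (f \<circ> act_cotangent (inv_into UNIV ?\<sigma>))"
      using assms(1) \<sigma> by (auto simp: inv_poly_fun_def weyl_group_def act_fun_def)
    also have "\<dots> = dpos n i f \<circ> act_cotangent (inv_into UNIV ?\<sigma>)"
    proof -
      have "inv_into UNIV ?\<sigma> j = i" by simp
      then show ?thesis by (simp only: dir_deriv_comp act_cotangent_pos_dir[OF \<tau>])
    qed
    finally have "dpos n j f 0 = (dpos n i f \<circ> act_cotangent (inv_into UNIV ?\<sigma>)) 0" by (rule fun_cong)
    then have "dpos n j f 0 = dpos n i f (act_cotangent (inv_into UNIV ?\<sigma>) 0)" by (simp only: comp_apply)
    also have "act_cotangent (inv_into UNIV ?\<sigma>) 0 = 0"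
      using lin_scale[of 0 0] by simp
    finally show ?thesis .
  qed
  have "(\<Sum>j\<le>n. pos_dir n j) = 0"
    by (simp add: prod_eq_iff fst_sum snd_sum pos_dir_def sum_proj_unit)
  then have "dir_deriv (phase_space n) 0 f 0 = (\<Sum>j\<le>n. dpos n j f 0)"
    using dir_deriv_sum_direction[OF phase_space_subspace, of "{..n}" "pos_dir n" n f] f
    by (simp add: sum_fun_apply del: mem_Times_iff)
  moreover have "dir_deriv (phase_space n) 0 f 0 = 0"
    by (simp add: dir_deriv_def)
  ultimately have "of_nat (Suc n) * dpos n i f 0 = 0" using eq by simp
  then show ?thesis by (simp del: of_nat_Suc)
qed

theorem HP0_line: "HP0 (inv_poly_fun n) (poisson (refl_rep n)) \<cong>\<^sub>C complex_line"
proof -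
  let ?S = "{poisson (refl_rep n) f g | f g. f \<in> inv_poly_fun n \<and> g \<in> inv_poly_fun n}"
  let ?K = "{h. h 0 = (0::complex)}"
  have "poisson (refl_rep n) f g 0 = 0" if "f \<in> inv_poly_fun n" "g \<in> inv_poly_fun n" for f g
    using that by (auto simp: inv_poly_fun_def poisson_eq sum_fun_apply fun_apply invariant_deriv_zero)
  moreover have "csubspace ?K" by (auto simp: complex_vector.subspace_def fun_apply)
  ultimately have K: "cspan ?S \<subseteq> ?K" by (intro complex_vector.span_minimal) auto
  show ?thesis
    unfolding HP0_def
  proof (rule one_dimensional_quotient)
    show "csubspace (inv_poly_fun n)" unfolding inv_poly_fun_eq by (rule fun_alg.B_subspace)
    show "csubspace (cspan ?S)" by (rule complex_vector.subspace_span)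
    show "cspan ?S \<subseteq> inv_poly_fun n"
      unfolding inv_poly_fun_eq by (intro complex_vector.span_minimal fun_alg.B_subspace) (auto intro: fun_alg.br_B)
    show "ind (phase_space n) \<in> inv_poly_fun n" unfolding inv_poly_fun_eq by (rule fun_alg.e_B)
    have "ind (phase_space n) 0 = 1" by (simp add: ind_def zero_prod_def)
    then show "ind (phase_space n) \<notin> cspan ?S" using K by auto
    have "insert (ind (phase_space n)) ?S \<subseteq> insert (ind (phase_space n)) (cspan ?S)"
      using complex_vector.span_superset[of ?S] by blast
    then show "inv_poly_fun n \<subseteq> cspan (insert (ind (phase_space n)) (cspan ?S))"
      using fun_alg.invariants_spanned[of n] complex_vector.span_mono unfolding inv_poly_fun_eq by blast
  qed
qed

section \<open>Differential operators\<close>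

lemma (in algebra_with_letters) commutator_leibniz:
  assumes "a \<in> A" "b \<in> A" "c \<in> A"
  shows "(a \<star> b) \<star> c - c \<star> (a \<star> b) = a \<star> (b \<star> c - c \<star> b) + (a \<star> c - c \<star> a) \<star> b"
    and "a \<star> (b \<star> c) - (b \<star> c) \<star> a = (a \<star> b - b \<star> a) \<star> c + b \<star> (a \<star> c - c \<star> a)"
  using assms by (simp_all add: mul_diff diff_mul mul_assoc)

text \<open>The types confine these rules to operators: they evaluate a sum of operators at a
  function without unfolding the result at points.\<close>

lemma op_apply:
  fixes D E :: "'a \<Rightarrow> 'b \<Rightarrow> complex"
  shows "(D + E) g = D g + E g" "(D - E) g = D g - E g" "(c *\<^sub>C D) g = c *\<^sub>C D g"
    "(0 :: 'a \<Rightarrow> 'b \<Rightarrow> complex) g = 0"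
  by (simp_all only: fun_apply)

section \<open>Multiplications, derivatives and the algebra they generate\<close>

definition mult_op :: "'a::complex_vector set \<Rightarrow> ('a \<Rightarrow> complex) \<Rightarrow> ('a \<Rightarrow> complex) \<Rightarrow> 'a \<Rightarrow> complex" where
  "mult_op S f = (\<lambda>g. if g \<in> poly_fun S then f * g else 0)"

definition deriv_op :: "'a::complex_vector set \<Rightarrow> 'a \<Rightarrow> ('a \<Rightarrow> complex) \<Rightarrow> 'a \<Rightarrow> complex" where
  "deriv_op S v = (\<lambda>g. if g \<in> poly_fun S then dir_deriv S v g else 0)"

lemma diff_op_induct [consumes 1, case_names mult deriv add comp]:
  assumes "D \<in> diff_op S"
    and "\<And>f. f \<in> poly_fun S \<Longrightarrow> P (mult_op S f)"
    and "\<And>v. v \<in> S \<Longrightarrow> P (deriv_op S v)"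
    and "\<And>D E. D \<in> diff_op S \<Longrightarrow> E \<in> diff_op S \<Longrightarrow> P D \<Longrightarrow> P E \<Longrightarrow> P (D + E)"
    and "\<And>D E. D \<in> diff_op S \<Longrightarrow> E \<in> diff_op S \<Longrightarrow> P D \<Longrightarrow> P E \<Longrightarrow> P (D \<circ> E)"
  shows "P D"
  using assms(1)
proof (induction D rule: diff_op.induct)
  case (mult f)
  then show ?case using assms(2)[of f] by (simp only: mult_op_def)
next
  case (deriv v)
  then show ?case using assms(3)[of v] by (simp only: deriv_op_def)
next
  case (add D E)
  then show ?case using assms(4)[of D E] by (simp only: plus_fun_def)
next
  case (comp D E)
  then show ?case using assms(5)[of D E] by (simp only: comp_def)
qed

lemma mult_op_in [simp]: "f \<in> poly_fun S \<Longrightarrow> mult_op S f \<in> diff_op S"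
  unfolding mult_op_def by (rule diff_op.mult)

lemma deriv_op_in [simp]: "v \<in> S \<Longrightarrow> deriv_op S v \<in> diff_op S"
  unfolding deriv_op_def by (rule diff_op.deriv)

lemma mult_op_apply: "g \<in> poly_fun S \<Longrightarrow> mult_op S f g = f * g" "g \<notin> poly_fun S \<Longrightarrow> mult_op S f g = 0"
  and deriv_op_apply: "g \<in> poly_fun S \<Longrightarrow> deriv_op S v g = dir_deriv S v g" "g \<notin> poly_fun S \<Longrightarrow> deriv_op S v g = 0"
  by (simp_all add: mult_op_def deriv_op_def)

text \<open>The four properties are proved together, because linearity of a composition requires
  that the inner operator preserve polynomial functions.\<close>

lemma diff_op_linear:
  assumes S: "csubspace S" and D: "D \<in> diff_op S"
  shows "(\<forall>g. g \<notin> poly_fun S \<longrightarrow> D g = 0) \<and> (\<forall>g\<in>poly_fun S. D g \<in> poly_fun S) \<and>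
    (\<forall>g\<in>poly_fun S. \<forall>h\<in>poly_fun S. D (g + h) = D g + D h) \<and>
    (\<forall>c. \<forall>g\<in>poly_fun S. D (c *\<^sub>C g) = c *\<^sub>C D g)"
  using D
proof (induction D rule: diff_op_induct)
  case (mult f)
  then show ?case by (simp add: mult_op_apply distrib_left scaleC_mult_fun)
next
  case (deriv v)
  then show ?case using S
    by (simp add: deriv_op_apply dir_deriv_add dir_deriv_scale dir_deriv_poly_fun)
next
  case (add D E)
  then show ?case by (simp add: op_apply scaleC_add_right algebra_simps)
next
  case (comp D E)
  \<comment> \<open>Outside \<open>poly_fun S\<close> the inner operator returns 0, so the outer one
    must send 0 to 0.\<close>
  moreover have "D (0 *\<^sub>C 0) = 0 *\<^sub>C D 0" using comp.IH(1) poly_fun_zero by blast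
  ultimately show ?case by simp
qed

lemma diff_op_outside: "csubspace S \<Longrightarrow> D \<in> diff_op S \<Longrightarrow> g \<notin> poly_fun S \<Longrightarrow> D g = 0"
  and diff_op_preserves: "csubspace S \<Longrightarrow> D \<in> diff_op S \<Longrightarrow> g \<in> poly_fun S \<Longrightarrow> D g \<in> poly_fun S"
  and diff_op_add: "csubspace S \<Longrightarrow> D \<in> diff_op S \<Longrightarrow> g \<in> poly_fun S \<Longrightarrow> h \<in> poly_fun S \<Longrightarrow>
    D (g + h) = D g + D h"
  and diff_op_scale: "csubspace S \<Longrightarrow> D \<in> diff_op S \<Longrightarrow> g \<in> poly_fun S \<Longrightarrow> D (c *\<^sub>C g) = c *\<^sub>C D g"
  using diff_op_linear[of S D] by blast+

lemma diff_op_zero: "csubspace S \<Longrightarrow> D \<in> diff_op S \<Longrightarrow> D 0 = 0"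
  using diff_op_scale[of S D 0 0] by simp

lemma mult_op_add: "mult_op S (f + g) = mult_op S f + mult_op S g"
  and mult_op_scale: "mult_op S (c *\<^sub>C f) = c *\<^sub>C mult_op S f"
  by (auto simp: mult_op_def fun_eq_iff fun_apply distrib_right)

lemma mult_op_mult: "f \<in> poly_fun S \<Longrightarrow> g \<in> poly_fun S \<Longrightarrow> mult_op S (f * g) = mult_op S f \<circ> mult_op S g"
  by (auto simp: mult_op_def fun_eq_iff mult.assoc fun_apply)

lemma mult_op_zero: "mult_op S 0 = 0"
  by (auto simp: mult_op_def fun_eq_iff fun_apply)

lemma mult_op_sum: "mult_op S (\<Sum>i\<in>I. f i) = (\<Sum>i\<in>I. mult_op S (f i))"
  by (induction I rule: infinite_finite_induct) (simp_all add: mult_op_zero mult_op_add)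

lemma deriv_op_add: "csubspace S \<Longrightarrow> v \<in> S \<Longrightarrow> w \<in> S \<Longrightarrow> deriv_op S (v + w) = deriv_op S v + deriv_op S w"
  by (auto simp: deriv_op_def fun_eq_iff plus_fun_apply zero_fun_apply dir_deriv_add_direction)

lemma deriv_op_scale: "csubspace S \<Longrightarrow> v \<in> S \<Longrightarrow> deriv_op S (c *\<^sub>C v) = c *\<^sub>C deriv_op S v"
  by (auto simp: deriv_op_def fun_eq_iff scaleC_fun_apply zero_fun_apply dir_deriv_scale_direction)

lemma deriv_op_zero: "csubspace S \<Longrightarrow> deriv_op S 0 = 0"
  using deriv_op_scale[of S 0 0] by (simp add: complex_vector.subspace_0)

lemma diff_op_scaleC: "csubspace S \<Longrightarrow> D \<in> diff_op S \<Longrightarrow> c *\<^sub>C D \<in> diff_op S"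
proof -
  assume S: "csubspace S" and D: "D \<in> diff_op S"
  have "c *\<^sub>C D = mult_op S (c *\<^sub>C ind S) \<circ> D"
  proof
    fix g show "(c *\<^sub>C D) g = (mult_op S (c *\<^sub>C ind S) \<circ> D) g"
      by (cases "g \<in> poly_fun S")
        (simp_all add: op_apply mult_op_apply diff_op_preserves[OF S D] diff_op_outside[OF S D] scaleC_mult_fun)
  qed
  then show ?thesis using D by (simp only: diff_op.comp mult_op_in poly_fun_scale poly_fun_ind)
qed

lemma diff_op_subspace: "csubspace S \<Longrightarrow> csubspace (diff_op S)"
  using diff_op_scaleC[of S "mult_op S 0" 0] by (simp add: complex_vector.subspace_def diff_op_scaleC diff_op.add)

section \<open>The letters as operators\<close>

definition gen_op :: "nat \<Rightarrow> bool \<times> nat \<Rightarrow> ((nat \<Rightarrow> complex) \<Rightarrow> complex) \<Rightarrow> ((nat \<Rightarrow> complex) \<Rightarrow> complex)" where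
  "gen_op n s = (if fst s then mult_op (refl_rep n) (coord n (snd s)) else deriv_op (refl_rep n) (proj_unit n (snd s)))"

text \<open>The identity of HOL does not vanish outside \<open>poly_fun S\<close>; under the
  convention for operators the unit for composition is multiplication by the constant 1.\<close>

abbreviation id_op :: "'a::complex_vector set \<Rightarrow> ('a \<Rightarrow> complex) \<Rightarrow> 'a \<Rightarrow> complex" where
  "id_op S \<equiv> mult_op S (ind S)"

lemma coord_poly [simp]: "coord n i \<in> poly_fun (refl_rep n)"
  by (intro poly_fun.linear) simp

lemma gen_op_in [simp]: "gen_op n s \<in> diff_op (refl_rep n)"
  by (simp add: gen_op_def)

lemma algebra_diff_op: "csubspace S \<Longrightarrow> (\<And>s. gen s \<in> diff_op S) \<Longrightarrow>
  algebra_with_letters (diff_op S) (\<circ>) (id_op S) gen"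
proof
  assume S: "csubspace S"
  note facts = diff_op_preserves[OF S] diff_op_outside[OF S] diff_op_zero[OF S] diff_op_add[OF S] diff_op_scale[OF S]
  show "csubspace (diff_op S)" by (rule diff_op_subspace[OF S])
  show "id_op S \<in> diff_op S" by simp
  fix a b c :: "('a \<Rightarrow> complex) \<Rightarrow> 'a \<Rightarrow> complex" and k
  show "a \<circ> b \<circ> c = a \<circ> (b \<circ> c)" by (simp add: o_assoc)
  assume a: "a \<in> diff_op S"
  show "id_op S \<circ> a = a"
  proof
    fix g show "(id_op S \<circ> a) g = a g"
      using a by (cases "g \<in> poly_fun S") (simp_all add: mult_op_apply facts)
  qed
  show "a \<circ> id_op S = a"
  proof
    fix g show "(a \<circ> id_op S) g = a g"
      using a by (cases "g \<in> poly_fun S") (simp_all add: mult_op_apply facts)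
  qed
  assume b: "b \<in> diff_op S"
  show "a \<circ> b \<in> diff_op S" using a b by (rule diff_op.comp)
  show "(k *\<^sub>C a) \<circ> b = k *\<^sub>C (a \<circ> b)" by (rule ext) (simp add: op_apply)
  show "a \<circ> (k *\<^sub>C b) = k *\<^sub>C (a \<circ> b)"
  proof
    fix g show "(a \<circ> (k *\<^sub>C b)) g = (k *\<^sub>C (a \<circ> b)) g"
      using a b by (cases "g \<in> poly_fun S") (simp_all add: op_apply facts)
  qed
  assume c: "c \<in> diff_op S"
  show "(a + b) \<circ> c = (a \<circ> c) + (b \<circ> c)" by (rule ext) (simp add: op_apply)
  show "a \<circ> (b + c) = (a \<circ> b) + (a \<circ> c)"
  proof
    fix g show "(a \<circ> (b + c)) g = ((a \<circ> b) + (a \<circ> c)) g"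
      using a b c by (cases "g \<in> poly_fun S") (simp_all add: op_apply facts)
  qed
qed

global_interpretation op_alg: algebra_with_letters "diff_op (refl_rep n)" "(\<circ>)" "id_op (refl_rep n)" "gen_op n" for n
  by (rule algebra_diff_op) (simp_all add: refl_subspace)

lemma diff_op_words: "diff_op (refl_rep n) \<subseteq> cspan (range (op_alg.ev n))"
proof
  let ?W = "cspan (range (op_alg.ev n))" and ?S = "refl_rep n"
  have coord: "mult_op ?S (coord n i) \<in> ?W" and proj_unit: "deriv_op ?S (proj_unit n i) \<in> ?W" for i
    using op_alg.gen_in_words[of n "(True, i)"] op_alg.gen_in_words[of n "(False, i)"] by (simp_all add: gen_op_def)
  have mult_op: "mult_op ?S f \<in> ?W" if "f \<in> poly_fun ?S" for f
    using that
  proof (induction f rule: poly_fun_induct)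
    case (const c)
    show ?case unfolding mult_op_scale by (intro complex_vector.span_scale op_alg.e_in_words)
  next
    case (linear l)
    have "mult_op ?S (\<Sum>i\<le>n. l (proj_unit n i) *\<^sub>C coord n i) \<in> ?W"
      unfolding mult_op_sum mult_op_scale by (intro complex_vector.span_sum complex_vector.span_scale coord)
    then show ?case by (simp only: dual_refl_expand[OF linear, symmetric])
  next
    case (add f g)
    then show ?case unfolding mult_op_add by (intro complex_vector.span_add)
  next
    case (mult f g)
    then show ?case by (simp only: mult_op_mult op_alg.words_mul_closed)
  qed
  have deriv_op: "deriv_op ?S v \<in> ?W" if "v \<in> ?S" for v
  proof -
    have "deriv_op ?S (\<Sum>i\<in>I. v i *\<^sub>C proj_unit n i) \<in> ?W" if "finite I" for I
      using that
    proof (induction I rule: finite_induct)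
      case empty
      show ?case unfolding sum.empty deriv_op_zero[OF refl_subspace] by (rule complex_vector.span_zero)
    next
      case (insert i I)
      have "(\<Sum>i\<in>I. v i *\<^sub>C proj_unit n i) \<in> ?S" by (intro complex_vector.subspace_sum refl_subspace scale_proj_unit_in)
      then have "deriv_op ?S (\<Sum>i\<in>insert i I. v i *\<^sub>C proj_unit n i) = v i *\<^sub>C deriv_op ?S (proj_unit n i) + deriv_op ?S (\<Sum>i\<in>I. v i *\<^sub>C proj_unit n i)"
        using insert.hyps by (simp add: deriv_op_add deriv_op_scale refl_subspace)
      then show ?case
        by (simp only:) (intro complex_vector.span_add complex_vector.span_scale proj_unit insert.IH)
    qed
    from this[of "{..n}"] show ?thesis by (simp only: finite_atMost refl_expand[OF that, symmetric])
  qed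
  fix D assume "D \<in> diff_op ?S"
  then show "D \<in> ?W"
  proof (induction D rule: diff_op_induct)
    case (mult f)
    then show ?case by (rule mult_op)
  next
    case (deriv v)
    then show ?case by (rule deriv_op)
  next
    case (add D E)
    show ?case by (rule complex_vector.span_add[OF add.IH])
  next
    case (comp D E)
    show ?case by (rule op_alg.words_mul_closed[OF comp.IH])
  qed
qed

definition comm_form :: "nat \<Rightarrow> bool \<times> nat \<Rightarrow> bool \<times> nat \<Rightarrow> complex" where
  "comm_form n s t = (if fst s = fst t then 0 else if fst s then - proj_unit n (snd t) (snd s)
     else proj_unit n (snd s) (snd t))"

lemma comm_deriv_op_mult_op:
  assumes S: "csubspace S" and v: "v \<in> S" and l: "l \<in> dual S"
  shows "(deriv_op S v \<circ> mult_op S l) - (mult_op S l \<circ> deriv_op S v) = l v *\<^sub>C id_op S"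
proof
  have l': "l \<in> poly_fun S" using l by (rule poly_fun.linear)
  fix g show "((deriv_op S v \<circ> mult_op S l) - (mult_op S l \<circ> deriv_op S v)) g = (l v *\<^sub>C id_op S) g"
    by (cases "g \<in> poly_fun S")
      (simp_all add: op_apply mult_op_apply deriv_op_apply
        l' dir_deriv_poly_fun[OF S v] dir_deriv_mult[OF S v] dir_deriv_linear[OF S v l] scaleC_mult_fun
        dir_deriv_zero[OF S v])
qed

lemma gen_op_comm: "(gen_op n s \<circ> gen_op n t) - (gen_op n t \<circ> gen_op n s) = comm_form n s t *\<^sub>C id_op (refl_rep n)"
proof -
  let ?S = "refl_rep n"
  have mm: "mult_op ?S (coord n i) \<circ> mult_op ?S (coord n j) = mult_op ?S (coord n j) \<circ> mult_op ?S (coord n i)" for i j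
    by (simp add: mult_op_mult[symmetric] mult.commute)
  have dd: "deriv_op ?S (proj_unit n i) \<circ> deriv_op ?S (proj_unit n j) = deriv_op ?S (proj_unit n j) \<circ> deriv_op ?S (proj_unit n i)" for i j
  proof
    fix g show "(deriv_op ?S (proj_unit n i) \<circ> deriv_op ?S (proj_unit n j)) g = (deriv_op ?S (proj_unit n j) \<circ> deriv_op ?S (proj_unit n i)) g"
      by (cases "g \<in> poly_fun ?S")
        (simp_all add: deriv_op_apply dir_deriv_poly_fun[OF refl_subspace] dir_deriv_zero[OF refl_subspace]
          dir_deriv_commute[OF refl_subspace, of "proj_unit n i"])
  qed
  have dm: "(deriv_op ?S (proj_unit n i) \<circ> mult_op ?S (coord n j)) - (mult_op ?S (coord n j) \<circ> deriv_op ?S (proj_unit n i)) = proj_unit n i j *\<^sub>C id_op ?S" for i j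
    using comm_deriv_op_mult_op[OF refl_subspace, of "proj_unit n i" n "coord n j"] by (simp add: coord_proj_unit)
  have md: "(mult_op ?S (coord n j) \<circ> deriv_op ?S (proj_unit n i)) - (deriv_op ?S (proj_unit n i) \<circ> mult_op ?S (coord n j)) = (- proj_unit n i j) *\<^sub>C id_op ?S" for i j
    using arg_cong[OF dm[of i j], of uminus] by simp
  show ?thesis
    using mm[of "snd s" "snd t"] dd[of "snd s" "snd t"] dm[of "snd s" "snd t"] md[of "snd s" "snd t"]
    by (cases "fst s"; cases "fst t") (simp_all add: gen_op_def comm_form_def)
qed

section \<open>The symmetric group acting on operators\<close>

lemma act_fun_act_vec_simps:
  "act_fun act_vec \<sigma> (f + g) = act_fun act_vec \<sigma> f + act_fun act_vec \<sigma> g"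
  "act_fun act_vec \<sigma> (f * g) = act_fun act_vec \<sigma> f * act_fun act_vec \<sigma> g"
  "act_fun act_vec \<sigma> (c *\<^sub>C f) = c *\<^sub>C act_fun act_vec \<sigma> f"
  "act_fun act_vec \<sigma> 0 = 0"
  by (simp_all add: act_fun_def fun_eq_iff fun_apply)

lemma act_fun_inverse:
  "\<sigma> permutes {..n} \<Longrightarrow> act_fun act_vec (inv_into UNIV \<sigma>) (act_fun act_vec \<sigma> f) = f"
  "\<sigma> permutes {..n} \<Longrightarrow> act_fun act_vec \<sigma> (act_fun act_vec (inv_into UNIV \<sigma>) f) = f"
  by (auto simp: act_fun_def fun_eq_iff act_vec_inverse)

lemma act_fun_poly_fun:
  "\<sigma> permutes {..n} \<Longrightarrow> f \<in> poly_fun (refl_rep n) \<Longrightarrow> act_fun act_vec \<sigma> f \<in> poly_fun (refl_rep n)"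
  unfolding act_fun_def by (rule linear_on.poly_fun_comp[OF linear_on_act_vec]) simp_all

lemma act_fun_poly_fun_iff:
  "\<sigma> permutes {..n} \<Longrightarrow> act_fun act_vec \<sigma> f \<in> poly_fun (refl_rep n) \<longleftrightarrow> f \<in> poly_fun (refl_rep n)"
  using act_fun_poly_fun[of \<sigma> n f] act_fun_poly_fun[of "inv_into UNIV \<sigma>" n "act_fun act_vec \<sigma> f"]
  by (auto simp: act_fun_inverse)

lemma act_op_mult_op:
  assumes "\<sigma> permutes {..n}"
  shows "act_op \<sigma> (mult_op (refl_rep n) f) = mult_op (refl_rep n) (act_fun act_vec \<sigma> f)"
proof
  fix g
  have "inv_into UNIV \<sigma> permutes {..n}" using assms by simp
  then show "act_op \<sigma> (mult_op (refl_rep n) f) g = mult_op (refl_rep n) (act_fun act_vec \<sigma> f) g"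
    using assms
    by (simp add: act_op_def mult_op_def act_fun_poly_fun_iff act_fun_act_vec_simps act_fun_inverse)
qed

lemma act_op_deriv_op:
  assumes "\<sigma> permutes {..n}"
  shows "act_op \<sigma> (deriv_op (refl_rep n) v) = deriv_op (refl_rep n) (act_vec \<sigma> v)"
proof
  fix g
  have \<tau>: "inv_into UNIV \<sigma> permutes {..n}" using assms by simp
  have "act_fun act_vec \<sigma> (dir_deriv (refl_rep n) v (act_fun act_vec (inv_into UNIV \<sigma>) g))
    = dir_deriv (refl_rep n) (act_vec \<sigma> v) g"
    using assms linear_on.dir_deriv_comp[OF linear_on_act_vec[OF assms], of v g]
    by (auto simp: act_fun_def fun_eq_iff act_vec_inverse)
  then show "act_op \<sigma> (deriv_op (refl_rep n) v) g = deriv_op (refl_rep n) (act_vec \<sigma> v) g"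
    using \<tau> by (simp add: act_op_def deriv_op_def act_fun_poly_fun_iff act_fun_act_vec_simps)
qed

lemma act_op_add: "act_op \<sigma> (D + E) = act_op \<sigma> D + act_op \<sigma> E"
  by (rule ext) (simp add: act_op_def op_apply act_fun_act_vec_simps)

lemma act_op_scale: "act_op \<sigma> (c *\<^sub>C D) = c *\<^sub>C act_op \<sigma> D"
  by (rule ext) (simp add: act_op_def op_apply act_fun_act_vec_simps)

lemma act_op_diff: "act_op \<sigma> (D - E) = act_op \<sigma> D - act_op \<sigma> E"
proof -
  have "act_op \<sigma> ((D - E) + E) = act_op \<sigma> (D - E) + act_op \<sigma> E" by (rule act_op_add)
  then show ?thesis by simp
qed

lemma act_op_comp: "\<sigma> permutes {..n} \<Longrightarrow> act_op \<sigma> (D \<circ> E) = act_op \<sigma> D \<circ> act_op \<sigma> E"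
  by (simp add: act_op_def fun_eq_iff act_fun_inverse)

lemma act_op_in: "\<sigma> permutes {..n} \<Longrightarrow> D \<in> diff_op (refl_rep n) \<Longrightarrow> act_op \<sigma> D \<in> diff_op (refl_rep n)"
  by (rotate_tac, induction D rule: diff_op_induct)
    (simp_all add: act_op_mult_op act_op_deriv_op act_op_add act_op_comp act_fun_poly_fun act_vec_refl
      diff_op.add diff_op.comp)

global_interpretation op_alg: symmetric_weyl_algebra "diff_op (refl_rep n)" "(\<circ>)" "id_op (refl_rep n)" "gen_op n"
  n "\<lambda>D E. (D \<circ> E) - (E \<circ> D)" act_op "comm_form n" "comm_form n" 1 for n
proof unfold_locales
  fix f g h :: "((nat \<Rightarrow> complex) \<Rightarrow> complex) \<Rightarrow> ((nat \<Rightarrow> complex) \<Rightarrow> complex)"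
  assume f: "f \<in> diff_op (refl_rep n)" and g: "g \<in> diff_op (refl_rep n)"
  show "(f \<circ> g) - (g \<circ> f) \<in> diff_op (refl_rep n)" using f g by (intro op_alg.diff_in op_alg.mul_in)
  assume h: "h \<in> diff_op (refl_rep n)"
  show "(f + g \<circ> h) - (h \<circ> f + g) = ((f \<circ> h) - (h \<circ> f)) + ((g \<circ> h) - (h \<circ> g))"
    "(f \<circ> g + h) - (g + h \<circ> f) = ((f \<circ> g) - (g \<circ> f)) + ((f \<circ> h) - (h \<circ> f))"
    using f g h by (simp_all only: op_alg.add_mul op_alg.mul_add) simp_all
  show "((f \<circ> g) \<circ> h) - (h \<circ> (f \<circ> g)) = (f \<circ> ((g \<circ> h) - (h \<circ> g))) + (((f \<circ> h) - (h \<circ> f)) \<circ> g)"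
    "(f \<circ> (g \<circ> h)) - ((g \<circ> h) \<circ> f) = (((f \<circ> g) - (g \<circ> f)) \<circ> h) + (g \<circ> ((f \<circ> h) - (h \<circ> f)))"
    by (rule op_alg.commutator_leibniz[OF f g h])+
next
  show "gen_op n (x, i) = 0" if "n < i" for i x
    using that by (simp add: gen_op_def coord_outside proj_unit_outside mult_op_zero deriv_op_zero refl_subspace)
  show "(\<Sum>i\<le>n. gen_op n (x, i)) = 0" for x
  proof (cases x)
    case True
    then show ?thesis using mult_op_sum[of "refl_rep n" "coord n" "{..n}"] by (simp add: gen_op_def sum_coord mult_op_zero)
  next
    case False
    have "deriv_op (refl_rep n) (\<Sum>i\<le>n. proj_unit n i) = (\<Sum>i\<le>n. deriv_op (refl_rep n) (proj_unit n i))"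
    proof
      fix g show "deriv_op (refl_rep n) (\<Sum>i\<le>n. proj_unit n i) g = (\<Sum>i\<le>n. deriv_op (refl_rep n) (proj_unit n i)) g"
        by (cases "g \<in> poly_fun (refl_rep n)")
          (simp_all add: sum_fun_apply deriv_op_apply dir_deriv_sum_direction[OF refl_subspace])
    qed
    then show ?thesis using False by (simp add: gen_op_def sum_proj_unit deriv_op_zero refl_subspace)
  qed
  show "(gen_op n s \<circ> gen_op n t) - (gen_op n t \<circ> gen_op n s) = comm_form n s t *\<^sub>C id_op (refl_rep n)" for s t
    by (rule gen_op_comm)
  show "comm_form n (True, i) (True, j) = 0" for i j by (simp add: comm_form_def)
  show "comm_form n (False, i) (True, j) = 1 * (of_bool (i = j) - 1 / of_nat (Suc n))"
    if "i \<le> n" "j \<le> n" for i j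
    using that by (auto simp: comm_form_def proj_unit_def)
  show "(1 :: complex) \<noteq> 0" by simp
  show "diff_op (refl_rep n) \<subseteq> cspan (range (op_alg.ev n))" by (rule diff_op_words)
  fix \<sigma> :: "nat \<Rightarrow> nat" assume \<sigma>: "\<sigma> permutes {..n}"
  have "act_fun act_vec \<sigma> (ind (refl_rep n)) = ind (refl_rep n)"
    unfolding act_fun_def using \<sigma> by (intro linear_on.ind_comp[OF linear_on_act_vec]) simp
  then show "act_op \<sigma> (id_op (refl_rep n)) = id_op (refl_rep n)" by (simp add: act_op_mult_op \<sigma>)
  show "act_op \<sigma> (gen_op n s) = gen_op n (apsnd \<sigma> s)" for s
    by (simp add: gen_op_def act_op_mult_op act_op_deriv_op act_fun_act_vec_coord act_vec_proj_unit \<sigma>)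
  fix f g :: "((nat \<Rightarrow> complex) \<Rightarrow> complex) \<Rightarrow> ((nat \<Rightarrow> complex) \<Rightarrow> complex)" and k :: complex
  show "act_op \<sigma> (k *\<^sub>C f) = k *\<^sub>C act_op \<sigma> f" by (rule act_op_scale)
  show "act_op \<sigma> (f + g) = act_op \<sigma> f + act_op \<sigma> g" by (rule act_op_add)
  show "act_op \<sigma> (f \<circ> g) = act_op \<sigma> f \<circ> act_op \<sigma> g" by (rule act_op_comp[OF \<sigma>])
  show "act_op \<sigma> ((f \<circ> g) - (g \<circ> f)) = (act_op \<sigma> f \<circ> act_op \<sigma> g) - (act_op \<sigma> g \<circ> act_op \<sigma> f)"
    by (simp only: act_op_diff act_op_comp[OF \<sigma>])
  show "act_op \<sigma> f \<in> diff_op (refl_rep n)" if "f \<in> diff_op (refl_rep n)"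
    using \<sigma> that by (rule act_op_in)
qed

lemma inv_diff_op_eq: "inv_diff_op n = op_alg.B n"
  by (auto simp: inv_diff_op_def op_alg.B_def weyl_group_def)

section \<open>The twisted trace and the zeroth Hochschild homology\<close>

lemma suminf_finite_support:
  fixes f :: "nat \<Rightarrow> complex"
  assumes "\<And>k. k \<ge> K \<Longrightarrow> f k = 0"
  shows "suminf f = (\<Sum>k<K. f k)"
  using assms by (intro suminf_finite) auto

section \<open>Symbols at a fixed covector\<close>

abbreviation AD :: "nat \<Rightarrow> ((nat \<Rightarrow> complex) \<Rightarrow> complex) \<Rightarrow> nat \<Rightarrow>
    (((nat \<Rightarrow> complex) \<Rightarrow> complex) \<Rightarrow> (nat \<Rightarrow> complex) \<Rightarrow> complex) \<Rightarrow>
    ((nat \<Rightarrow> complex) \<Rightarrow> complex) \<Rightarrow> (nat \<Rightarrow> complex) \<Rightarrow> complex" where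
  "AD n \<xi> k \<equiv> algebra_with_letters.ad (\<circ>) (mult_op (refl_rep n) \<xi>) ^^ k"

text \<open>
  The next definition is $e^{-\xi} D e^{\xi}$ applied to 1, because
  $e^{-\xi} D e^{\xi} = \sum_k \mathrm{ad}^k(D) / k!$ with $\mathrm{ad}(D) = D \xi - \xi D$.
\<close>

definition symbol_at :: "nat \<Rightarrow> ((nat \<Rightarrow> complex) \<Rightarrow> complex) \<Rightarrow>
    (((nat \<Rightarrow> complex) \<Rightarrow> complex) \<Rightarrow> (nat \<Rightarrow> complex) \<Rightarrow> complex) \<Rightarrow> (nat \<Rightarrow> complex) \<Rightarrow> complex" where
  "symbol_at n \<xi> D x = (\<Sum>k. AD n \<xi> k D (ind (refl_rep n)) x / fact k)"

lemma diff_op_sum: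
  assumes S: "csubspace S" and D: "D \<in> diff_op S" and f: "\<And>i. i \<in> I \<Longrightarrow> f i \<in> poly_fun S"
  shows "D (\<Sum>i\<in>I. f i) = (\<Sum>i\<in>I. D (f i))"
  using f
  by (induction I rule: infinite_finite_induct)
    (simp_all add: diff_op_zero[OF S D] diff_op_add[OF S D] poly_fun_sum)

context
  fixes n :: nat and \<xi> :: "(nat \<Rightarrow> complex) \<Rightarrow> complex"
  assumes \<xi>: "\<xi> \<in> dual (refl_rep n)"
begin

lemma covector_poly: "\<xi> \<in> poly_fun (refl_rep n)"
  using \<xi> by (rule poly_fun.linear)

lemma mult_op_covector_in: "mult_op (refl_rep n) \<xi> \<in> diff_op (refl_rep n)"
  by (rule mult_op_in[OF covector_poly])

lemmas AD_in = op_alg.ad_power_in[OF mult_op_covector_in]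
lemmas AD_add = op_alg.ad_power_add[OF mult_op_covector_in]
lemmas AD_scale = op_alg.ad_power_scale[OF mult_op_covector_in]

lemma AD_apply_in: "D \<in> diff_op (refl_rep n) \<Longrightarrow> AD n \<xi> k D (ind (refl_rep n)) \<in> poly_fun (refl_rep n)"
  by (rule diff_op_preserves[OF refl_subspace AD_in poly_fun_ind])

lemma ad_mult_op:
  assumes "f \<in> poly_fun (refl_rep n)"
  shows "op_alg.ad (mult_op (refl_rep n) \<xi>) (mult_op (refl_rep n) f) = 0 *\<^sub>C id_op (refl_rep n)"
  using assms covector_poly by (simp add: op_alg.ad_def mult_op_mult[symmetric] mult.commute del: comp_apply)

text \<open>The order of the two products in \<open>ad\<close> is chosen to give the plus sign here,
  so that a derivative contributes \<open>\<xi> v\<close> to the symbol.\<close>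

lemma ad_deriv_op:
  assumes "v \<in> refl_rep n"
  shows "op_alg.ad (mult_op (refl_rep n) \<xi>) (deriv_op (refl_rep n) v) = \<xi> v *\<^sub>C id_op (refl_rep n)"
  unfolding op_alg.ad_def by (rule comm_deriv_op_mult_op[OF refl_subspace assms \<xi>])

lemma AD_nilpotent:
  assumes "D \<in> diff_op (refl_rep n)"
  obtains K where "\<And>k. k \<ge> K \<Longrightarrow> AD n \<xi> k D = 0"
proof -
  have "\<exists>c. op_alg.ad (mult_op (refl_rep n) \<xi>) (gen_op n s) = c *\<^sub>C id_op (refl_rep n)" for s
    using ad_mult_op[OF coord_poly, of "snd s"] ad_deriv_op[OF proj_unit_in, of "snd s"]
    by (cases "fst s") (auto simp only: gen_op_def if_True if_False)
  from op_alg.ad_nilpotent[OF mult_op_covector_in this] assms show ?thesis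
    using diff_op_words that by blast
qed

text \<open>Any bound on the order of nilpotency may serve as \<open>K\<close>, so symbols of
  several operators can be expanded over a common range.\<close>

lemma symbol_at_eq:
  assumes "\<And>k. k \<ge> K \<Longrightarrow> AD n \<xi> k D = 0"
  shows "symbol_at n \<xi> D = (\<Sum>k<K. (1 / fact k) *\<^sub>C AD n \<xi> k D (ind (refl_rep n)))"
proof
  fix x
  have "AD n \<xi> k D (ind (refl_rep n)) x / fact k = 0" if "k \<ge> K" for k
    by (simp only: assms[OF that] op_apply zero_fun_apply div_0)
  from suminf_finite_support[OF this]
  have "symbol_at n \<xi> D x = (\<Sum>k<K. AD n \<xi> k D (ind (refl_rep n)) x / fact k)"
    unfolding symbol_at_def by simp
  then show "symbol_at n \<xi> D x = (\<Sum>k<K. (1 / fact k) *\<^sub>C AD n \<xi> k D (ind (refl_rep n))) x"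
    by (simp add: sum_fun_apply scaleC_fun_apply)
qed

lemma symbol_at_in:
  assumes D: "D \<in> diff_op (refl_rep n)"
  shows "symbol_at n \<xi> D \<in> poly_fun (refl_rep n)"
proof -
  obtain K where "\<And>k. k \<ge> K \<Longrightarrow> AD n \<xi> k D = 0" using AD_nilpotent[OF D] by blast
  from symbol_at_eq[OF this] show ?thesis
    by (simp only:) (intro poly_fun_sum poly_fun_scale AD_apply_in D)
qed

lemma symbol_at_add:
  assumes D: "D \<in> diff_op (refl_rep n)" and E: "E \<in> diff_op (refl_rep n)"
  shows "symbol_at n \<xi> (D + E) = symbol_at n \<xi> D + symbol_at n \<xi> E"
proof -
  obtain K where K: "\<And>k. k \<ge> K \<Longrightarrow> AD n \<xi> k D = 0" using AD_nilpotent[OF D] by blast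
  obtain L where L: "\<And>k. k \<ge> L \<Longrightarrow> AD n \<xi> k E = 0" using AD_nilpotent[OF E] by blast
  have D0: "AD n \<xi> k D = 0" and E0: "AD n \<xi> k E = 0" if "k \<ge> max K L" for k
    using K[of k] L[of k] that by simp_all
  have "AD n \<xi> k (D + E) = 0" if "k \<ge> max K L" for k
    by (simp only: AD_add[OF D E] D0[OF that] E0[OF that] add_0_left)
  from symbol_at_eq[OF this] symbol_at_eq[OF D0] symbol_at_eq[OF E0] show ?thesis
    by (simp only: AD_add[OF D E] op_apply scaleC_add_right sum.distrib)
qed

lemma symbol_at_scale:
  assumes D: "D \<in> diff_op (refl_rep n)"
  shows "symbol_at n \<xi> (c *\<^sub>C D) = c *\<^sub>C symbol_at n \<xi> D"
proof -
  obtain K where K: "\<And>k. k \<ge> K \<Longrightarrow> AD n \<xi> k D = 0" using AD_nilpotent[OF D] by blast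
  have "AD n \<xi> k (c *\<^sub>C D) = 0" if "k \<ge> K" for k
    by (simp only: AD_scale[OF D] K[OF that] complex_vector.scale_zero_right)
  from symbol_at_eq[OF this] symbol_at_eq[OF K] show ?thesis
    by (simp only: AD_scale[OF D] op_apply complex_vector.scale_sum_right scaleC_scaleC mult.commute)
qed

lemma symbol_at_id: "symbol_at n \<xi> (id_op (refl_rep n)) = ind (refl_rep n)"
proof -
  have "AD n \<xi> 1 (id_op (refl_rep n)) = 0" using op_alg.ad_e[OF mult_op_covector_in] by simp
  from symbol_at_eq[OF op_alg.ad_power_zero_mono[OF mult_op_covector_in this]] show ?thesis
    by (simp add: mult_op_apply scaleC_one)
qed

text \<open>Conjugation by the exponential of \<open>\<xi>\<close> is multiplicative and turns
  \<open>a\<close> into \<open>a\<close> plus the scalar \<open>c\<close>, since the higher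
  commutators of \<open>a\<close> vanish.\<close>

lemma symbol_at_comp:
  assumes a: "a \<in> diff_op (refl_rep n)" and D: "D \<in> diff_op (refl_rep n)"
    and c: "op_alg.ad (mult_op (refl_rep n) \<xi>) a = c *\<^sub>C id_op (refl_rep n)"
  shows "symbol_at n \<xi> (a \<circ> D) = a (symbol_at n \<xi> D) + c *\<^sub>C symbol_at n \<xi> D"
proof -
  let ?i = "ind (refl_rep n)"
  note power = op_alg.ad_power_mul[OF mult_op_covector_in a D c]
  obtain K where K: "\<And>k. k \<ge> K \<Longrightarrow> AD n \<xi> k D = 0" using AD_nilpotent[OF D] by blast
  have "AD n \<xi> k (a \<circ> D) = 0" if "k \<ge> Suc K" for k
  proof -
    from that obtain j where j: "k = Suc j" "j \<ge> K" by (cases k) auto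
    have z: "AD n \<xi> (Suc j) D = 0" "AD n \<xi> j D = 0" using K[of j] K[of "Suc j"] j(2) by simp_all
    show ?thesis
      by (simp only: j power z complex_vector.scale_zero_right add_0_right op_alg.mul_zero[OF a])
  qed
  from symbol_at_eq[OF this]
  have "symbol_at n \<xi> (a \<circ> D) = AD n \<xi> 0 (a \<circ> D) ?i + (\<Sum>k<K. (1 / fact (Suc k)) *\<^sub>C AD n \<xi> (Suc k) (a \<circ> D) ?i)"
    by (simp only: sum.lessThan_Suc_shift fact_0 div_by_1 scaleC_one)
  also have "(\<Sum>k<K. (1 / fact (Suc k)) *\<^sub>C AD n \<xi> (Suc k) (a \<circ> D) ?i) =
      (\<Sum>k<K. (1 / fact (Suc k)) *\<^sub>C (a (AD n \<xi> (Suc k) D ?i)) + c *\<^sub>C ((1 / fact k) *\<^sub>C AD n \<xi> k D ?i))"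
  proof (intro sum.cong refl)
    fix k
    have "(1 / fact (Suc k)) * (of_nat (Suc k) * c) = c * (1 / fact k)"
      by (simp add: fact_Suc del: of_nat_Suc)
    then show "(1 / fact (Suc k)) *\<^sub>C AD n \<xi> (Suc k) (a \<circ> D) ?i =
      (1 / fact (Suc k)) *\<^sub>C (a (AD n \<xi> (Suc k) D ?i)) + c *\<^sub>C ((1 / fact k) *\<^sub>C AD n \<xi> k D ?i)"
      by (simp only: power op_apply comp_apply scaleC_add_right scaleC_scaleC)
  qed
  also have "\<dots> = (\<Sum>k<K. (1 / fact (Suc k)) *\<^sub>C (a (AD n \<xi> (Suc k) D ?i))) + c *\<^sub>C symbol_at n \<xi> D"
  proof -
    have "symbol_at n \<xi> D = (\<Sum>k<K. (1 / fact k) *\<^sub>C AD n \<xi> k D ?i)" by (rule symbol_at_eq[OF K])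
    then show ?thesis by (simp only: sum.distrib complex_vector.scale_sum_right)
  qed
  also have "AD n \<xi> 0 (a \<circ> D) ?i = (1 / fact 0) *\<^sub>C (a (AD n \<xi> 0 D ?i))" by (simp add: scaleC_one)
  finally have "symbol_at n \<xi> (a \<circ> D) = (\<Sum>k<Suc K. (1 / fact k) *\<^sub>C a (AD n \<xi> k D ?i)) + c *\<^sub>C symbol_at n \<xi> D"
    by (simp only: sum.lessThan_Suc_shift add.assoc)
  also have "(\<Sum>k<Suc K. (1 / fact k) *\<^sub>C a (AD n \<xi> k D ?i)) = a (symbol_at n \<xi> D)"
  proof -
    have "symbol_at n \<xi> D = (\<Sum>k<Suc K. (1 / fact k) *\<^sub>C AD n \<xi> k D ?i)" by (rule symbol_at_eq) (simp add: K)
    then show ?thesis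
      by (simp only: diff_op_sum[OF refl_subspace a] diff_op_scale[OF refl_subspace a] poly_fun_scale AD_apply_in[OF D])
  qed
  finally show ?thesis .
qed

lemma symbol_at_mult_op:
  assumes D: "D \<in> diff_op (refl_rep n)" and f: "f \<in> poly_fun (refl_rep n)"
  shows "symbol_at n \<xi> (mult_op (refl_rep n) f \<circ> D) = f * symbol_at n \<xi> D"
  using symbol_at_comp[OF mult_op_in[OF f] D ad_mult_op[OF f]] symbol_at_in[OF D] by (simp add: mult_op_apply)

lemma symbol_at_deriv_op:
  assumes D: "D \<in> diff_op (refl_rep n)" and v: "v \<in> refl_rep n"
  shows "symbol_at n \<xi> (deriv_op (refl_rep n) v \<circ> D) = dir_deriv (refl_rep n) v (symbol_at n \<xi> D) + \<xi> v *\<^sub>C symbol_at n \<xi> D"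
  using symbol_at_comp[OF deriv_op_in[OF v] D ad_deriv_op[OF v]] symbol_at_in[OF D] by (simp add: deriv_op_apply)

end

text \<open>With the covector varying, this is the full normally ordered symbol: coefficients stand
  to the left of derivatives, and a derivative along \<open>v\<close> becomes the function that
  evaluates the covector at \<open>v\<close>.\<close>

definition symbol :: "nat \<Rightarrow> (((nat \<Rightarrow> complex) \<Rightarrow> complex) \<Rightarrow> (nat \<Rightarrow> complex) \<Rightarrow> complex) \<Rightarrow>
    (nat \<Rightarrow> complex) \<times> ((nat \<Rightarrow> complex) \<Rightarrow> complex) \<Rightarrow> complex" where
  "symbol n D p = (if p \<in> phase_space n then symbol_at n (snd p) D (fst p) else 0)"

lemma symbol_id: "symbol n (id_op (refl_rep n)) = ind (phase_space n)"
proof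
  fix p show "symbol n (id_op (refl_rep n)) p = ind (phase_space n) p"
    by (cases "p \<in> phase_space n") (auto simp: symbol_def symbol_at_id, auto simp: ind_def)
qed

lemma symbol_add: "D \<in> diff_op (refl_rep n) \<Longrightarrow> E \<in> diff_op (refl_rep n) \<Longrightarrow>
    symbol n (D + E) = symbol n D + symbol n E"
  by (auto simp: symbol_def fun_eq_iff symbol_at_add plus_fun_apply)

lemma symbol_scale: "D \<in> diff_op (refl_rep n) \<Longrightarrow> symbol n (c *\<^sub>C D) = c *\<^sub>C symbol n D"
  by (auto simp: symbol_def fun_eq_iff symbol_at_scale scaleC_fun_apply)

section \<open>Multiplication by letters in terms of symbols\<close>

abbreviation pos_op :: "nat \<Rightarrow> nat \<Rightarrow> ((nat \<Rightarrow> complex) \<Rightarrow> complex) \<Rightarrow> (nat \<Rightarrow> complex) \<Rightarrow> complex" where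
  "pos_op n i \<equiv> mult_op (refl_rep n) (coord n i)"

abbreviation mom_op :: "nat \<Rightarrow> nat \<Rightarrow> ((nat \<Rightarrow> complex) \<Rightarrow> complex) \<Rightarrow> (nat \<Rightarrow> complex) \<Rightarrow> complex" where
  "mom_op n i \<equiv> deriv_op (refl_rep n) (proj_unit n i)"

lemma symbol_pos_op: "D \<in> diff_op (refl_rep n) \<Longrightarrow> symbol n (pos_op n i \<circ> D) = pos_fun n i * symbol n D"
proof
  fix p assume D: "D \<in> diff_op (refl_rep n)"
  show "symbol n (pos_op n i \<circ> D) p = (pos_fun n i * symbol n D) p"
    by (cases "p \<in> phase_space n")
      (auto simp: symbol_def symbol_at_mult_op[OF _ D] pos_fun_def times_fun_apply coord_def simp del: comp_apply)
qed

lemma symbol_mom_op: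
  assumes D: "D \<in> diff_op (refl_rep n)"
  shows "symbol n (mom_op n i \<circ> D) = dpos n i (symbol n D) + mom_fun n i * symbol n D"
proof
  fix p
  show "symbol n (mom_op n i \<circ> D) p = (dpos n i (symbol n D) + mom_fun n i * symbol n D) p"
  proof (cases "p \<in> phase_space n")
    case True
    then have p: "fst p \<in> refl_rep n" "snd p \<in> dual (refl_rep n)" by auto
    \<comment> \<open>The covector stays constant along \<open>pos_dir\<close>, so this derivative
      can be taken with the covector fixed.\<close>
    have "dpos n i (symbol n D) p = dir_deriv (refl_rep n) (proj_unit n i) (symbol_at n (snd p) D) (fst p)"
    proof -
      have "symbol n D (p + t *\<^sub>C pos_dir n i) = symbol_at n (snd p) D (fst p + t *\<^sub>C proj_unit n i)" for t
        using line_in_subspace[OF phase_space_subspace True pos_dir_in, of t i] by (simp add: symbol_def pos_dir_def)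
      then show ?thesis using True p by (simp add: dir_deriv_def)
    qed
    then show ?thesis
      using True p symbol_at_deriv_op[OF p(2) D proj_unit_in, of i]
      by (simp add: symbol_def[of n "mom_op n i \<circ> D"] fun_apply mom_fun_def del: comp_apply mem_Times_iff)
         (simp add: symbol_def)
  next
    case False
    then show ?thesis by (auto simp: symbol_def fun_apply dir_deriv_outside mom_fun_def)
  qed
qed

lemma pos_fun_poly [simp]: "pos_fun n i \<in> poly_fun (phase_space n)" and mom_fun_poly [simp]: "mom_fun n i \<in> poly_fun (phase_space n)"
  by (simp_all add: poly_fun.linear)

text \<open>\<open>symbol_at_in\<close> gives polynomials in the position for each single covector
  only. Polynomial dependence on both variables comes from building words letter by letter.\<close>

lemma symbol_in [simp]: "D \<in> diff_op (refl_rep n) \<Longrightarrow> symbol n D \<in> poly_fun (phase_space n)"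
proof (induction D rule: op_alg.A_induct)
  case zero
  show ?case using symbol_scale[of 0 n 0] by simp
next
  case (add x y)
  then show ?case by (simp only: symbol_add poly_fun_add)
next
  case (scale c x)
  then show ?case by (simp only: symbol_scale poly_fun_scale)
next
  case (ev w)
  show ?case
  proof (induction w)
    case Nil
    show ?case by (simp only: op_alg.ev_Nil symbol_id poly_fun_ind)
  next
    case (Cons s w)
    show ?case unfolding op_alg.ev_Cons gen_op_def[of n s]
      by (cases "fst s") (simp_all only: if_True if_False symbol_pos_op[OF op_alg.ev_in] symbol_mom_op[OF op_alg.ev_in]
          Cons.IH poly_fun_add poly_fun_mult pos_fun_poly mom_fun_poly dir_deriv_phase_space_in)
  qed
qed

text \<open>The induction adds letters on the left, where their effect on symbols is known, and
  shows that it commutes with the claimed effect on the right. The one interaction is between Y_j on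
  the left and X_i on the right: \<open>dpos\<close> applied to \<open>pos_fun\<close> and
  \<open>dmom\<close> applied to \<open>mom_fun\<close> give the same entry of
  \<open>proj_unit\<close>.\<close>

lemma symbol_right:
  assumes "D \<in> diff_op (refl_rep n)"
  shows "symbol n (D \<circ> pos_op n i) = pos_fun n i * symbol n D + dmom n i (symbol n D) \<and>
    symbol n (D \<circ> mom_op n i) = mom_fun n i * symbol n D"
  using assms
proof (induction D rule: op_alg.A_induct)
  case zero
  have "symbol n 0 = 0" using symbol_scale[of 0 n 0] by simp
  moreover have "dmom n i 0 = 0" by (rule dir_deriv_zero[OF phase_space_subspace mom_dir_in])
  ultimately show ?case
    by (simp only: op_alg.zero_mul[OF mult_op_in[OF coord_poly]] op_alg.zero_mul[OF deriv_op_in[OF proj_unit_in]]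
        mult_zero_right add_0_right)
next
  case (add D E)
  then show ?case
    by (simp only: op_alg.add_mul mult_op_in deriv_op_in coord_poly proj_unit_in symbol_add op_alg.mul_in phase_space_deriv_simps symbol_in distrib_left)
      simp
next
  case (scale c D)
  then show ?case
    by (simp only: op_alg.scale_mul mult_op_in deriv_op_in coord_poly proj_unit_in symbol_scale op_alg.mul_in phase_space_deriv_simps symbol_in
        scaleC_mult_fun scaleC_add_right)
next
  case (ev w)
  let ?P = "\<lambda>w. symbol n (op_alg.ev n w \<circ> pos_op n i) = pos_fun n i * symbol n (op_alg.ev n w) + dmom n i (symbol n (op_alg.ev n w)) \<and>
    symbol n (op_alg.ev n w \<circ> mom_op n i) = mom_fun n i * symbol n (op_alg.ev n w)"
  show ?case
  proof (rule list.induct[where P = ?P])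
    have "symbol n (pos_op n i) = pos_fun n i" "symbol n (mom_op n i) = mom_fun n i"
      using symbol_pos_op[OF op_alg.e_in, of n i] symbol_mom_op[OF op_alg.e_in, of n i]
      by (simp_all only: op_alg.mul_e mult_op_in deriv_op_in coord_poly proj_unit_in symbol_id phase_space_deriv_simps poly_fun_ind_mult
          pos_fun_poly mom_fun_poly add_0_left)
    then show "?P []"
      by (simp only: op_alg.ev_Nil op_alg.e_mul mult_op_in deriv_op_in coord_poly proj_unit_in symbol_id phase_space_deriv_simps poly_fun_ind_mult
          pos_fun_poly mom_fun_poly add_0_right)
  next
    fix s :: "bool \<times> nat" and w assume IH': "?P w"
    let ?p = "symbol n (op_alg.ev n w)" and ?j = "snd s"
    have IH: "symbol n (op_alg.ev n w \<circ> pos_op n i) = pos_fun n i * ?p + dmom n i ?p"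
      "symbol n (op_alg.ev n w \<circ> mom_op n i) = mom_fun n i * ?p" using IH' by auto
    have m: "op_alg.ev n w \<circ> pos_op n i \<in> diff_op (refl_rep n)" "op_alg.ev n w \<circ> mom_op n i \<in> diff_op (refl_rep n)"
      by (simp_all only: op_alg.mul_in op_alg.ev_in mult_op_in deriv_op_in coord_poly proj_unit_in)
    note d = phase_space_deriv_simps pos_fun_poly mom_fun_poly symbol_in[OF op_alg.ev_in] dir_deriv_phase_space_in poly_fun_mult poly_fun_add
      pos_fun_dual mom_fun_dual pos_fun_pos_dir pos_fun_mom_dir mom_fun_pos_dir mom_fun_mom_dir poly_fun_ind_mult scaleC_mult_fun
    have comm: "dpos n j (dmom n i ?p) = dmom n i (dpos n j ?p)" for j
      by (rule dir_deriv_commute[OF phase_space_subspace pos_dir_in mom_dir_in symbol_in[OF op_alg.ev_in]])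
    show "?P (s # w)"
    proof (cases "fst s")
      case True
      then show ?thesis
        unfolding op_alg.ev_Cons gen_op_def[of n s]
        by (simp only: if_True comp_assoc symbol_pos_op[OF op_alg.ev_in] symbol_pos_op[OF m(1)] symbol_pos_op[OF m(2)] IH d)
          (simp add: algebra_simps)
    next
      case False
      then show ?thesis
        unfolding op_alg.ev_Cons gen_op_def[of n s]
        by (simp only: if_False comp_assoc symbol_mom_op[OF op_alg.ev_in] symbol_mom_op[OF m(1)] symbol_mom_op[OF m(2)] IH d comm)
          (simp add: algebra_simps proj_unit_sym)
    qed
  qed
qed

text \<open>
  The coefficients of $Q$ form a circulant matrix: they depend only on $d = (j - i) \bmod (n + 1)$, with
  value 0 for $d = 0$ and $1 - d/(n+1)$ otherwise. Hence their differences along a row or a column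
  are constant except for one jump, as the twisted trace property requires.
\<close>

definition gauss_coeff :: "nat \<Rightarrow> nat \<Rightarrow> nat \<Rightarrow> complex" where
  "gauss_coeff n i j = of_bool (i < j) + (of_nat i - of_nat j) / of_nat (Suc n)"

definition gauss_op :: "nat \<Rightarrow> ((nat \<Rightarrow> complex) \<times> ((nat \<Rightarrow> complex) \<Rightarrow> complex) \<Rightarrow> complex) \<Rightarrow>
    (nat \<Rightarrow> complex) \<times> ((nat \<Rightarrow> complex) \<Rightarrow> complex) \<Rightarrow> complex" where
  "gauss_op n p = (\<Sum>i\<le>n. \<Sum>j\<le>n. gauss_coeff n i j *\<^sub>C dpos n i (dmom n j p))"

text \<open>The commutator of $Q$ with the multiplication by the linear function \<open>l\<close>.\<close>

definition gauss_shift :: "nat \<Rightarrow> ((nat \<Rightarrow> complex) \<times> ((nat \<Rightarrow> complex) \<Rightarrow> complex) \<Rightarrow> complex) \<Rightarrow>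
    ((nat \<Rightarrow> complex) \<times> ((nat \<Rightarrow> complex) \<Rightarrow> complex) \<Rightarrow> complex) \<Rightarrow>
    (nat \<Rightarrow> complex) \<times> ((nat \<Rightarrow> complex) \<Rightarrow> complex) \<Rightarrow> complex" where
  "gauss_shift n l p = (\<Sum>i\<le>n. \<Sum>j\<le>n. gauss_coeff n i j *\<^sub>C (l (pos_dir n i) *\<^sub>C dmom n j p + l (mom_dir n j) *\<^sub>C dpos n i p))"

section \<open>Calculus of Q and its commutators with linear functions\<close>

lemma gauss_op_in [simp]: "p \<in> poly_fun (phase_space n) \<Longrightarrow> gauss_op n p \<in> poly_fun (phase_space n)"
  unfolding gauss_op_def by (intro poly_fun_sum poly_fun_scale dir_deriv_phase_space_in)

lemma gauss_shift_in [simp]: "p \<in> poly_fun (phase_space n) \<Longrightarrow> gauss_shift n l p \<in> poly_fun (phase_space n)"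
  unfolding gauss_shift_def by (intro poly_fun_sum poly_fun_scale poly_fun_add dir_deriv_phase_space_in)

lemma gauss_op_add: "p \<in> poly_fun (phase_space n) \<Longrightarrow> q \<in> poly_fun (phase_space n) \<Longrightarrow> gauss_op n (p + q) = gauss_op n p + gauss_op n q"
  by (simp add: gauss_op_def phase_space_deriv_simps scaleC_add_right sum.distrib)

lemma gauss_op_scale: "p \<in> poly_fun (phase_space n) \<Longrightarrow> gauss_op n (c *\<^sub>C p) = c *\<^sub>C gauss_op n p"
  by (simp add: gauss_op_def phase_space_deriv_simps complex_vector.scale_sum_right scaleC_scaleC mult.commute)

lemma gauss_op_zero: "gauss_op n 0 = 0"
  using gauss_op_scale[OF poly_fun_zero, of n 0] by simp

lemma gauss_shift_zero: "gauss_shift n l 0 = 0"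
  by (simp add: gauss_shift_def dir_deriv_zero[OF phase_space_subspace] del: mem_Times_iff)

lemma gauss_op_ind: "gauss_op n (ind (phase_space n)) = 0"
  by (simp add: gauss_op_def phase_space_deriv_simps dir_deriv_zero[OF phase_space_subspace] del: mem_Times_iff)

lemma gauss_op_mult:
  assumes l: "l \<in> dual (phase_space n)" and p: "p \<in> poly_fun (phase_space n)"
  shows "gauss_op n (l * p) = l * gauss_op n p + gauss_shift n l p"
proof -
  have l': "l \<in> poly_fun (phase_space n)" using l by (rule poly_fun.linear)
  have "dpos n i (dmom n j (l * p)) = l * dpos n i (dmom n j p) + (l (pos_dir n i) *\<^sub>C dmom n j p + l (mom_dir n j) *\<^sub>C dpos n i p)" for i j
    using l l' p by (simp add: phase_space_deriv_simps scaleC_mult_fun)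
  then show ?thesis
    by (simp only: gauss_op_def gauss_shift_def scaleC_add_right[of _ "l * _"] sum.distrib sum_distrib_left scaleC_mult_fun)
qed

lemma dpos_dmom_commute:
  assumes "p \<in> poly_fun (phase_space n)"
  shows "dpos n i (dpos n j p) = dpos n j (dpos n i p)" "dmom n i (dmom n j p) = dmom n j (dmom n i p)"
    "dpos n i (dmom n j p) = dmom n j (dpos n i p)"
  using assms
  by (auto intro!: dir_deriv_commute[OF phase_space_subspace] simp del: mem_Times_iff)

lemma dpos_gauss_op:
  assumes p: "p \<in> poly_fun (phase_space n)"
  shows "dpos n k (gauss_op n p) = gauss_op n (dpos n k p)" "dmom n k (gauss_op n p) = gauss_op n (dmom n k p)"
proof -
  have d: "dir_deriv (phase_space n) v (gauss_op n p) = (\<Sum>i\<le>n. \<Sum>j\<le>n. gauss_coeff n i j *\<^sub>C dir_deriv (phase_space n) v (dpos n i (dmom n j p)))"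
    if "v \<in> phase_space n" for v
    unfolding gauss_op_def using p
    by (simp only: dir_deriv_sum[OF phase_space_subspace that] dir_deriv_scale[OF phase_space_subspace that] poly_fun_sum
        poly_fun_scale dir_deriv_phase_space_in)
  show "dpos n k (gauss_op n p) = gauss_op n (dpos n k p)"
    unfolding d[OF pos_dir_in] unfolding gauss_op_def using p
    by (simp only: dpos_dmom_commute(1)[OF dir_deriv_phase_space_in(2), of p n k] dpos_dmom_commute(3)[of p n k])
  show "dmom n k (gauss_op n p) = gauss_op n (dmom n k p)"
    unfolding d[OF mom_dir_in] unfolding gauss_op_def using p
    by (simp only: dpos_dmom_commute(3)[symmetric] dir_deriv_phase_space_in dpos_dmom_commute(2)[of p n k])
qed

lemma gauss_op_sum: "(\<And>i. i \<in> I \<Longrightarrow> f i \<in> poly_fun (phase_space n)) \<Longrightarrow> gauss_op n (\<Sum>i\<in>I. f i) = (\<Sum>i\<in>I. gauss_op n (f i))"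
  by (induction I rule: infinite_finite_induct) (simp_all add: gauss_op_zero gauss_op_add poly_fun_sum)

text \<open>Both operators have constant coefficients. Hence the iterated commutators of Q with a
  linear function stop after the first.\<close>

lemma gauss_op_gauss_shift:
  assumes p: "p \<in> poly_fun (phase_space n)"
  shows "gauss_op n (gauss_shift n l p) = gauss_shift n l (gauss_op n p)"
  unfolding gauss_shift_def using p
  by (simp only: gauss_op_sum gauss_op_scale gauss_op_add dpos_gauss_op poly_fun_sum poly_fun_scale poly_fun_add dir_deriv_phase_space_in)

lemma gauss_op_power_in [simp]: "p \<in> poly_fun (phase_space n) \<Longrightarrow> (gauss_op n ^^ m) p \<in> poly_fun (phase_space n)"
  by (induct m) simp_all

lemma gauss_op_power_linear:
  assumes p: "p \<in> poly_fun (phase_space n)" and q: "q \<in> poly_fun (phase_space n)"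
  shows "(gauss_op n ^^ m) (p + q) = (gauss_op n ^^ m) p + (gauss_op n ^^ m) q" "(gauss_op n ^^ m) (c *\<^sub>C p) = c *\<^sub>C (gauss_op n ^^ m) p"
proof -
  show "(gauss_op n ^^ m) (p + q) = (gauss_op n ^^ m) p + (gauss_op n ^^ m) q"
  proof (induction m)
    case (Suc m)
    then show ?case using gauss_op_add[OF gauss_op_power_in[OF p, of m] gauss_op_power_in[OF q, of m]] by simp
  qed simp
  show "(gauss_op n ^^ m) (c *\<^sub>C p) = c *\<^sub>C (gauss_op n ^^ m) p"
  proof (induction m)
    case (Suc m)
    then show ?case using gauss_op_scale[OF gauss_op_power_in[OF p, of m]] by simp
  qed simp
qed

lemma gauss_op_power_zero_mono: "(gauss_op n ^^ k) p = 0 \<Longrightarrow> k \<le> m \<Longrightarrow> (gauss_op n ^^ m) p = 0"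
proof -
  assume *: "(gauss_op n ^^ k) p = 0" "k \<le> m"
  from *(2) show ?thesis
  proof (induction m rule: dec_induct)
    case base
    show ?case by (rule *(1))
  next
    case (step j)
    then show ?case by (simp add: gauss_op_zero)
  qed
qed

lemma gauss_op_power_gauss_shift:
  assumes p: "p \<in> poly_fun (phase_space n)"
  shows "(gauss_op n ^^ m) (gauss_shift n l p) = gauss_shift n l ((gauss_op n ^^ m) p)"
proof (induction m)
  case (Suc m)
  then show ?case using gauss_op_gauss_shift[OF gauss_op_power_in[OF p, of m], of l] by simp
qed simp

lemma gauss_op_power_mult:
  assumes l: "l \<in> dual (phase_space n)" and p: "p \<in> poly_fun (phase_space n)"
  shows "(gauss_op n ^^ Suc m) (l * p) = l * (gauss_op n ^^ Suc m) p + of_nat (Suc m) *\<^sub>C (gauss_op n ^^ m) (gauss_shift n l p)"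
proof (induction m)
  case 0
  show ?case using gauss_op_mult[OF l p] by (simp add: scaleC_one)
next
  case (Suc m)
  have l': "l \<in> poly_fun (phase_space n)" using l by (rule poly_fun.linear)
  have "(gauss_op n ^^ Suc (Suc m)) (l * p) = gauss_op n ((gauss_op n ^^ Suc m) (l * p))" by simp
  also have "\<dots> = gauss_op n (l * (gauss_op n ^^ Suc m) p) + of_nat (Suc m) *\<^sub>C (gauss_op n ^^ Suc m) (gauss_shift n l p)"
    unfolding Suc.IH using l' p by (subst gauss_op_add) (simp_all add: gauss_op_scale)
  also have "gauss_op n (l * (gauss_op n ^^ Suc m) p) = l * (gauss_op n ^^ Suc (Suc m)) p + (gauss_op n ^^ Suc m) (gauss_shift n l p)"
    using gauss_op_mult[OF l gauss_op_power_in[OF p, of "Suc m"]] gauss_op_power_gauss_shift[OF p, of "Suc m" l] by simp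
  finally show ?case
    by (simp only: of_nat_Suc[of "Suc m"] scaleC_add_left scaleC_one add.assoc)
qed

text \<open>Induction over words takes the place of a degree: by \<open>gauss_op_power_mult\<close>
  a further letter raises the order of nilpotency by at most one.\<close>

lemma gauss_op_nilpotent:
  assumes "p \<in> poly_fun (phase_space n)"
  obtains K where "\<And>m. m \<ge> K \<Longrightarrow> (gauss_op n ^^ m) p = 0"
proof -
  have "\<exists>K. \<forall>m\<ge>K. (gauss_op n ^^ m) p = 0"
    using assms
  proof (induction p rule: fun_alg.A_induct)
    case zero
    have "(gauss_op n ^^ m) 0 = 0" for m by (rule gauss_op_power_zero_mono[of 0]) simp_all
    then show ?case by blast
  next
    case (add x y)
    then obtain K L where "\<forall>k\<ge>K. (gauss_op n ^^ k) x = 0" "\<forall>k\<ge>L. (gauss_op n ^^ k) y = 0" by blast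
    then show ?case
      by (intro exI[of _ "max K L"]) (simp add: gauss_op_power_linear(1)[OF add.hyps(1,2)])
  next
    case (scale c x)
    then obtain K where "\<forall>k\<ge>K. (gauss_op n ^^ k) x = 0" by blast
    then show ?case
      by (intro exI[of _ K]) (simp add: gauss_op_power_linear(2)[OF scale.hyps(1) poly_fun_zero])
  next
    case (ev w)
    have "\<exists>K. (gauss_op n ^^ K) (fun_alg.ev n w) = 0"
    proof (induction w)
      case Nil
      show ?case by (intro exI[of _ 1]) (simp add: gauss_op_ind)
    next
      case (Cons s w)
      then obtain K where K: "(gauss_op n ^^ K) (fun_alg.ev n w) = 0" by blast
      then have "(gauss_op n ^^ Suc K) (fun_alg.ev n w) = 0" by (simp add: gauss_op_zero)
      then have "(gauss_op n ^^ Suc K) (fun_alg.ev n (s # w)) = 0"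
        unfolding fun_alg.ev_Cons gauss_op_power_mult[OF gen_fun_dual fun_alg.ev_in] gauss_op_power_gauss_shift[OF fun_alg.ev_in]
        by (simp only: K gauss_shift_zero mult_zero_right complex_vector.scale_zero_right add_0_left)
      then show ?case by blast
    qed
    then show ?case using gauss_op_power_zero_mono by blast
  qed
  with that show ?thesis by blast
qed

text \<open>The value of e^Q p at the origin, that is, a formal Gaussian expectation of p whose
  covariances are given by Q.\<close>

definition gauss_value :: "nat \<Rightarrow> ((nat \<Rightarrow> complex) \<times> ((nat \<Rightarrow> complex) \<Rightarrow> complex) \<Rightarrow> complex) \<Rightarrow> complex" where
  "gauss_value n p = (\<Sum>m. (gauss_op n ^^ m) p 0 / fact m)"

lemma gauss_value_eq:
  assumes "\<And>m. m \<ge> K \<Longrightarrow> (gauss_op n ^^ m) p = 0"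
  shows "gauss_value n p = (\<Sum>m<K. (gauss_op n ^^ m) p 0 / fact m)"
  unfolding gauss_value_def by (rule suminf_finite_support) (simp add: assms zero_fun_apply)

lemma gauss_value_add:
  assumes p: "p \<in> poly_fun (phase_space n)" and q: "q \<in> poly_fun (phase_space n)"
  shows "gauss_value n (p + q) = gauss_value n p + gauss_value n q"
proof -
  obtain K where K: "\<And>k. k \<ge> K \<Longrightarrow> (gauss_op n ^^ k) p = 0" using gauss_op_nilpotent[OF p] by blast
  obtain L where L: "\<And>k. k \<ge> L \<Longrightarrow> (gauss_op n ^^ k) q = 0" using gauss_op_nilpotent[OF q] by blast
  have p0: "(gauss_op n ^^ k) p = 0" and q0: "(gauss_op n ^^ k) q = 0" if "k \<ge> max K L" for k
    using K[of k] L[of k] that by simp_all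
  have "(gauss_op n ^^ k) (p + q) = 0" if "k \<ge> max K L" for k
    by (simp only: gauss_op_power_linear(1)[OF p q] p0[OF that] q0[OF that] add_0_left)
  then have "gauss_value n (p + q) = (\<Sum>m<max K L. (gauss_op n ^^ m) (p + q) 0 / fact m)" by (rule gauss_value_eq)
  moreover have "gauss_value n p = (\<Sum>m<max K L. (gauss_op n ^^ m) p 0 / fact m)" by (rule gauss_value_eq[OF p0])
  moreover have "gauss_value n q = (\<Sum>m<max K L. (gauss_op n ^^ m) q 0 / fact m)" by (rule gauss_value_eq[OF q0])
  ultimately show ?thesis
    by (simp add: gauss_op_power_linear(1)[OF p q] plus_fun_apply add_divide_distrib sum.distrib)
qed

lemma gauss_value_scale:
  assumes p: "p \<in> poly_fun (phase_space n)"
  shows "gauss_value n (c *\<^sub>C p) = c * gauss_value n p"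
proof -
  obtain K where K: "\<And>k. k \<ge> K \<Longrightarrow> (gauss_op n ^^ k) p = 0" using gauss_op_nilpotent[OF p] by blast
  have "(gauss_op n ^^ k) (c *\<^sub>C p) = 0" if "k \<ge> K" for k
    by (simp only: gauss_op_power_linear(2)[OF p p] K[OF that] complex_vector.scale_zero_right)
  from gauss_value_eq[OF this] gauss_value_eq[OF K] show ?thesis
    by (simp add: gauss_op_power_linear(2)[OF p p] scaleC_fun_apply sum_distrib_left)
qed

lemma gauss_value_ind: "gauss_value n (ind (phase_space n)) = 1"
proof -
  have "(gauss_op n ^^ 1) (ind (phase_space n)) = 0" by (simp add: gauss_op_ind)
  from gauss_value_eq[OF gauss_op_power_zero_mono[OF this]] show ?thesis
    by (simp add: ind_def zero_prod_def)
qed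

text \<open>This is Wick's integration by parts: e^Q (l p) = (l + [Q, l]) e^Q p, and the first
  summand vanishes at the origin.\<close>

lemma gauss_value_mult:
  assumes l: "l \<in> dual (phase_space n)" and p: "p \<in> poly_fun (phase_space n)"
  shows "gauss_value n (l * p) = gauss_value n (gauss_shift n l p)"
proof -
  obtain K where K: "\<And>k. k \<ge> K \<Longrightarrow> (gauss_op n ^^ k) p = 0" using gauss_op_nilpotent[OF p] by blast
  have l0: "l 0 = 0" by (rule dual_zero[OF phase_space_subspace l])
  have X: "(gauss_op n ^^ k) (gauss_shift n l p) = 0" if "k \<ge> K" for k
    by (simp only: gauss_op_power_gauss_shift[OF p] K[OF that] gauss_shift_zero)
  have "(gauss_op n ^^ k) (l * p) = 0" if "k \<ge> Suc K" for k
  proof -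
    from that obtain j where j: "k = Suc j" "j \<ge> K" by (cases k) auto
    have "(gauss_op n ^^ Suc j) p = 0" using K[of "Suc j"] j(2) by simp
    then show ?thesis
      by (simp only: j(1) gauss_op_power_mult[OF l p] X[OF j(2)] complex_vector.scale_zero_right mult_zero_right add_0_left)
  qed
  \<comment> \<open>The term of index 0 is the value of \<open>l * p\<close> at the origin and drops
    out; the shift of the others turns \<open>fact (Suc m)\<close> into \<open>fact m\<close>
    against the factor in \<open>gauss_op_power_mult\<close>.\<close>
  from gauss_value_eq[OF this] have "gauss_value n (l * p) = (\<Sum>m<K. (gauss_op n ^^ Suc m) (l * p) 0 / fact (Suc m))"
    by (simp only: sum.lessThan_Suc_shift funpow_0 times_fun_apply l0 mult_zero_left div_0 add_0_left)
  also have "\<dots> = (\<Sum>m<K. (gauss_op n ^^ m) (gauss_shift n l p) 0 / fact m)"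
    by (intro sum.cong) (simp_all only: gauss_op_power_mult[OF l p], simp add: fun_apply l0 fact_Suc del: of_nat_Suc funpow.simps)
  also have "\<dots> = gauss_value n (gauss_shift n l p)" by (rule gauss_value_eq[OF X, symmetric])
  finally show ?thesis .
qed

section \<open>The cyclic permutation and the coefficients of Q\<close>

definition next_index :: "nat \<Rightarrow> nat \<Rightarrow> nat" where
  "next_index n i = (if i < n then Suc i else if i = n then 0 else i)"

lemma next_index_permutes: "next_index n permutes {..n}"
proof (rule bij_imp_permutes)
  have "next_index n ` {..n} = {..n}"
  proof (intro equalityI subsetI)
    fix j assume "j \<in> {..n}"
    then show "j \<in> next_index n ` {..n}"
      by (intro image_eqI[of _ _ "if j = 0 then n else j - 1"]) (auto simp: next_index_def)
  qed (auto simp: next_index_def)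
  then show "bij_betw (next_index n) {..n} {..n}"
    by (simp add: bij_betw_def eq_card_imp_inj_on)
qed (auto simp: next_index_def)

text \<open>At the wrap-around \<open>k = n\<close> the linear part changes by n/(n+1) instead of
  -1/(n+1); the indicator \<open>i < j\<close> compensates for the difference of 1 except at
  \<open>j = 0\<close>.\<close>

lemma gauss_coeff_next_index_left: "k \<le> n \<Longrightarrow> j \<le> n \<Longrightarrow> gauss_coeff n k j - gauss_coeff n (next_index n k) j = of_bool (j = next_index n k) - 1 / of_nat (Suc n)"
  by (auto simp: gauss_coeff_def next_index_def divide_simps simp del: of_nat_Suc) (auto simp: algebra_simps)

lemma gauss_coeff_next_index_right: "k \<le> n \<Longrightarrow> i \<le> n \<Longrightarrow> gauss_coeff n i k - gauss_coeff n i (next_index n k) = 1 / of_nat (Suc n) - of_bool (i = k)"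
  by (auto simp: gauss_coeff_def next_index_def divide_simps simp del: of_nat_Suc) (auto simp: algebra_simps)

text \<open>Because of these relations a constant added to a row or column of
  \<open>gauss_coeff\<close> leaves Q unchanged, so only the jumps of the coefficients
  matter.\<close>

lemma sum_dpos: "p \<in> poly_fun (phase_space n) \<Longrightarrow> (\<Sum>j\<le>n. dpos n j p) = 0"
  and sum_dmom: "p \<in> poly_fun (phase_space n) \<Longrightarrow> (\<Sum>j\<le>n. dmom n j p) = 0"
proof -
  assume p: "p \<in> poly_fun (phase_space n)"
  have z: "dir_deriv (phase_space n) 0 p = 0"
    by (auto simp: dir_deriv_def fun_eq_iff zero_fun_apply)
  have "(\<Sum>j\<le>n. pos_dir n j) = 0" "(\<Sum>j\<le>n. mom_dir n j) = 0"
    by (simp_all add: prod_eq_iff fst_sum snd_sum pos_dir_def mom_dir_def sum_proj_unit sum_coord)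
  then show "(\<Sum>j\<le>n. dpos n j p) = 0" "(\<Sum>j\<le>n. dmom n j p) = 0"
    using dir_deriv_sum_direction[OF phase_space_subspace, of "{..n}" "pos_dir n" n p]
      dir_deriv_sum_direction[OF phase_space_subspace, of "{..n}" "mom_dir n" n p] z p
    by (simp_all del: mem_Times_iff)
qed

lemma proj_unit_sum_right:
  assumes "k \<le> n"
  shows "(\<Sum>i\<le>n. f i * proj_unit n i k) = f k - (\<Sum>i\<le>n. f i) / of_nat (Suc n)"
proof -
  have "(\<Sum>i\<le>n. f i * proj_unit n i k) = (\<Sum>i\<le>n. f i * of_bool (k = i) - f i / of_nat (Suc n))"
    using assms by (intro sum.cong) (auto simp: proj_unit_def algebra_simps)
  also have "\<dots> = f k - (\<Sum>i\<le>n. f i / of_nat (Suc n))"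
    unfolding sum_subtractf of_bool_mult_sum using assms by simp
  finally show ?thesis by (simp only: sum_divide_distrib)
qed

lemma sum_of_bool_scale:
  fixes g :: "nat \<Rightarrow> 'a \<Rightarrow> complex"
  assumes "k \<le> n" "(\<Sum>j\<le>n. g j) = 0"
  shows "(\<Sum>j\<le>n. (of_bool (j = k) - c) *\<^sub>C g j) = g k"
proof
  fix x
  have "(\<Sum>j\<le>n. g j x) = 0" using fun_cong[OF assms(2), of x] by (simp add: sum_fun_apply zero_fun_apply)
  then have "c * (\<Sum>j\<le>n. g j x) = 0" by simp
  moreover have "(\<Sum>j\<le>n. (of_bool (j = k) - c) * g j x) = (\<Sum>j\<le>n. of_bool (k = j) * g j x) - c * (\<Sum>j\<le>n. g j x)"
    by (simp add: left_diff_distrib sum_subtractf sum_distrib_left eq_commute[of k])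
  ultimately show "(\<Sum>j\<le>n. (of_bool (j = k) - c) *\<^sub>C g j) x = g k x"
    using assms(1) by (simp add: of_bool_mult_sum sum_fun_apply scaleC_fun_apply)
qed

text \<open>The average comes from the entries -1/N of \<open>proj_unit\<close>. It does not depend
  on \<open>k\<close> and cancels when two values of \<open>k\<close> are compared.\<close>

lemma gauss_shift_pos_fun:
  assumes "k \<le> n"
  shows "gauss_shift n (pos_fun n k) p = (\<Sum>j\<le>n. (gauss_coeff n k j - (\<Sum>i\<le>n. gauss_coeff n i j) / of_nat (Suc n)) *\<^sub>C dmom n j p)"
proof -
  have "gauss_shift n (pos_fun n k) p = (\<Sum>j\<le>n. (\<Sum>i\<le>n. gauss_coeff n i j * proj_unit n i k) *\<^sub>C dmom n j p)"
    unfolding gauss_shift_def by (subst sum.swap) (simp add: pos_fun_pos_dir pos_fun_mom_dir scaleC_scaleC complex_vector.scale_sum_left)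
  then show ?thesis by (simp only: proj_unit_sum_right[OF assms])
qed

lemma gauss_shift_mom_fun:
  assumes "k \<le> n"
  shows "gauss_shift n (mom_fun n k) p = (\<Sum>i\<le>n. (gauss_coeff n i k - (\<Sum>j\<le>n. gauss_coeff n i j) / of_nat (Suc n)) *\<^sub>C dpos n i p)"
proof -
  have "gauss_shift n (mom_fun n k) p = (\<Sum>i\<le>n. (\<Sum>j\<le>n. gauss_coeff n i j * proj_unit n j k) *\<^sub>C dpos n i p)"
    unfolding gauss_shift_def by (simp add: mom_fun_pos_dir mom_fun_mom_dir scaleC_scaleC complex_vector.scale_sum_left)
  then show ?thesis by (simp only: proj_unit_sum_right[OF assms])
qed

text \<open>This is the linear equation on Q that the letters X impose: the extra
  \<open>dmom\<close> is the one that \<open>symbol_right\<close> produces for right multiplication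
  by the next letter.\<close>

lemma gauss_shift_next_index_X:
  assumes k: "k \<le> n" and p: "p \<in> poly_fun (phase_space n)"
  shows "gauss_shift n (pos_fun n k) p = gauss_shift n (pos_fun n (next_index n k)) p + dmom n (next_index n k) p"
proof -
  have ck: "next_index n k \<le> n" using k by (simp add: next_index_def)
  have "gauss_shift n (pos_fun n k) p - gauss_shift n (pos_fun n (next_index n k)) p =
      (\<Sum>j\<le>n. (of_bool (j = next_index n k) - 1 / of_nat (Suc n)) *\<^sub>C dmom n j p)"
    unfolding gauss_shift_pos_fun[OF k] gauss_shift_pos_fun[OF ck] sum_subtractf[symmetric] complex_vector.scale_left_diff_distrib[symmetric]
  proof (intro sum.cong refl)
    fix j assume "j \<in> {..n}"
    then have "gauss_coeff n k j - gauss_coeff n (next_index n k) j = of_bool (j = next_index n k) - 1 / of_nat (Suc n)"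
      using gauss_coeff_next_index_left[OF k, of j] by simp
    then show "(gauss_coeff n k j - (\<Sum>i\<le>n. gauss_coeff n i j) / of_nat (Suc n) -
        (gauss_coeff n (next_index n k) j - (\<Sum>i\<le>n. gauss_coeff n i j) / of_nat (Suc n))) *\<^sub>C dmom n j p =
      (of_bool (j = next_index n k) - 1 / of_nat (Suc n)) *\<^sub>C dmom n j p" by simp
  qed
  also have "\<dots> = dmom n (next_index n k) p" by (rule sum_of_bool_scale[OF ck sum_dmom[OF p]])
  finally show ?thesis by (simp add: algebra_simps)
qed

text \<open>The equation that the letters Y impose. Here the extra \<open>dpos\<close> belongs to
  the left multiplication, by \<open>symbol_mom_op\<close>.\<close>

lemma gauss_shift_next_index_Y:
  assumes k: "k \<le> n" and p: "p \<in> poly_fun (phase_space n)"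
  shows "gauss_shift n (mom_fun n (next_index n k)) p = gauss_shift n (mom_fun n k) p + dpos n k p"
proof -
  have ck: "next_index n k \<le> n" using k by (simp add: next_index_def)
  have "gauss_shift n (mom_fun n (next_index n k)) p - gauss_shift n (mom_fun n k) p =
      (\<Sum>i\<le>n. (of_bool (i = k) - 1 / of_nat (Suc n)) *\<^sub>C dpos n i p)"
    unfolding gauss_shift_mom_fun[OF k] gauss_shift_mom_fun[OF ck] sum_subtractf[symmetric] complex_vector.scale_left_diff_distrib[symmetric]
  proof (intro sum.cong refl)
    fix i assume "i \<in> {..n}"
    then have "gauss_coeff n i (next_index n k) - gauss_coeff n i k = of_bool (i = k) - 1 / of_nat (Suc n)"
      using gauss_coeff_next_index_right[OF k, of i] by (simp add: algebra_simps)
    then show "(gauss_coeff n i (next_index n k) - (\<Sum>j\<le>n. gauss_coeff n i j) / of_nat (Suc n) -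
        (gauss_coeff n i k - (\<Sum>j\<le>n. gauss_coeff n i j) / of_nat (Suc n))) *\<^sub>C dpos n i p =
      (of_bool (i = k) - 1 / of_nat (Suc n)) *\<^sub>C dpos n i p" by simp
  qed
  also have "\<dots> = dpos n k p" by (rule sum_of_bool_scale[OF k sum_dpos[OF p]])
  finally show ?thesis by (simp add: algebra_simps)
qed

section \<open>The twisted trace on differential operators\<close>

definition twisted_tr :: "nat \<Rightarrow> (((nat \<Rightarrow> complex) \<Rightarrow> complex) \<Rightarrow> (nat \<Rightarrow> complex) \<Rightarrow> complex) \<Rightarrow> complex" where
  "twisted_tr n D = gauss_value n (symbol n D)"

lemma twisted_tr_add: "D \<in> diff_op (refl_rep n) \<Longrightarrow> E \<in> diff_op (refl_rep n) \<Longrightarrow> twisted_tr n (D + E) = twisted_tr n D + twisted_tr n E"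
  by (simp add: twisted_tr_def symbol_add gauss_value_add)

lemma twisted_tr_scale: "D \<in> diff_op (refl_rep n) \<Longrightarrow> twisted_tr n (c *\<^sub>C D) = c * twisted_tr n D"
  by (simp add: twisted_tr_def symbol_scale gauss_value_scale)

lemma twisted_tr_id: "twisted_tr n (id_op (refl_rep n)) = 1"
  by (simp only: twisted_tr_def symbol_id gauss_value_ind)

text \<open>\<open>gauss_value_mult\<close> exchanges a linear factor for a
  \<open>gauss_shift\<close>, where the index can be advanced along the cycle, and then exchanges it
  back.\<close>

lemma twisted_tr_gen:
  assumes D: "D \<in> diff_op (refl_rep n)"
  shows "twisted_tr n (gen_op n s \<circ> D) = twisted_tr n (D \<circ> gen_op n (apsnd (next_index n) s))"
proof (cases "snd s \<le> n")
  case False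
  then have "gen_op n s = 0" "gen_op n (apsnd (next_index n) s) = 0"
    using op_alg.gen_zero[of n "snd s" "fst s"] by (cases s; simp add: next_index_def)+
  then show ?thesis by (simp only: op_alg.zero_mul[OF D] op_alg.mul_zero[OF D])
next
  case True
  let ?k = "snd s" and ?p = "symbol n D"
  note p = symbol_in[OF D]
  note in_simps = poly_fun_mult poly_fun_add pos_fun_poly mom_fun_poly dir_deriv_phase_space_in p gauss_shift_in
  show ?thesis
  proof (cases "fst s")
    case X: True
    have "twisted_tr n (gen_op n s \<circ> D) = gauss_value n (pos_fun n ?k * ?p)"
      using X by (simp only: twisted_tr_def gen_op_def if_True symbol_pos_op[OF D])
    also have "\<dots> = gauss_value n (gauss_shift n (pos_fun n ?k) ?p)" by (rule gauss_value_mult[OF pos_fun_dual p])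
    also have "\<dots> = gauss_value n (gauss_shift n (pos_fun n (next_index n ?k)) ?p) + gauss_value n (dmom n (next_index n ?k) ?p)"
      unfolding gauss_shift_next_index_X[OF True p] by (rule gauss_value_add) (simp_all only: in_simps)
    also have "gauss_value n (gauss_shift n (pos_fun n (next_index n ?k)) ?p) = gauss_value n (pos_fun n (next_index n ?k) * ?p)"
      by (rule gauss_value_mult[OF pos_fun_dual p, symmetric])
    also have "\<dots> + gauss_value n (dmom n (next_index n ?k) ?p) = gauss_value n (pos_fun n (next_index n ?k) * ?p + dmom n (next_index n ?k) ?p)"
      by (rule gauss_value_add[symmetric]) (simp_all only: in_simps)
    also have "\<dots> = twisted_tr n (D \<circ> gen_op n (apsnd (next_index n) s))"
      using X symbol_right[OF D, of "next_index n ?k"] by (simp only: twisted_tr_def gen_op_def if_True fst_apsnd snd_apsnd)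
    finally show ?thesis .
  next
    case Y: False
    have "twisted_tr n (gen_op n s \<circ> D) = gauss_value n (dpos n ?k ?p + mom_fun n ?k * ?p)"
      using Y by (simp only: twisted_tr_def gen_op_def if_False symbol_mom_op[OF D])
    also have "\<dots> = gauss_value n (dpos n ?k ?p) + gauss_value n (mom_fun n ?k * ?p)"
      by (rule gauss_value_add) (simp_all only: in_simps)
    also have "gauss_value n (mom_fun n ?k * ?p) = gauss_value n (gauss_shift n (mom_fun n ?k) ?p)" by (rule gauss_value_mult[OF mom_fun_dual p])
    also have "gauss_value n (dpos n ?k ?p) + \<dots> = gauss_value n (gauss_shift n (mom_fun n (next_index n ?k)) ?p)"
      unfolding gauss_shift_next_index_Y[OF True p] by (subst add.commute, rule gauss_value_add[symmetric]) (simp_all only: in_simps)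
    also have "\<dots> = gauss_value n (mom_fun n (next_index n ?k) * ?p)" by (rule gauss_value_mult[OF mom_fun_dual p, symmetric])
    also have "\<dots> = twisted_tr n (D \<circ> gen_op n (apsnd (next_index n) s))"
      using Y symbol_right[OF D, of "next_index n ?k"] by (simp only: twisted_tr_def gen_op_def if_False fst_apsnd snd_apsnd)
    finally show ?thesis .
  qed
qed

lemma twisted_tr_twisted:
  assumes "D \<in> diff_op (refl_rep n)" "E \<in> diff_op (refl_rep n)"
  shows "twisted_tr n (D \<circ> E) = twisted_tr n (E \<circ> act_op (next_index n) D)"
  by (rule op_alg.twisted_trace[OF next_index_permutes twisted_tr_add twisted_tr_scale twisted_tr_gen assms])

theorem HH0_line: "complex_line \<cong>\<^sub>C HH0 (inv_diff_op n) (\<circ>)"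
proof -
  let ?S = "{(D \<circ> E) - (E \<circ> D) | D E. D \<in> inv_diff_op n \<and> E \<in> inv_diff_op n}"
  let ?K = "{D \<in> diff_op (refl_rep n). twisted_tr n D = 0}"
  let ?e = "id_op (refl_rep n)"
  have "(D \<circ> E) - (E \<circ> D) \<in> ?K" if "D \<in> op_alg.B n" "E \<in> op_alg.B n" for D E
  proof -
    from that have D: "D \<in> diff_op (refl_rep n)" and E: "E \<in> diff_op (refl_rep n)"
      by (simp_all only: op_alg.B_in)
    have "act_op (next_index n) D = D" using that(1) next_index_permutes[of n] by (simp add: op_alg.B_def)
    then have "twisted_tr n (D \<circ> E) = twisted_tr n (E \<circ> D)" using twisted_tr_twisted[OF D E] by (simp only:)
    moreover have "twisted_tr n (((D \<circ> E) - (E \<circ> D)) + (E \<circ> D)) = twisted_tr n ((D \<circ> E) - (E \<circ> D)) + twisted_tr n (E \<circ> D)"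
      by (intro twisted_tr_add op_alg.diff_in op_alg.mul_in D E)
    ultimately have "twisted_tr n ((D \<circ> E) - (E \<circ> D)) = 0" by (simp only: diff_add_cancel) simp
    moreover have "(D \<circ> E) - (E \<circ> D) \<in> diff_op (refl_rep n)" by (intro op_alg.diff_in op_alg.mul_in D E)
    ultimately show ?thesis by blast
  qed
  then have S_K: "?S \<subseteq> ?K" unfolding inv_diff_op_eq by blast
  have "twisted_tr n 0 = 0" using twisted_tr_scale[of 0 n 0] by simp
  then have "csubspace ?K" by (simp add: complex_vector.subspace_def twisted_tr_add twisted_tr_scale)
  with S_K have K: "cspan ?S \<subseteq> ?K" by (intro complex_vector.span_minimal)
  show ?thesis
    unfolding HH0_def
  proof (rule one_dimensional_quotient(2))
    show "csubspace (inv_diff_op n)" unfolding inv_diff_op_eq by (rule op_alg.B_subspace)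
    show "csubspace (cspan ?S)" by (rule complex_vector.subspace_span)
    have "?S \<subseteq> inv_diff_op n" unfolding inv_diff_op_eq using op_alg.br_B by blast
    then show "cspan ?S \<subseteq> inv_diff_op n"
      unfolding inv_diff_op_eq by (intro complex_vector.span_minimal op_alg.B_subspace)
    show "?e \<in> inv_diff_op n" unfolding inv_diff_op_eq by (rule op_alg.e_B)
    show "?e \<notin> cspan ?S" using K twisted_tr_id[of n] by auto
    have "insert ?e ?S \<subseteq> insert ?e (cspan ?S)"
      using complex_vector.span_superset[of ?S] by blast
    then show "inv_diff_op n \<subseteq> cspan (insert ?e (cspan ?S))"
      using op_alg.invariants_spanned[of n] complex_vector.span_mono unfolding inv_diff_op_eq by blast
  qed
qed

theorem corollary1p1p12:
  fixes n :: nat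
  assumes "n \<ge> 1"
  shows "HP0 (inv_poly_fun n) (poisson (refl_rep n)) \<cong>\<^sub>C complex_line \<and>
         complex_line \<cong>\<^sub>C HH0 (inv_diff_op n) (\<circ>)"
  using HP0_line HH0_line by blast

end
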